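(* Let $\Gamma$ be the $3$-regular tree, $\Gamma_0$ its edge graph with graph distance $d$, and $\Sigma=[3-2\sqrt2,3+2\sqrt2]$. With $\tilde P_6$, $\tilde P_\lambda$, $\mu$, $b(\lambda)$ and the modified mean inner product $\langle\cdot,\cdot\rangle_M$ as in the context, for $F\in\ell^2(\Gamma_0)$, for $\mu$-a.e. $\lambda$ in $\Sigma$, $\langle\tilde P_\lambda F,\tilde P_\lambda F\rangle_M$ exists, and $$\|F\|^2_{\ell^2(\Gamma_0)}=\|\tilde P_6F\|_2^2+\int_\Sigma\langle\tilde P_\lambda F,\tilde P_\lambda F\rangle_M\,36\,b(\lambda)^{-1}\,d\mu(\lambda).$$
   Context: The edge graph $\Gamma_0$ has the edges of $\Gamma$ as vertices, two being adjacent if and only if they share an endpoint (it is $4$-regular). $\Delta_{\Gamma_0}F(x)=\sum_{y\sim x}(F(y)-F(x))$. The modified mean inner product on $\Gamma_0$ is $$\langle f,g\rangle_M=\lim_{N\to\infty}\frac1N\sum_{x\in\Gamma_0,\ d(x,x_0)\le N}f(x)\overline{g(x)},$$ where $x_0\in\Gamma_0$ is a base point (it is used for eigenfunctions for which the limit exists and is independent of $x_0$). $\tilde P_6$ is the orthogonal projection of $\ell^2(\Gamma_0)$ onto the space of $\ell^2$ eigenfunctions of $-\Delta_{\Gamma_0}$ with eigenvalue $6$, given by $\tilde P_6F(x)=\sum_y\frac13\left(-\frac12\right)^{d(x,y)}F(y)$. For $z\in\mathbb C$ with $2^{2z-1}\neq1$: $c(z)=\frac13\,\frac{2^{1-z}-2^{z-1}}{2^{-z}-2^{z-1}}$,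 $\varphi_z(n)=c(z)2^{-nz}+c(1-z)2^{-n(1-z)}$, and $\psi_z(n)=2\varphi_z(n)+\varphi_z(n+1)+\varphi_z(n-1)$. The parameters $t\in[0,\frac\pi{\log2}]$ and $\lambda\in\Sigma$ are related by $\lambda=3-2\sqrt2\cos(t\log2)$, and $$\tilde P_\lambda F(x)=\frac1{3(6-\lambda)}\sum_y\psi_{\frac12+it}(d(x,y))F(y).$$ The function $b$ is $b(\lambda)=8+\frac1{\sin^2(t\log2)}=8\left(\frac{-\lambda^2+6\lambda}{-\lambda^2+6\lambda-1}\right)$. The spectral measure $\mu$ on $\Sigma$ is $$d\mu(\lambda)=\frac{3\sqrt{-\lambda^2+6\lambda-1}}{\sqrt2\,\pi(-\lambda^2+6\lambda+3)}\,d\lambda .$$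
   Formalization: The printed density of μ makes the identity false (F = indicator of one edge gives 0.533, not 1); it is replaced by 9√(−λ²+6λ−1)/(2π(−λ²+6λ)). For general F in ℓ², the sum defining P̃_λF(x) is taken as an unconditionally convergent series in L²(μ). *)

theory Defs
  imports "HOL-Analysis.Analysis"
begin

definition simple_graph :: "'v set \<Rightarrow> 'v set set \<Rightarrow> bool" where
  "simple_graph V E \<longleftrightarrow> (\<forall>e\<in>E. \<exists>u\<in>V. \<exists>v\<in>V. u \<noteq> v \<and> e = {u, v})"

definition connected_graph :: "'v set \<Rightarrow> 'v set set \<Rightarrow> bool" where
  "connected_graph V E \<longleftrightarrow> V \<noteq> {} \<and> (\<forall>u\<in>V. \<forall>v\<in>V. (\<lambda>a b. {a, b} \<in> E)\<^sup>*\<^sup>* u v)"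

definition acyclic_graph :: "'v set set \<Rightarrow> bool" where
  "acyclic_graph E \<longleftrightarrow>
     \<not> (\<exists>vs. length vs \<ge> 3 \<and> distinct vs \<and>
          (\<forall>i<length vs. {vs ! i, vs ! (Suc i mod length vs)} \<in> E))"

definition regular_tree :: "nat \<Rightarrow> 'v set \<Rightarrow> 'v set set \<Rightarrow> bool" where
  "regular_tree k V E \<longleftrightarrow>
     simple_graph V E \<and> connected_graph V E \<and> acyclic_graph E \<and>
     (\<forall>v\<in>V. card {e\<in>E. v \<in> e} = k)"

text \<open>The edge graph of \<open>(V, E)\<close> has vertex set \<open>E\<close>, so functions on it are
  functions on \<open>E\<close>.\<close>

definition edge_adj :: "'v set set \<Rightarrow> 'v set \<Rightarrow> 'v set \<Rightarrow> bool" where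
  "edge_adj E x y \<longleftrightarrow> x \<in> E \<and> y \<in> E \<and> x \<noteq> y \<and> x \<inter> y \<noteq> {}"

definition edge_dist :: "'v set set \<Rightarrow> 'v set \<Rightarrow> 'v set \<Rightarrow> nat" where
  "edge_dist E x y = (LEAST n. (edge_adj E ^^ n) x y)"

definition in_l2 :: "'v set set \<Rightarrow> ('v set \<Rightarrow> complex) \<Rightarrow> bool" where
  "in_l2 E F \<longleftrightarrow> (\<lambda>x. (cmod (F x))\<^sup>2) summable_on E"

definition l2_norm_sq :: "'v set set \<Rightarrow> ('v set \<Rightarrow> complex) \<Rightarrow> real" where
  "l2_norm_sq E F = (\<Sum>\<^sub>\<infinity>x\<in>E. (cmod (F x))\<^sup>2)"

definition has_mean_inner ::
  "'v set set \<Rightarrow> ('v set \<Rightarrow> complex) \<Rightarrow> ('v set \<Rightarrow> complex) \<Rightarrow> complex \<Rightarrow> bool" where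
  "has_mean_inner E f g L \<longleftrightarrow>
     (\<forall>x0\<in>E. (\<lambda>N. (1 / of_nat N) * (\<Sum>x | x \<in> E \<and> edge_dist E x x0 \<le> N. f x * cnj (g x)))
        \<longlonglongrightarrow> L)"

definition mean_inner ::
  "'v set set \<Rightarrow> ('v set \<Rightarrow> complex) \<Rightarrow> ('v set \<Rightarrow> complex) \<Rightarrow> complex" where
  "mean_inner E f g = (THE L. has_mean_inner E f g L)"

definition P6 :: "'v set set \<Rightarrow> ('v set \<Rightarrow> complex) \<Rightarrow> 'v set \<Rightarrow> complex" where
  "P6 E F x = (\<Sum>\<^sub>\<infinity>y\<in>E. 1/3 * (- 1/2) ^ edge_dist E x y * F y)"

definition cfun :: "complex \<Rightarrow> complex" where
  "cfun z = 1/3 * ((2 powr (1 - z) - 2 powr (z - 1)) / (2 powr (- z) - 2 powr (z - 1)))"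

text \<open>The index is an integer because \<open>psi z 0\<close> involves \<open>phi z (- 1)\<close>.\<close>

definition phi :: "complex \<Rightarrow> int \<Rightarrow> complex" where
  "phi z n = cfun z * 2 powr (- of_int n * z) + cfun (1 - z) * 2 powr (- of_int n * (1 - z))"

definition psi :: "complex \<Rightarrow> int \<Rightarrow> complex" where
  "psi z n = 2 * phi z n + phi z (n + 1) + phi z (n - 1)"

definition Sig :: "real set" where
  "Sig = {3 - 2 * sqrt 2 .. 3 + 2 * sqrt 2}"

definition t_of :: "real \<Rightarrow> real" where
  "t_of lam = arccos ((3 - lam) / (2 * sqrt 2)) / ln 2"

lemma t_of_correct:
  assumes "lam \<in> Sig"
  shows "t_of lam \<in> {0 .. pi / ln 2}" "lam = 3 - 2 * sqrt 2 * cos (t_of lam * ln 2)"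
proof -
  have r: "- 1 \<le> (3 - lam) / (2 * sqrt 2)" "(3 - lam) / (2 * sqrt 2) \<le> 1"
    using assms by (auto simp: Sig_def field_simps)
  show "t_of lam \<in> {0 .. pi / ln 2}"
    using arccos_bounded[OF r] by (auto simp: t_of_def field_simps)
  show "lam = 3 - 2 * sqrt 2 * cos (t_of lam * ln 2)"
    using cos_arccos[OF r] by (simp add: t_of_def)
qed

definition bfun :: "real \<Rightarrow> real" where
  "bfun lam = 8 + 1 / (sin (t_of lam * ln 2))\<^sup>2"

lemma bfun_eq:
  assumes "lam \<in> Sig" "- lam\<^sup>2 + 6 * lam - 1 \<noteq> 0"
  shows "bfun lam = 8 * ((- lam\<^sup>2 + 6 * lam) / (- lam\<^sup>2 + 6 * lam - 1))"
proof -
  define c where "c = cos (t_of lam * ln 2)"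
  have l: "3 - lam = 2 * sqrt 2 * c"
    using t_of_correct(2)[OF assms(1)] by (simp add: c_def)
  have "(3 - lam)\<^sup>2 = 8 * c\<^sup>2"
    unfolding l by (simp add: power_mult_distrib)
  hence s: "(sin (t_of lam * ln 2))\<^sup>2 = (- lam\<^sup>2 + 6 * lam - 1) / 8"
    unfolding sin_squared_eq c_def[symmetric] by (simp add: power2_eq_square algebra_simps)
  show ?thesis
    unfolding bfun_def s using assms(2) by (simp add: field_simps)
qed

text \<open>
  The spectral measure, i.e. the measure for which \<open>F = P6 F + \<integral> P_lambda F d mu(lambda)\<close>
  with \<open>P_lambda\<close> normalised by the factor \<open>1 / (3 (6 - lambda))\<close> as in \<open>Pker\<close> below.  It is
  \<open>3\<close> times the Plancherel measure
  \<open>(log 2 / (3 pi)) |c(1/2 + i t)|^(-2) dt = (12 log 2 / (pi b)) dt\<close> of the \<open>3\<close>-regular tree.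

  The density \<open>3 sqrt(-lambda^2 + 6 lambda - 1) / (sqrt 2 pi (-lambda^2 + 6 lambda + 3))\<close> found
  in the literature is a miscalculation of this measure.  The normalisation is forced: for
  \<open>F\<close> the indicator function of a single edge one has \<open>\<parallel>P6 F\<parallel>\<^sup>2 = 1/3\<close>, and the mean inner
  product of \<open>P_lambda F\<close> with itself is \<open>b(lambda) / 162\<close>, so that the total mass has to be
  \<open>3\<close>; the other density has total mass \<open>(3 / sqrt 2) (1 - 1 / sqrt 3) = 0.896\<dots>\<close>.
\<close>

definition mu_density :: "real \<Rightarrow> real" where
  "mu_density lam = 9 * sqrt (- lam\<^sup>2 + 6 * lam - 1) / (2 * pi * (- lam\<^sup>2 + 6 * lam))"

definition mu :: "real measure" where
  "mu = density lborel (\<lambda>lam. ennreal (indicator Sig lam * mu_density lam))"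

definition Pker :: "'v set set \<Rightarrow> real \<Rightarrow> 'v set \<Rightarrow> 'v set \<Rightarrow> complex" where
  "Pker E lam x y =
     1 / (3 * (6 - of_real lam)) * psi (Complex (1/2) (t_of lam)) (int (edge_dist E x y))"

text \<open>
  \<open>is_Plam E F G\<close> says that \<open>(\<lambda>lam. G lam)\<close> is (a version of) the family of the
  \<open>P_lambda F\<close>, where \<open>P_lambda F x = (\<Sum>y. Pker E lambda x y * F y)\<close>.  For \<open>F\<close> of finite
  support this is a finite sum.  For general \<open>F\<close> in \<open>l2\<close> and fixed \<open>lambda\<close> the series need not
  converge, because \<open>Pker E lambda x\<close> does not belong to \<open>l2\<close>; as for the Fourier transform,
  it has to be taken as a (unconditionally) convergent series in \<open>L2(mu)\<close>, for every \<open>x\<close>,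
  which determines \<open>G lambda\<close> for \<open>mu\<close>-almost every \<open>lambda\<close>.
\<close>

definition is_Plam ::
  "'v set set \<Rightarrow> ('v set \<Rightarrow> complex) \<Rightarrow> (real \<Rightarrow> 'v set \<Rightarrow> complex) \<Rightarrow> bool" where
  "is_Plam E F G \<longleftrightarrow>
     (\<forall>x\<in>E. (\<lambda>lam. G lam x) \<in> borel_measurable mu \<and>
        ((\<lambda>A. \<integral>\<^sup>+ lam. ennreal ((cmod (G lam x - (\<Sum>y\<in>A. Pker E lam x y * F y)))\<^sup>2) \<partial>mu)
           \<longlongrightarrow> 0) (finite_subsets_at_top E))"

end

(*
  Put r = 2 powr (-z) with Re z = 1/2.  The outgoing wave v(x) = sum_y F(y) r^d(x,y) of a finitely
  supported F satisfies T v = (4 - lambda) v - s F for the adjacency operator T, so Green's identity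
  on large balls gives  sum_{|x| = n} |v(x)|^2 = 9 <P_lambda F, F>  for all large n.  Since
  P_lambda F = a v + cnj a v', with v' the wave of cnj r, the mean of |P_lambda F|^2 is computed from
  this, the cross term being a rotating geometric sequence; it equals b(lambda)/36 <P_lambda F, F>.
  The "boundary measure" of an eigenfunction u has square sums over spheres that increase
  with the radius, which bounds sum_{|x| = n} |P_lambda F|^2 by C(lambda) <P_lambda F, F> uniformly
  in n.  Along finite truncations of F in l2 that converge fast enough, <P_lambda ., .> is
  Cauchy for almost every lambda, and the uniform bound carries the mean value to the limit.
  The integral of <P_lambda F, F> over mu is |F|^2 - |P6 F|^2, by computing the integral of the kernel.
*)
theory Submission
  imports Defs "HOL-Real_Asymp.Real_Asymp"
begin

section \<open>Distances in the edge graph of the cubic tree\<close>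

text \<open>The exact sphere formulas hold only beyond the support of a truncation, and that support
  grows with the truncation. They leave the spheres in between uncontrolled, so alone they do not
  allow the limits over the radius and over the truncation to be interchanged. The boundary measure
  closes this gap: its square sums are known far out and can only be smaller further in. Using it
  for both \<open>r\<close> and \<open>cnj r\<close> recovers the eigenfunction as a difference, at
  the price of dividing by \<open>Im r\<close>, which vanishes only at the ends of the spectrum. The
  far-sphere identity also shows that the form of P_lambda, whose kernel has no visible sign, is a
  squared norm; positivity, triangle inequality and Cauchy-Schwarz all come from it. The tree enters
  mainly through one local fact: seen from a fixed edge, another edge has one nearer neighbour, one
  at its own distance and two farther ones. The integral of the kernel reduces, by
  \<open>lam = 3 - 2 * sqrt 2 * cos x\<close>, to Fourier coefficients of the Poisson kernel of
  radius 1/2.\<close>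

lemma rtranclp_imp_distinct_path:
  assumes "R\<^sup>*\<^sup>* a b"
  shows "\<exists>vs. vs \<noteq> [] \<and> hd vs = a \<and> last vs = b \<and> distinct vs \<and> successively R vs"
  using assms
proof (induction rule: converse_rtranclp_induct)
  case base
  show ?case by (rule exI[of _ "[b]"]) auto
next
  case (step a c)
  then obtain vs where vs: "vs \<noteq> []" "hd vs = c" "last vs = b" "distinct vs" "successively R vs"
    by auto
  show ?case
  proof (cases "a \<in> set vs")
    \<comment> \<open>Loop erasure: if \<open>a\<close> already occurs on the path, everything
      before its occurrence is dropped.\<close>
    case True
    then obtain xs ys where s: "vs = xs @ a # ys" by (meson split_list)
    show ?thesis
      using vs unfolding s by (intro exI[of _ "a # ys"]) (auto simp: successively_append_iff)
  next
    case False
    show ?thesis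
      using vs False step(1) by (intro exI[of _ "a # vs"]) (auto simp: successively_Cons)
  qed
qed

locale cubic_tree =
  fixes V :: "'v set" and E :: "'v set set"
  assumes tree: "regular_tree 3 V E"
begin

abbreviation D :: "'v set \<Rightarrow> 'v set \<Rightarrow> nat" where "D \<equiv> edge_dist E"

definition star :: "'v \<Rightarrow> 'v set set" where "star v = {e \<in> E. v \<in> e}"

definition nbrs :: "'v set \<Rightarrow> 'v set set" where "nbrs e = {z. edge_adj E e z}"

text \<open>Reachability in the edge graph with the vertex \<open>e\<close> deleted. For edges
  different from \<open>e\<close> it means lying on the same side of \<open>e\<close> in the tree,
  which is how acyclicity enters the distance computations.\<close>

definition linked :: "'v set \<Rightarrow> 'v set \<Rightarrow> 'v set \<Rightarrow> bool" where
  "linked e = (\<lambda>f g. edge_adj E f g \<and> f \<noteq> e \<and> g \<noteq> e)\<^sup>*\<^sup>*"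

section \<open>Ends of edges, stars and the degree of the edge graph\<close>

lemma edge_ends:
  assumes "e \<in> E"
  obtains a b where "a \<in> V" "b \<in> V" "a \<noteq> b" "e = {a, b}"
  using assms tree unfolding regular_tree_def simple_graph_def by blast

lemma other_end: "e \<in> E \<Longrightarrow> v \<in> e \<Longrightarrow> \<exists>c. e = {c, v} \<and> c \<noteq> v"
  by (erule edge_ends) auto

lemma edge_eqI: "e \<in> E \<Longrightarrow> a \<in> e \<Longrightarrow> b \<in> e \<Longrightarrow> a \<noteq> b \<Longrightarrow> e = {a, b}"
  by (erule edge_ends) auto

lemma card_star: "v \<in> V \<Longrightarrow> card (star v) = 3"
  using tree unfolding regular_tree_def star_def by auto

lemma finite_star: "v \<in> V \<Longrightarrow> finite (star v)"
  using card_star[of v] by (metis card.infinite numeral_3_eq_3 nat.distinct(1))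

lemma edge_adj_sym: "edge_adj E x y \<Longrightarrow> edge_adj E y x"
  unfolding edge_adj_def by auto

lemma nbrs_in: "z \<in> nbrs e \<Longrightarrow> z \<in> E" "z \<in> nbrs e \<Longrightarrow> e \<in> E" "z \<in> nbrs e \<Longrightarrow> z \<noteq> e"
  unfolding nbrs_def edge_adj_def by auto

lemma nbrs_sym: "z \<in> nbrs e \<longleftrightarrow> e \<in> nbrs z"
  unfolding nbrs_def using edge_adj_sym by auto

lemma nbrs_eq: "{a, b} \<in> E \<Longrightarrow> nbrs {a, b} = (star a - {{a, b}}) \<union> (star b - {{a, b}})"
  unfolding nbrs_def edge_adj_def star_def by auto

lemma star_inter: "{a, b} \<in> E \<Longrightarrow> a \<noteq> b \<Longrightarrow> star a \<inter> star b = {{a, b}}"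
  using edge_eqI unfolding star_def by blast

lemma finite_nbrs: "finite (nbrs e)"
proof (cases "e \<in> E")
  case True
  then obtain a b where "a \<in> V" "b \<in> V" "e = {a, b}" by (metis edge_ends)
  with True show ?thesis using nbrs_eq[of a b] finite_star by auto
qed (auto simp: nbrs_def edge_adj_def)

lemma card_nbrs:
  assumes "e \<in> E" shows "card (nbrs e) = 4"
proof -
  obtain a b where ab: "a \<in> V" "b \<in> V" "a \<noteq> b" "e = {a, b}" using assms by (metis edge_ends)
  have m: "e \<in> star a" "e \<in> star b" using ab assms by (auto simp: star_def)
  have "card (nbrs e) = card (star a - {e}) + card (star b - {e})"
    unfolding ab(4)
    by (subst nbrs_eq, use assms ab in simp, subst card_Un_disjoint)
       (use ab star_inter[of a b] assms finite_star in auto)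
  thus ?thesis using m ab by (simp add: card_star)
qed

text \<open>Acyclicity in the form that every edge is a bridge: a distinct path from
  \<open>a\<close> to \<open>b\<close> avoiding the edge would close up to a cycle through
  it.\<close>

lemma no_detour:
  assumes e: "{a, b} \<in> E" "a \<noteq> b"
  shows "\<not> (\<lambda>u v. {u, v} \<in> E - {{a, b}})\<^sup>*\<^sup>* a b"
proof
  assume "(\<lambda>u v. {u, v} \<in> E - {{a, b}})\<^sup>*\<^sup>* a b"
  from rtranclp_imp_distinct_path[OF this] obtain vs where
    vs: "vs \<noteq> []" "hd vs = a" "last vs = b" "distinct vs"
        "successively (\<lambda>u v. {u, v} \<in> E - {{a, b}}) vs" by auto
  \<comment> \<open>A single vertex would give \<open>a = b\<close>, and two vertices would use the
    excluded edge itself.\<close>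
  have len: "length vs \<ge> 3"
  proof (rule ccontr)
    assume "\<not> length vs \<ge> 3"
    then consider "length vs = 1" | "length vs = 2" using vs(1)
      by (metis One_nat_def Suc_1 leI le_SucE length_0_conv less_2_cases_iff numeral_3_eq_3
          less_Suc_eq not_less_eq_eq)
    thus False
    proof cases
      case 1
      then obtain x where "vs = [x]" by (metis One_nat_def length_0_conv length_Suc_conv)
      thus False using vs e by auto
    next
      case 2
      then obtain x y where "vs = [x, y]"
        by (metis One_nat_def Suc_1 length_0_conv length_Suc_conv)
      thus False using vs e by auto
    qed
  qed
  have "{vs ! i, vs ! (Suc i mod length vs)} \<in> E" if i: "i < length vs" for i
  proof (cases "Suc i = length vs")
    \<comment> \<open>The closing step, from the last vertex back to the first, is the excluded
      edge.\<close>
    case True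
    hence "vs ! i = b" "vs ! (Suc i mod length vs) = a" using vs(1-3)
      by (auto simp: last_conv_nth hd_conv_nth simp flip: True)
    thus ?thesis using e by (simp add: insert_commute)
  next
    case False
    thus ?thesis using i vs(5) by (auto simp: successively_conv_nth)
  qed
  hence "\<not> acyclic_graph E" unfolding acyclic_graph_def using len vs(4) by blast
  thus False using tree by (auto simp: regular_tree_def)
qed

section \<open>The two sides of an edge\<close>

lemma linked_sym: "linked e f g \<Longrightarrow> linked e g f"
  unfolding linked_def
  by (rule sympD[OF symp_rtranclp]) (auto simp: symp_def edge_adj_sym)

lemma linked_trans: "linked e f g \<Longrightarrow> linked e g h \<Longrightarrow> linked e f h"
  unfolding linked_def by (rule rtranclp_trans)

lemma linked_step: "edge_adj E f g \<Longrightarrow> f \<noteq> e \<Longrightarrow> g \<noteq> e \<Longrightarrow> linked e f g"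
  unfolding linked_def by (rule r_into_rtranclp) auto

text \<open>Consecutive edges share a vertex, so a chain of edges avoiding \<open>e\<close> yields a
  walk through their ends that avoids \<open>e\<close> as well. This carries the bridge property
  over to the edge graph.\<close>

lemma linked_vertices:
  assumes "linked e f g" "f \<in> E" "f \<noteq> e" "a \<in> f" "b \<in> g"
  shows "(\<lambda>u v. {u, v} \<in> E - {e})\<^sup>*\<^sup>* a b"
  using assms(1,5) unfolding linked_def
proof (induction arbitrary: b rule: rtranclp_induct)
  case base
  show ?case
  proof (cases "a = b")
    case False
    hence "f = {a, b}" using edge_eqI assms base by auto
    thus ?thesis using assms by (intro r_into_rtranclp) auto
  qed auto
next
  case (step g h)
  then obtain c where c: "c \<in> g" "c \<in> h" unfolding edge_adj_def by auto
  have h: "h \<in> E" "h \<noteq> e" using step by (auto simp: edge_adj_def)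
  have ac: "(\<lambda>u v. {u, v} \<in> E - {e})\<^sup>*\<^sup>* a c" using step c by auto
  show ?case
  proof (cases "c = b")
    case False
    hence "h = {c, b}" using edge_eqI[of h c b] h c step by auto
    thus ?thesis using ac h by (auto intro: rtranclp.rtrancl_into_rtrancl)
  qed (use ac in auto)
qed

lemma not_linked:
  assumes "{a, b} \<in> E" "a \<noteq> b" "f \<in> E" "f \<noteq> {a, b}" "a \<in> f" "b \<in> g"
  shows "\<not> linked {a, b} f g"
  using linked_vertices[OF _ assms(3-6)] no_detour[OF assms(1,2)] by auto

lemma edge_connected:
  assumes "x \<in> E" "y \<in> E"
  shows "(edge_adj E)\<^sup>*\<^sup>* x y"
proof -
  obtain a where a: "a \<in> x" "a \<in> V" using assms edge_ends by blast
  obtain b where b: "b \<in> y" "b \<in> V" using assms edge_ends by blast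
  have "(\<lambda>a b. {a, b} \<in> E)\<^sup>*\<^sup>* a b"
    using tree a b unfolding regular_tree_def connected_graph_def by auto
  \<comment> \<open>The claim covers every edge at the current vertex, because the target edge need
    not be the one along which the walk arrives.\<close>
  hence "\<forall>z\<in>E. b \<in> z \<longrightarrow> (edge_adj E)\<^sup>*\<^sup>* x z"
  proof (induction rule: rtranclp_induct)
    case base
    show ?case
    proof (intro ballI impI)
      fix z assume "z \<in> E" "a \<in> z"
      hence "x = z \<or> edge_adj E x z" using a assms unfolding edge_adj_def by auto
      thus "(edge_adj E)\<^sup>*\<^sup>* x z" by auto
    qed
  next
    case (step b c)
    show ?case
    proof (intro ballI impI)
      fix z assume z: "z \<in> E" "c \<in> z"
      have "(edge_adj E)\<^sup>*\<^sup>* x {b, c}" using step by auto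
      moreover have "{b, c} = z \<or> edge_adj E {b, c} z"
        using z step unfolding edge_adj_def by auto
      ultimately show "(edge_adj E)\<^sup>*\<^sup>* x z"
        by (metis rtranclp.rtrancl_into_rtrancl)
    qed
  qed
  thus ?thesis using assms b by auto
qed

section \<open>Distances seen from a fixed edge\<close>

lemma D_le: "(edge_adj E ^^ n) x y \<Longrightarrow> D x y \<le> n"
  unfolding edge_dist_def by (rule Least_le)

lemma D_attain:
  assumes "x \<in> E" "y \<in> E" shows "(edge_adj E ^^ D x y) x y"
  unfolding edge_dist_def
  using rtranclp_imp_relpowp[OF edge_connected[OF assms]] by (rule LeastI_ex)

lemma D_self [simp]: "D x x = 0"
  using D_le[of 0 x x] by simp

lemma D_eq_0 [simp]: "x \<in> E \<Longrightarrow> y \<in> E \<Longrightarrow> D x y = 0 \<longleftrightarrow> x = y"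
  using D_attain[of x y] by auto

lemma relpowp_edge_adj_sym: "(edge_adj E ^^ n) x y \<Longrightarrow> (edge_adj E ^^ n) y x"
proof (induction n arbitrary: y)
  case (Suc n)
  then obtain z where "(edge_adj E ^^ n) x z" "edge_adj E z y" by (auto elim: relpowp_Suc_E)
  thus ?case using Suc.IH edge_adj_sym by (metis relpowp_Suc_I2)
qed auto

lemma D_sym: "D x y = D y x"
  unfolding edge_dist_def by (rule arg_cong[of _ _ Least]) (use relpowp_edge_adj_sym in blast)

lemma D_step: "x \<in> E \<Longrightarrow> edge_adj E y z \<Longrightarrow> D x z \<le> Suc (D x y)"
  using D_le[OF relpowp_Suc_I[OF D_attain]] by (auto simp: edge_adj_def)

lemma D_pred:
  assumes "x \<in> E" "y \<in> E" "x \<noteq> y"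
  obtains z where "edge_adj E z y" "D x y = Suc (D x z)"
proof -
  obtain m where m: "D x y = Suc m" using assms by (metis D_eq_0 not0_implies_Suc)
  then obtain z where z: "(edge_adj E ^^ m) x z" "edge_adj E z y"
    using D_attain[OF assms(1,2)] by (auto elim: relpowp_Suc_E)
  have "D x z \<le> m" using z D_le by auto
  moreover have "Suc m \<le> Suc (D x z)" using D_step[OF assms(1) z(2)] m by auto
  ultimately show ?thesis using that z m by auto
qed

lemma D_nbrs: "z \<in> nbrs x \<Longrightarrow> D x z = 1"
proof -
  assume z: "z \<in> nbrs x"
  hence "D x z \<le> Suc (D x x)" by (intro D_step) (auto simp: nbrs_def edge_adj_def)
  moreover have "D x z \<noteq> 0" using z nbrs_in[OF z] by auto
  ultimately show ?thesis by auto
qed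

text \<open>A geodesic from \<open>x\<close> to \<open>y\<close> meets only edges that are nearer to
  \<open>x\<close> than \<open>e\<close>, hence never \<open>e\<close> itself.\<close>

lemma linked_of_D_less:
  assumes "x \<in> E" "y \<in> E" "D x y < D x e"
  shows "linked e x y"
  using assms(2,3)
proof (induction "D x y" arbitrary: y)
  case 0
  thus ?case using assms by (auto simp: linked_def)
next
  case (Suc n)
  hence "x \<noteq> y" by auto
  then obtain z where z: "edge_adj E z y" "D x y = Suc (D x z)" using D_pred Suc assms by metis
  have "linked e x z" using Suc z by (auto simp: edge_adj_def)
  moreover have "linked e z y" using z Suc by (intro linked_step) auto
  ultimately show ?case by (rule linked_trans)
qed

text \<open>The edge \<open>g\<close> witnesses that \<open>x\<close> lies on the side of
  \<open>a\<close>. Were \<open>f\<close> no farther than \<open>{a, b}\<close>, its predecessor on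
  a geodesic would be nearer than \<open>{a, b}\<close> and so linked with \<open>x\<close>; this
  would put \<open>f\<close> on the side of \<open>a\<close> too, against the bridge
  property.\<close>

lemma D_cross:
  assumes x: "x \<in> E" "x \<noteq> {a, b}" and e: "{a, b} \<in> E" "a \<noteq> b"
    and g: "linked {a, b} x g" "g \<in> E" "g \<noteq> {a, b}" "a \<in> g"
    and f: "f \<in> E" "f \<noteq> {a, b}" "b \<in> f"
  shows "D x f = Suc (D x {a, b})"
proof -
  have "edge_adj E {a, b} f" using e f by (auto simp: edge_adj_def)
  hence 1: "D x f \<le> Suc (D x {a, b})" using D_step x by auto
  have nl: "\<not> linked {a, b} x f"
    using not_linked[OF e g(2-4) f(3)] linked_trans[OF linked_sym[OF g(1)]] by blast
  have "D x f > D x {a, b}"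
  proof (rule ccontr)
    assume le: "\<not> D x f > D x {a, b}"
    have pos: "D x {a, b} > 0" using x e by auto
    show False
    proof (cases "x = f")
      case True thus False using nl by (auto simp: linked_def)
    next
      case False
      then obtain z where z: "edge_adj E z f" "D x f = Suc (D x z)"
        using D_pred[OF x(1) f(1)] by blast
      have zE: "z \<in> E" using z by (auto simp: edge_adj_def)
      have "linked {a, b} x z" using linked_of_D_less[OF x(1) zE, of "{a, b}"] z le by auto
      moreover have "z \<noteq> {a, b}" using z le by auto
      ultimately have "linked {a, b} x f"
        using linked_step[OF z(1) _ f(2)] linked_trans by blast
      thus False using nl by auto
    qed
  qed
  with 1 show ?thesis by auto
qed

text \<open>A predecessor \<open>g\<close> of the nearest edge \<open>e1\<close> cannot contain
  \<open>v\<close>, since it would be a nearer edge at \<open>v\<close>. So it meets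
  \<open>e1\<close> at the other end, and the remaining edges at \<open>v\<close> lie across
  \<open>e1\<close>.\<close>

lemma star_nearest:
  assumes y: "y \<in> E" and v: "v \<in> V"
  obtains e1 where "e1 \<in> star v" "\<And>f. f \<in> star v \<Longrightarrow> f \<noteq> e1 \<Longrightarrow> D y f = Suc (D y e1)"
proof -
  have "star v \<noteq> {}" using card_star[OF v] by auto
  then obtain e1 where e1: "e1 \<in> star v" "\<And>f. f \<in> star v \<Longrightarrow> D y e1 \<le> D y f"
    using arg_min_if_finite(1)[OF finite_star[OF v], of "D y"]
      arg_min_least[OF finite_star[OF v], of _ "D y"] by blast
  have e1E: "e1 \<in> E" "v \<in> e1" using e1 by (auto simp: star_def)
  have "D y f = Suc (D y e1)" if f: "f \<in> star v" "f \<noteq> e1" for f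
  proof (cases "y = e1")
    case True
    hence "f \<in> nbrs y" using f e1E by (auto simp: nbrs_def edge_adj_def star_def)
    thus ?thesis using D_nbrs True by auto
  next
    case False
    then obtain g where g: "edge_adj E g e1" "D y e1 = Suc (D y g)" using D_pred[OF y e1E(1)] by blast
    have gE: "g \<in> E" "g \<noteq> e1" using g by (auto simp: edge_adj_def)
    have gv: "v \<notin> g" using e1(2)[of g] g gE by (auto simp: star_def)
    obtain c where c: "e1 = {c, v}" "c \<noteq> v" using other_end[OF e1E] by metis
    have cg: "c \<in> g" using g gv c by (auto simp: edge_adj_def)
    have "linked e1 y g" using linked_of_D_less[OF y gE(1), of e1] g by auto
    thus ?thesis using D_cross[of y c v g f] False e1E y gE cg c f by (auto simp: star_def)
  qed
  thus ?thesis using that e1 by blast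
qed

lemma star_split:
  assumes y: "y \<in> E" and v: "v \<in> V"
  obtains e1 e2 e3 where "star v = {e1, e2, e3}" "distinct [e1, e2, e3]"
    "D y e2 = Suc (D y e1)" "D y e3 = Suc (D y e1)"
proof -
  obtain e1 where e1: "e1 \<in> star v" "\<And>f. f \<in> star v \<Longrightarrow> f \<noteq> e1 \<Longrightarrow> D y f = Suc (D y e1)"
    using star_nearest[OF y v] by blast
  have "card (star v - {e1}) = 2" using e1 card_star[OF v] by simp
  then obtain e2 e3 where e: "star v - {e1} = {e2, e3}" "e2 \<noteq> e3" by (auto simp: card_2_iff)
  have s: "star v = {e1, e2, e3}" using insert_Diff[OF e1(1)] e(1) by simp
  have m: "e2 \<in> star v - {e1}" "e3 \<in> star v - {e1}" unfolding e by auto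
  hence "distinct [e1, e2, e3]" using e(2) by auto
  moreover have "D y e2 = Suc (D y e1)" "D y e3 = Suc (D y e1)" using m e1(2) by blast+
  ultimately show ?thesis using that s by blast
qed

text \<open>The local picture behind the later computations. The edge graph consists of triangles,
  one for each vertex of the tree. Seen from \<open>y\<close>, the triangle at the near end
  \<open>a\<close> contains the parent \<open>g\<close> and a sibling \<open>h\<close>; the triangle
  at the far end \<open>b\<close> has \<open>e\<close> as its nearest edge and therefore contributes
  two children.\<close>

lemma edge_split:
  assumes y: "y \<in> E" and e: "e \<in> E" and ne: "y \<noteq> e"
  obtains a b g h c1 c2 where "e = {a, b}" "a \<noteq> b" "a \<in> V" "b \<in> V"
    "star a = {e, g, h}" "star b = {e, c1, c2}" "distinct [e, g, h, c1, c2]"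
    "nbrs e = {g, h, c1, c2}"
    "D y e = Suc (D y g)" "D y h = D y e" "D y c1 = Suc (D y e)" "D y c2 = Suc (D y e)"
proof -
  note result = that
  have key: thesis if ab: "a \<in> V" "b \<in> V" "a \<noteq> b" "e = {a, b}"
    and g: "g \<in> star a" "D y e = Suc (D y g)" for a b g
  proof -
    have eab: "e \<in> star a" "e \<in> star b" using e ab by (auto simp: star_def)
    obtain f1 f2 f3 where f: "star a = {f1, f2, f3}" "distinct [f1, f2, f3]"
      "D y f2 = Suc (D y f1)" "D y f3 = Suc (D y f1)" using star_split[OF y ab(1)] by blast
    have m: "e \<in> {f1, f2, f3}" "g \<in> {f1, f2, f3}" using eab(1) g(1) unfolding f(1) by auto
    have f1: "f1 = g"
    proof (rule ccontr)
      assume "f1 \<noteq> g"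
      hence "D y g = Suc (D y f1)" using m(2) f(3,4) by (metis insertE singletonD)
      moreover have "D y e \<le> Suc (D y f1)" using m(1) f(3,4) by (metis insertE singletonD le_SucI order_refl)
      ultimately show False using g(2) by linarith
    qed
    have "e \<noteq> f1" using g(2) f1 by auto
    then consider "e = f2" | "e = f3" using m(1) by auto
    then have "\<exists>h. {f2, f3} = {e, h} \<and> e \<noteq> h \<and> h \<noteq> g"
    proof cases
      case 1 thus ?thesis using f(2) f1 by (intro exI[of _ f3]) auto
    next
      case 2 thus ?thesis using f(2) f1 by (intro exI[of _ f2]) auto
    qed
    then obtain h where h: "{f2, f3} = {e, h}" "e \<noteq> h" "h \<noteq> g" by (elim exE conjE)
    have sa: "star a = {e, g, h}" "distinct [e, g, h]"
      using f(1) h \<open>e \<noteq> f1\<close> f1 by auto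
    have "h \<in> {f2, f3}" using h(1) by simp
    hence sh: "D y h = D y e" using f(3,4) g(2) f1 by (metis insertE singletonD)
    obtain k1 k2 k3 where k: "star b = {k1, k2, k3}" "distinct [k1, k2, k3]"
      "D y k2 = Suc (D y k1)" "D y k3 = Suc (D y k1)" using star_split[OF y ab(2)] by blast
    \<comment> \<open>An edge at \<open>b\<close> nearer than \<open>e\<close> would be linked with
      \<open>g\<close> through \<open>y\<close>, giving a detour around the bridge
      \<open>e\<close>.\<close>
    have "k1 = e"
    proof (rule ccontr)
      assume k1: "k1 \<noteq> e"
      have "e \<in> {k1, k2, k3}" using eab(2) k(1) by simp
      hence d: "D y e = Suc (D y k1)" using k(3,4) k1 by (metis insertE singletonD)
      have kE: "k1 \<in> E" "b \<in> k1" "g \<in> E" "a \<in> g" "g \<noteq> e"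
        using k(1) g(1) sa by (auto simp: star_def)
      have "linked e y k1" "linked e y g"
        using linked_of_D_less[OF y, of _ e] d g(2) kE(1,3) by simp_all
      hence "linked e g k1" using linked_sym linked_trans by blast
      thus False using not_linked[of a b g k1] e ab(3,4) kE by simp
    qed
    hence sb: "star b = {e, k2, k3}" using k(1) by (simp only:)
    have int: "star a \<inter> star b = {e}" using star_inter[of a b] e ab(3,4) by simp
    have dist: "distinct [e, g, h, k2, k3]"
    proof -
      have "k2 \<in> star b" "k3 \<in> star b" "k2 \<noteq> e" "k3 \<noteq> e" "k2 \<noteq> k3"
        using k(1,2) \<open>k1 = e\<close> by auto
      hence "k2 \<notin> star a" "k3 \<notin> star a" using int by blast+
      thus ?thesis using sa(1,2) \<open>k2 \<noteq> k3\<close> \<open>k2 \<noteq> e\<close> \<open>k3 \<noteq> e\<close> by auto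
    qed
    have nb: "nbrs e = {g, h, k2, k3}"
    proof -
      have "nbrs e = (star a - {e}) \<union> (star b - {e})" using nbrs_eq[of a b] e ab(4) by simp
      also have "\<dots> = {g, h, k2, k3}" unfolding sa(1) sb using dist by auto
      finally show ?thesis .
    qed
    show thesis
      by (rule result[OF ab(4,3,1,2) sa(1) sb dist nb g(2) sh])
         (use k(3,4) \<open>k1 = e\<close> in auto)
  qed
  obtain a b where ab: "a \<in> V" "b \<in> V" "a \<noteq> b" "e = {a, b}" using e by (metis edge_ends)
  obtain g where g: "edge_adj E g e" "D y e = Suc (D y g)" using D_pred[OF y e ne] by blast
  have "g \<in> star a \<or> g \<in> star b" using g ab by (auto simp: edge_adj_def star_def)
  thus thesis
  proof
    assume "g \<in> star a" thus thesis using key[OF ab] g by blast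
  next
    assume "g \<in> star b"
    moreover have "e = {b, a}" using ab by auto
    ultimately show thesis using key[OF ab(2,1)] ab(3) g by blast
  qed
qed

section \<open>Spheres, children and balls\<close>

definition sphere :: "'v set \<Rightarrow> nat \<Rightarrow> 'v set set" where "sphere x n = {y \<in> E. D x y = n}"

definition children :: "'v set \<Rightarrow> 'v set \<Rightarrow> 'v set set" where
  "children x e = {c \<in> nbrs e. D x c = Suc (D x e)}"

text \<open>As \<open>y\<close> is reached from \<open>x\<close> without passing \<open>e\<close>,
  it lies on the side of the parent of \<open>e\<close>, and the child lies across \<open>e\<close>
  from it. This is what makes a wave geometric outside its support.\<close>

lemma D_child_far:
  assumes "x \<in> E" "y \<in> E" "e \<in> E" "D x y < D x e" "c \<in> children x e"
  shows "D y c = Suc (D y e)"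
proof -
  have "x \<noteq> e" "y \<noteq> e" using assms by auto
  then obtain a b g h c1 c2 where s: "e = {a, b}" "a \<noteq> b" "a \<in> V" "b \<in> V"
    "star a = {e, g, h}" "star b = {e, c1, c2}" "distinct [e, g, h, c1, c2]"
    "nbrs e = {g, h, c1, c2}"
    "D x e = Suc (D x g)" "D x h = D x e" "D x c1 = Suc (D x e)" "D x c2 = Suc (D x e)"
    using edge_split[OF assms(1,3)] by metis
  have "c \<in> {g, h, c1, c2}" "D x c = Suc (D x e)"
    using assms(5) s(8) by (auto simp: children_def)
  moreover have "D x g \<noteq> Suc (D x e)" "D x h \<noteq> Suc (D x e)" using s(9,10) by linarith+
  ultimately have "c = c1 \<or> c = c2" by blast
  hence c: "c \<in> star b" "c \<noteq> e" using s(6,7) by auto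
  have g: "g \<in> star a" "g \<noteq> e" using s(5,7) by auto
  have gE: "g \<in> E" "a \<in> g" "c \<in> E" "b \<in> c" using g c by (auto simp: star_def)
  have "linked e x y" "linked e x g"
    using linked_of_D_less[OF assms(1)] assms(2,4) gE(1) s(9) by auto
  hence "linked e y g" using linked_sym linked_trans by blast
  thus ?thesis using D_cross[of y a b g c] assms(2,3) s(1,2) c g gE \<open>y \<noteq> e\<close> by simp
qed

text \<open>The local picture extended by one generation: the neighbours of a child are its parent,
  its sibling and its own children, which is the form in which the eigenvalue equation at a child is
  used.\<close>

lemma children_split:
  assumes "x \<in> E" "e \<in> E" "x \<noteq> e"
  obtains b g h c1 c2 where "b \<in> V" "star b = {e, c1, c2}" "distinct [e, g, h, c1, c2]"
    "nbrs e = {g, h, c1, c2}" "children x e = {c1, c2}"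
    "nbrs c1 = {e, c2} \<union> children x c1" "nbrs c2 = {e, c1} \<union> children x c2"
    "D x e = Suc (D x g)" "D x h = D x e" "D x c1 = Suc (D x e)" "D x c2 = Suc (D x e)"
proof -
  obtain a b g h c1 c2 where s: "e = {a, b}" "a \<noteq> b" "a \<in> V" "b \<in> V"
    "star a = {e, g, h}" "star b = {e, c1, c2}" "distinct [e, g, h, c1, c2]"
    "nbrs e = {g, h, c1, c2}"
    "D x e = Suc (D x g)" "D x h = D x e" "D x c1 = Suc (D x e)" "D x c2 = Suc (D x e)"
    using edge_split[OF assms] by metis
  have ch: "children x e = {c1, c2}"
  proof -
    have "D x g \<noteq> Suc (D x e)" "D x h \<noteq> Suc (D x e)" using s(9,10) by linarith+
    thus ?thesis unfolding children_def s(8) using s(11,12) by auto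
  qed
  have aux: "nbrs c = {e, c'} \<union> children x c"
    if c: "c \<in> {c1, c2}" "c' \<in> {c1, c2}" "c \<noteq> c'" for c c'
  proof -
    have cs: "c \<in> star b" "c' \<in> star b" "c \<noteq> e" "c' \<noteq> e"
      using c(1,2) s(6,7) by auto
    have ds: "D x c = Suc (D x e)" "D x c' = Suc (D x e)" using c(1,2) s(11,12) by auto
    have nb: "e \<in> nbrs c" "c' \<in> nbrs c" using cs c(3) assms(2) s(1)
      by (auto simp: nbrs_def edge_adj_def star_def)
    have "c \<in> E" "x \<noteq> c" using cs(1) ds(1) by (auto simp: star_def)
    then obtain g' h' d1 d2 where n:
      "nbrs c = {g', h', d1, d2}"
      "D x c = Suc (D x g')" "D x h' = D x c" "D x d1 = Suc (D x c)" "D x d2 = Suc (D x c)"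
      using edge_split[OF assms(1), of c] by metis
    have "D x e \<noteq> D x h'" "D x e \<noteq> D x d1" "D x e \<noteq> D x d2"
      "D x c' \<noteq> D x g'" "D x c' \<noteq> D x d1" "D x c' \<noteq> D x d2" using n(2-5) ds by linarith+
    hence "g' = e" "h' = c'" using nb unfolding n(1) by blast+
    moreover have "children x c = {d1, d2}"
    proof -
      have "D x g' \<noteq> Suc (D x c)" "D x h' \<noteq> Suc (D x c)" using n(2,3) by linarith+
      thus ?thesis unfolding children_def n(1) using n(4,5) by auto
    qed
    ultimately show ?thesis using n(1) by auto
  qed
  have c12: "c1 \<noteq> c2" using s(7) by simp
  show ?thesis
    by (rule that[OF s(4,6,7,8) ch aux aux s(9-12)]) (use c12 in simp_all)
qed

lemma card_children: "x \<in> E \<Longrightarrow> e \<in> E \<Longrightarrow> x \<noteq> e \<Longrightarrow> card (children x e) = 2"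
  by (erule (2) children_split) auto

lemma children_root: "x \<in> E \<Longrightarrow> children x x = nbrs x"
  using D_nbrs by (auto simp: children_def)

lemma finite_children: "finite (children x e)"
  using finite_nbrs by (auto simp: children_def)

lemma sphere_0: "x \<in> E \<Longrightarrow> sphere x 0 = {x}"
  by (auto simp: sphere_def)

lemma sphere_Suc:
  assumes "x \<in> E" shows "sphere x (Suc n) = (\<Union>e\<in>sphere x n. children x e)"
proof
  show "sphere x (Suc n) \<subseteq> (\<Union>e\<in>sphere x n. children x e)"
  proof
    fix c assume "c \<in> sphere x (Suc n)"
    hence c: "c \<in> E" "D x c = Suc n" by (auto simp: sphere_def)
    hence "x \<noteq> c" by auto
    then obtain z where "edge_adj E z c" "D x c = Suc (D x z)" using D_pred[OF assms c(1)] by blast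
    thus "c \<in> (\<Union>e\<in>sphere x n. children x e)"
      using c by (auto simp: sphere_def children_def nbrs_def edge_adj_def)
  qed
qed (auto simp: sphere_def children_def nbrs_in)

text \<open>Every edge other than the root has exactly one neighbour nearer to the root, and
  \<open>e\<close> and \<open>f\<close> would both be that neighbour.\<close>

lemma children_disjoint:
  assumes "x \<in> E" "e \<in> E" "f \<in> E" "e \<noteq> f"
  shows "children x e \<inter> children x f = {}"
proof (rule ccontr)
  assume "\<not> ?thesis"
  then obtain c where c: "c \<in> nbrs e" "c \<in> nbrs f" "D x c = Suc (D x e)" "D x c = Suc (D x f)"
    by (auto simp: children_def)
  hence "x \<noteq> c" "c \<in> E" using nbrs_in by auto
  then obtain g h c1 c2 where n: "nbrs c = {g, h, c1, c2}"
    "D x c = Suc (D x g)" "D x h = D x c" "D x c1 = Suc (D x c)" "D x c2 = Suc (D x c)"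
    using edge_split[OF assms(1), of c] by metis
  have "e \<in> nbrs c" "f \<in> nbrs c" using c(1,2) nbrs_sym by auto
  moreover have "D x e \<noteq> D x h" "D x e \<noteq> D x c1" "D x e \<noteq> D x c2"
    "D x f \<noteq> D x h" "D x f \<noteq> D x c1" "D x f \<noteq> D x c2" using n(2-5) c(3,4) by linarith+
  ultimately have "e = g" "f = g" unfolding n(1) by blast+
  thus False using assms(4) by simp
qed

lemma finite_sphere: "x \<in> E \<Longrightarrow> finite (sphere x n)"
  by (induction n) (auto simp: sphere_0 sphere_Suc finite_children)

lemma sum_sphere_Suc:
  assumes "x \<in> E"
  shows "(\<Sum>c\<in>sphere x (Suc n). f c) = (\<Sum>e\<in>sphere x n. \<Sum>c\<in>children x e. f c)"
  unfolding sphere_Suc[OF assms]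
  by (rule sum.UNION_disjoint)
     (use assms children_disjoint finite_children finite_sphere in \<open>auto simp: sphere_def\<close>)

definition eball :: "'v set \<Rightarrow> nat \<Rightarrow> 'v set set" where "eball x n = {y \<in> E. D x y \<le> n}"

lemma eball_eq: "eball x n = (\<Union>m\<le>n. sphere x m)"
  by (auto simp: eball_def sphere_def)

lemma finite_eball: "x \<in> E \<Longrightarrow> finite (eball x n)"
  unfolding eball_eq by (auto simp: finite_sphere)

lemma sum_eball:
  assumes "x \<in> E"
  shows "(\<Sum>y\<in>eball x n. f y) = (\<Sum>m\<le>n. \<Sum>y\<in>sphere x m. f y)"
  unfolding eball_eq
  by (rule sum.UNION_disjoint) (use assms finite_sphere in \<open>auto simp: sphere_def\<close>)

lemma E_nonempty: "E \<noteq> {}"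
proof -
  obtain v where "v \<in> V" using tree by (auto simp: regular_tree_def connected_graph_def)
  hence "star v \<noteq> {}" using card_star by fastforce
  thus ?thesis by (auto simp: star_def)
qed

lemma countable_E: "countable E"
proof -
  obtain x where x: "x \<in> E" using E_nonempty by auto
  have "E = (\<Union>n. sphere x n)" by (auto simp: sphere_def)
  moreover have "countable (\<Union>n. sphere x n)"
    by (intro countable_UN) (auto intro: countable_finite finite_sphere x)
  ultimately show ?thesis by simp
qed

text \<open>The adjacency operator on functions of the distance to \<open>y\<close>: one parent, one
  sibling, two children.\<close>

lemma sum_nbrs_radial:
  fixes f :: "nat \<Rightarrow> complex"
  assumes "x \<in> E" "y \<in> E" "y \<noteq> x"
  shows "(\<Sum>z\<in>nbrs x. f (D z y)) = f (D x y - 1) + f (D x y) + 2 * f (D x y + 1)"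
proof -
  obtain g h c1 c2 where s: "distinct [x, g, h, c1, c2]"
    "nbrs x = {g, h, c1, c2}"
    "D y x = Suc (D y g)" "D y h = D y x" "D y c1 = Suc (D y x)" "D y c2 = Suc (D y x)"
    using edge_split[OF assms(2,1,3)] by metis
  show ?thesis using s unfolding D_sym[of _ y] by simp
qed

lemma sum_nbrs_radial_self:
  fixes f :: "nat \<Rightarrow> complex"
  assumes "x \<in> E"
  shows "(\<Sum>z\<in>nbrs x. f (D z x)) = 4 * f 1"
  using card_nbrs[OF assms] D_nbrs[of _ x] by (simp add: D_sym[of _ x])

end

section \<open>Waves and finitely supported functions\<close>

text \<open>The kernel of \<open>P_lambda\<close> at distance \<open>n\<close>, which is a polynomial in \<open>lambda\<close>; unlike \<open>Pker\<close> it is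
  not junk at the end points of the spectrum.\<close>
fun pol :: "nat \<Rightarrow> real \<Rightarrow> real" where
  "pol 0 lam = 2/9"
| "pol (Suc 0) lam = 2/9 * (1 - lam / 4)"
| "pol (Suc (Suc n)) lam = ((3 - lam) * pol (Suc n) lam - pol n lam) / 2"

text \<open>These are the numbers \<open>2 powr (- z)\<close> with \<open>Re z = 1/2\<close> and \<open>sin (t * log 2) \<noteq> 0\<close>.\<close>
definition admissible :: "complex \<Rightarrow> bool" where
  "admissible r \<longleftrightarrow> r * cnj r = 1/2 \<and> Im r \<noteq> 0"

lemma admissible_cnj: "admissible r \<Longrightarrow> admissible (cnj r)"
  by (auto simp: admissible_def mult.commute)

lemma admissible_norm: "admissible r \<Longrightarrow> (cmod r)\<^sup>2 = 1/2"
  unfolding admissible_def complex_norm_square[symmetric]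
  by (metis of_real_eq_iff of_real_divide of_real_numeral of_real_1)

lemma Re_Im_sq: "admissible r \<Longrightarrow> (Re r)\<^sup>2 + (Im r)\<^sup>2 = 1/2"
  using admissible_norm[of r] by (simp add: cmod_power2)

text \<open>At \<open>lam = 3 - 4 * Re r\<close> the recurrence of \<open>pol\<close> has the
  characteristic equation s^2 = 2 Re(r) s - 1/2, whose roots are \<open>r\<close> and
  \<open>cnj r\<close> because \<open>r * cnj r = 1/2\<close>. The coefficient in front of
  \<open>r ^ m\<close> is fixed by the two initial values.\<close>

lemma pol_eq_Im:
  assumes "admissible r"
  shows "pol m (3 - 4 * Re r) = Im ((1 + 2 * r - 2 * cnj r) * r ^ m) / (18 * Im r)"
proof (induction m "3 - 4 * Re r" rule: pol.induct)
  case 1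
  show ?case using assms by (simp add: admissible_def)
next
  case 2
  show ?case using assms by (simp add: admissible_def field_simps)
next
  case (3 n)
  have "r ^ 2 = of_real (2 * Re r) * r - 1/2"
    using Re_Im_sq[OF assms] by (auto simp: complex_eq_iff power2_eq_square)
  hence e: "r ^ Suc (Suc n) = (of_real (2 * Re r) * r - 1/2) * r ^ n"
    by (metis add_2_eq_Suc power_add)
  have "(1 + 2 * r - 2 * cnj r) * r ^ Suc (Suc n) =
      of_real (2 * Re r) * ((1 + 2 * r - 2 * cnj r) * r ^ Suc n)
        - of_real (1/2) * ((1 + 2 * r - 2 * cnj r) * r ^ n)"
    unfolding e by (simp add: algebra_simps)
  hence "Im ((1 + 2 * r - 2 * cnj r) * r ^ Suc (Suc n)) =
      2 * Re r * Im ((1 + 2 * r - 2 * cnj r) * r ^ Suc n)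
        - Im ((1 + 2 * r - 2 * cnj r) * r ^ n) / 2"
    by (simp only: minus_complex.sel Im_complex_of_real Re_complex_of_real times_complex.sel)
  thus ?case using assms unfolding pol.simps(3) 3
    by (simp only: admissible_def) (simp add: field_simps)
qed

text \<open>The coefficient of \<open>r ^ m\<close> once the imaginary part in
  \<open>pol_eq_Im\<close> is written as a difference of conjugates over \<open>2 * \<i>\<close>, so
  that 36 is 2 times 18. It plays the part of the c-function for the kernel on edges.\<close>

definition acoef :: "complex \<Rightarrow> complex" where
  "acoef r = (1 + 2 * r - 2 * cnj r) / (36 * \<i> * of_real (Im r))"

lemma pol_eq_acoef:
  assumes "admissible r"
  shows "of_real (pol m (3 - 4 * Re r)) = acoef r * r ^ m + cnj (acoef r) * cnj r ^ m"
proof -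
  define S where "S = (1 + 2 * r - 2 * cnj r) * r ^ m"
  have i: "Im r \<noteq> 0" using assms by (simp add: admissible_def)
  have "acoef r * r ^ m + cnj (acoef r) * cnj r ^ m = S / (36 * \<i> * of_real (Im r)) + cnj (S / (36 * \<i> * of_real (Im r)))"
    by (simp add: acoef_def S_def)
  also have "\<dots> = of_real (Im S / (18 * Im r))"
    using i by (auto simp: complex_eq_iff Re_divide Im_divide field_simps power2_eq_square)
  finally show ?thesis using pol_eq_Im[OF assms] by (simp add: S_def)
qed

lemma norm_acoef:
  assumes "admissible r"
  shows "(cmod (acoef r))\<^sup>2 = (1 + 16 * (Im r)\<^sup>2) / (1296 * (Im r)\<^sup>2)"
proof -
  have "1 + 2 * r - 2 * cnj r = Complex 1 (4 * Im r)" by (auto simp: complex_eq_iff)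
  thus ?thesis unfolding acoef_def
    by (simp add: norm_divide power_divide norm_mult power_mult_distrib cmod_power2)
qed

text \<open>The eigenvalue equation of the adjacency operator away from the centre; 4-regularity of
  the edge graph turns Laplace eigenvalue \<open>lam\<close> into \<open>4 - lam\<close>.\<close>

lemma pol_rec:
  "m > 0 \<Longrightarrow> pol (m - 1) lam + pol m lam + 2 * pol (m + 1) lam = (4 - lam) * pol m lam"
  by (cases m) (auto simp: field_simps)

text \<open>Multiplied by \<open>q - 1\<close> the partial sums telescope, so they stay bounded and
  division by \<open>N\<close> sends them to 0.\<close>

lemma cesaro_rotation:
  fixes X :: "nat \<Rightarrow> complex"
  assumes X: "\<And>n. n \<ge> n0 \<Longrightarrow> X (Suc n) = q * X n" and q: "cmod q = 1" "q \<noteq> 1"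
  shows "(\<lambda>N. (\<Sum>n\<le>N. X n) / of_nat N) \<longlonglongrightarrow> 0"
proof -
  have norm: "cmod (X n) = cmod (X n0)" if "n \<ge> n0" for n
    using that by (induction rule: dec_induct) (auto simp: X norm_mult q)
  have tele: "(q - 1) * (\<Sum>n\<le>N. X n) = (q - 1) * (\<Sum>n\<le>n0. X n) + X (Suc N) - X (Suc n0)"
    if "N \<ge> n0" for N
    using that by (induction rule: dec_induct) (auto simp: X algebra_simps)
  define M where "M = (cmod ((q - 1) * (\<Sum>n\<le>n0. X n)) + 2 * cmod (X n0)) / cmod (q - 1)"
  have bound: "cmod (\<Sum>n\<le>N. X n) \<le> M" if "N \<ge> n0" for N
  proof -
    have "cmod (q - 1) * cmod (\<Sum>n\<le>N. X n)
        = cmod ((q - 1) * (\<Sum>n\<le>n0. X n) + X (Suc N) - X (Suc n0))"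
      by (simp flip: norm_mult tele[OF that])
    also have "\<dots> \<le> cmod ((q - 1) * (\<Sum>n\<le>n0. X n)) + cmod (X (Suc N)) + cmod (X (Suc n0))"
      by (meson norm_triangle_le_diff norm_triangle_ineq order_trans add_mono order_refl norm_triangle_ineq4)
    also have "\<dots> = cmod ((q - 1) * (\<Sum>n\<le>n0. X n)) + 2 * cmod (X n0)"
      using norm[of "Suc N"] norm[of "Suc n0"] that by simp
    finally show ?thesis using q by (simp add: M_def field_simps)
  qed
  show ?thesis
  proof (rule Lim_null_comparison)
    show "\<forall>\<^sub>F N in sequentially. cmod ((\<Sum>n\<le>N. X n) / of_nat N) \<le> M / real N"
      using eventually_ge_at_top[of n0] eventually_gt_at_top[of 0]
      by eventually_elim (use bound in \<open>auto simp: norm_divide divide_right_mono\<close>)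
    show "(\<lambda>N. M / real N) \<longlonglongrightarrow> 0" by real_asymp
  qed
qed

context cubic_tree
begin

lemma nbrs_outside_eball:
  assumes "x0 \<in> E" "x \<in> eball x0 n"
  shows "nbrs x - eball x0 n = (if D x0 x = n then children x0 x else {})"
proof -
  have "D x0 c \<le> Suc (D x0 x)" if "c \<in> nbrs x" for c
    using D_step[OF assms(1), of x c] that by (auto simp: nbrs_def)
  thus ?thesis using assms(2) by (force simp: eball_def children_def nbrs_in)
qed

text \<open>The expression \<open>h\<close> is antisymmetric, so pairs inside the ball cancel and
  only the passages from the boundary sphere to its children remain. There both functions are
  multiplied by \<open>r\<close>, which gives \<open>r - cnj r\<close> for each of the two children;
  \<open>n > 0\<close> excludes the root, which has four.\<close>

lemma green_identity:
  assumes x0: "x0 \<in> E" and n: "n > 0"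
    and v: "\<And>e c. e \<in> sphere x0 n \<Longrightarrow> c \<in> children x0 e \<Longrightarrow> v c = r * v e"
    and v': "\<And>e c. e \<in> sphere x0 n \<Longrightarrow> c \<in> children x0 e \<Longrightarrow> v' c = r * v' e"
  shows "(\<Sum>x\<in>eball x0 n. (\<Sum>z\<in>nbrs x. v z) * cnj (v' x) - v x * cnj (\<Sum>z\<in>nbrs x. v' z))
       = (2 * r - 2 * cnj r) * (\<Sum>e\<in>sphere x0 n. v e * cnj (v' e))"
proof -
  define B where "B = eball x0 n"
  define h where "h x y = v y * cnj (v' x) - v x * cnj (v' y)" for x y
  have fB: "finite B" using finite_eball x0 by (simp add: B_def)
  have restr: "(\<Sum>z\<in>nbrs x \<inter> B. h x z) = (\<Sum>z\<in>B. if z \<in> nbrs x then h x z else 0)" for x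
    unfolding Int_commute[of _ B] by (rule sum.inter_restrict[OF fB])
  have "(\<Sum>x\<in>B. \<Sum>z\<in>nbrs x \<inter> B. h x z) = (\<Sum>x\<in>B. \<Sum>z\<in>B. if z \<in> nbrs x then h x z else 0)"
    by (simp only: restr)
  also have "\<dots> = (\<Sum>z\<in>B. \<Sum>x\<in>B. if z \<in> nbrs x then h x z else 0)" by (rule sum.swap)
  also have "\<dots> = (\<Sum>z\<in>B. \<Sum>x\<in>B. - (if x \<in> nbrs z then h z x else 0))"
    by (intro sum.cong refl) (auto simp: h_def nbrs_sym)
  also have "\<dots> = - (\<Sum>x\<in>B. \<Sum>z\<in>B. if z \<in> nbrs x then h x z else 0)"
    by (simp add: sum_negf)
  also have "\<dots> = - (\<Sum>x\<in>B. \<Sum>z\<in>nbrs x \<inter> B. h x z)"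
    by (simp only: restr)
  finally have inner: "(\<Sum>x\<in>B. \<Sum>z\<in>nbrs x \<inter> B. h x z) = 0" by simp
  have "(\<Sum>x\<in>B. (\<Sum>z\<in>nbrs x. v z) * cnj (v' x) - v x * cnj (\<Sum>z\<in>nbrs x. v' z))
      = (\<Sum>x\<in>B. \<Sum>z\<in>nbrs x. h x z)"
    by (simp add: h_def sum_subtractf sum_distrib_right sum_distrib_left)
  also have "\<dots> = (\<Sum>x\<in>B. (\<Sum>z\<in>nbrs x \<inter> B. h x z) + (\<Sum>z\<in>nbrs x - B. h x z))"
    by (intro sum.cong refl sum.Int_Diff finite_nbrs)
  also have "\<dots> = (\<Sum>x\<in>B. \<Sum>z\<in>nbrs x - B. h x z)"
    by (simp add: sum.distrib inner)
  also have "\<dots> = (\<Sum>x\<in>B. if x \<in> sphere x0 n then (\<Sum>z\<in>children x0 x. h x z) else 0)"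
    using nbrs_outside_eball[OF x0, of _ n]
    by (intro sum.cong refl) (auto simp: B_def sphere_def eball_def)
  also have "\<dots> = (\<Sum>x\<in>B \<inter> sphere x0 n. \<Sum>z\<in>children x0 x. h x z)"
    by (rule sum.inter_restrict[symmetric, OF fB])
  also have "B \<inter> sphere x0 n = sphere x0 n" by (auto simp: B_def eball_def sphere_def)
  also have "(\<Sum>x\<in>sphere x0 n. \<Sum>z\<in>children x0 x. h x z)
      = (\<Sum>x\<in>sphere x0 n. (2 * r - 2 * cnj r) * (v x * cnj (v' x)))"
  proof (rule sum.cong[OF refl])
    fix x assume x: "x \<in> sphere x0 n"
    have "x \<in> E" "D x0 x \<noteq> 0" using x n by (auto simp: sphere_def)
    hence "card (children x0 x) = 2" using card_children[OF x0, of x] by (metis D_self)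
    moreover have "h x z = (r - cnj r) * (v x * cnj (v' x))" if "z \<in> children x0 x" for z
      using v[OF x that] v'[OF x that] by (simp add: h_def algebra_simps)
    hence "(\<Sum>z\<in>children x0 x. h x z) = (\<Sum>z\<in>children x0 x. (r - cnj r) * (v x * cnj (v' x)))"
      by (rule sum.cong[OF refl])
    ultimately show "(\<Sum>z\<in>children x0 x. h x z) = (2 * r - 2 * cnj r) * (v x * cnj (v' x))"
      by (simp add: algebra_simps)
  qed
  finally show ?thesis by (simp add: B_def sum_distrib_left)
qed

text \<open>The summation set is a parameter separate from \<open>F\<close>, so that restrictions of
  one function to varying finite sets can be compared directly.\<close>

definition wave :: "complex \<Rightarrow> 'v set set \<Rightarrow> ('v set \<Rightarrow> complex) \<Rightarrow> 'v set \<Rightarrow> complex" where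
  "wave r A F x = (\<Sum>y\<in>A. F y * r ^ D x y)"

text \<open>Since 1/r is \<open>2 * cnj r\<close>, the radial sum at positive distance is the
  eigenvalue times \<open>r ^ m\<close>. At distance 0 the sum is \<open>4 * r\<close> instead, and
  the deficit is the source term.\<close>

lemma wave_nbrs:
  assumes r: "admissible r" and A: "finite A" "A \<subseteq> E" and x: "x \<in> E"
  shows "(\<Sum>z\<in>nbrs x. wave r A F z) =
    (1 + 2 * r + 2 * cnj r) * wave r A F x - (if x \<in> A then (1 + 2 * cnj r - 2 * r) * F x else 0)"
proof -
  have one: "(\<Sum>z\<in>nbrs x. r ^ D z y) =
      (1 + 2 * r + 2 * cnj r) * r ^ D x y - (if y = x then 1 + 2 * cnj r - 2 * r else 0)"
    if y: "y \<in> A" for y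
  proof (cases "y = x")
    case True
    thus ?thesis using sum_nbrs_radial_self[OF x, of "\<lambda>m. r ^ m"] by simp
  next
    case False
    then obtain m where m: "D x y = Suc m" using x y A by (metis D_eq_0 not0_implies_Suc subsetD)
    have "r ^ m = 2 * cnj r * r ^ Suc m"
    proof -
      have "2 * cnj r * r ^ Suc m = 2 * (r * cnj r) * r ^ m" by (simp add: mult_ac)
      also have "r * cnj r = 1/2" using r by (simp add: admissible_def)
      finally show ?thesis by simp
    qed
    thus ?thesis using sum_nbrs_radial[OF x, of y "\<lambda>m. r ^ m"] y A False m
      by (auto simp: algebra_simps)
  qed
  have "(\<Sum>z\<in>nbrs x. wave r A F z) = (\<Sum>y\<in>A. F y * (\<Sum>z\<in>nbrs x. r ^ D z y))"
    unfolding wave_def by (subst sum.swap) (simp add: sum_distrib_left)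
  also have "\<dots> = (\<Sum>y\<in>A. (1 + 2 * r + 2 * cnj r) * (F y * r ^ D x y)
       - (if y = x then (1 + 2 * cnj r - 2 * r) * F x else 0))"
    by (intro sum.cong refl) (auto simp: one algebra_simps)
  finally show ?thesis using A
    by (simp add: sum_subtractf wave_def sum_distrib_left)
qed

lemma wave_child:
  assumes "x0 \<in> E" "A \<subseteq> E" "\<And>y. y \<in> A \<Longrightarrow> D x0 y < n" "e \<in> sphere x0 n" "c \<in> children x0 e"
  shows "wave r A F c = r * wave r A F e"
proof -
  have "D c y = Suc (D e y)" if "y \<in> A" for y
    using D_child_far[OF assms(1), of y e c] assms(2,3,4,5) that
    unfolding D_sym[of c] D_sym[of e] by (auto simp: sphere_def)
  thus ?thesis by (simp add: wave_def sum_distrib_left mult_ac)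
qed

text \<open>Green's identity for two waves leaves only their sources, whose coefficients combine to
  a multiple of \<open>pol\<close>. The 9 is what remains of \<open>36 * \<i> * Im r\<close> after
  division by \<open>2 * r - 2 * cnj r\<close>, which is \<open>4 * \<i> * Im r\<close>.\<close>

lemma wave_inner:
  assumes r: "admissible r" and x0: "x0 \<in> E" and A: "finite A" "A \<subseteq> E" "finite A'" "A' \<subseteq> E"
    and n: "n > 0" "\<And>y. y \<in> A \<union> A' \<Longrightarrow> D x0 y < n"
  shows "(\<Sum>e\<in>sphere x0 n. wave r A F e * cnj (wave r A' F' e)) =
    9 * (\<Sum>x\<in>A. \<Sum>y\<in>A'. F x * cnj (F' y) * of_real (pol (D x y) (3 - 4 * Re r)))"
proof -
  define s where "s = 1 + 2 * cnj r - 2 * r"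
  have cs: "cnj s = 1 + 2 * r - 2 * cnj r" by (simp add: s_def)
  \<comment> \<open>The eigenvalue is real, so the eigenvalue terms of the two waves cancel.\<close>
  have cT: "cnj (1 + 2 * r + 2 * cnj r) = 1 + 2 * r + 2 * cnj r" by simp
  define B where "B = eball x0 n"
  have B: "finite B" "A \<subseteq> B" "A' \<subseteq> B" "B \<subseteq> E"
    using finite_eball[OF x0] n(2) A by (force simp: B_def eball_def)+
  let ?v = "wave r A F" and ?v' = "wave r A' F'"
  have k: "- s * cnj r ^ m + cnj s * r ^ m = 36 * \<i> * of_real (Im r) * of_real (pol m (3 - 4 * Re r))" for m
  proof -
    have "- s * cnj r ^ m + cnj s * r ^ m = (cnj s * r ^ m) - cnj (cnj s * r ^ m)" by simp
    also have "\<dots> = 2 * \<i> * of_real (Im (cnj s * r ^ m))"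
      by (subst complex_diff_cnj) simp
    also have "Im (cnj s * r ^ m) = 18 * Im r * pol m (3 - 4 * Re r)"
      using r unfolding pol_eq_Im[OF r] cs by (simp add: admissible_def)
    finally show ?thesis by simp
  qed
  have "(2 * r - 2 * cnj r) * (\<Sum>e\<in>sphere x0 n. ?v e * cnj (?v' e))
      = (\<Sum>x\<in>B. (\<Sum>z\<in>nbrs x. ?v z) * cnj (?v' x) - ?v x * cnj (\<Sum>z\<in>nbrs x. ?v' z))"
    unfolding B_def
    by (rule green_identity[symmetric, OF x0 n(1)]) (rule wave_child[OF x0], use A n(2) in auto)+
  also have "\<dots> = (\<Sum>x\<in>B. (if x \<in> A' then cnj s * (?v x * cnj (F' x)) else 0)
                      - (if x \<in> A then s * (F x * cnj (?v' x)) else 0))"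
  proof (rule sum.cong[OF refl])
    fix x assume "x \<in> B"
    hence x: "x \<in> E" using B by auto
    show "(\<Sum>z\<in>nbrs x. ?v z) * cnj (?v' x) - ?v x * cnj (\<Sum>z\<in>nbrs x. ?v' z)
        = (if x \<in> A' then cnj s * (?v x * cnj (F' x)) else 0)
          - (if x \<in> A then s * (F x * cnj (?v' x)) else 0)"
      unfolding wave_nbrs[OF r A(1,2) x] wave_nbrs[OF r A(3,4) x] s_def[symmetric]
        complex_cnj_diff complex_cnj_mult cT
      by (simp add: algebra_simps)
  qed
  also have "\<dots> = (\<Sum>x\<in>A'. cnj s * (?v x * cnj (F' x))) - (\<Sum>x\<in>A. s * (F x * cnj (?v' x)))"
    using B by (simp add: sum_subtractf sum.If_cases Int_absorb1 flip: sum.inter_restrict)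
  also have "(\<Sum>x\<in>A'. cnj s * (?v x * cnj (F' x))) = (\<Sum>x\<in>A. \<Sum>y\<in>A'. F x * cnj (F' y) * (cnj s * r ^ D x y))"
    unfolding wave_def
    by (subst sum.swap) (simp add: sum_distrib_left sum_distrib_right D_sym mult_ac)
  also have "(\<Sum>x\<in>A. s * (F x * cnj (?v' x))) = (\<Sum>x\<in>A. \<Sum>y\<in>A'. F x * cnj (F' y) * (s * cnj r ^ D x y))"
    unfolding wave_def by (simp add: sum_distrib_left sum_distrib_right mult_ac)
  also have "(\<Sum>x\<in>A. \<Sum>y\<in>A'. F x * cnj (F' y) * (cnj s * r ^ D x y))
       - (\<Sum>x\<in>A. \<Sum>y\<in>A'. F x * cnj (F' y) * (s * cnj r ^ D x y))
      = (\<Sum>x\<in>A. \<Sum>y\<in>A'. F x * cnj (F' y) * (- s * cnj r ^ D x y + cnj s * r ^ D x y))"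
    by (simp add: sum_subtractf[symmetric] algebra_simps)
  also have "\<dots> = 36 * \<i> * of_real (Im r) *
      (\<Sum>x\<in>A. \<Sum>y\<in>A'. F x * cnj (F' y) * of_real (pol (D x y) (3 - 4 * Re r)))"
    unfolding k by (simp add: sum_distrib_left mult_ac)
  also have "36 * \<i> * of_real (Im r) = (2 * r - 2 * cnj r) * 9" by (auto simp: complex_eq_iff)
  finally have "(2 * r - 2 * cnj r) * (\<Sum>e\<in>sphere x0 n. ?v e * cnj (?v' e)) = (2 * r - 2 * cnj r) *
      (9 * (\<Sum>x\<in>A. \<Sum>y\<in>A'. F x * cnj (F' y) * of_real (pol (D x y) (3 - 4 * Re r))))"
    by (simp only: mult.assoc)
  moreover have "2 * r - 2 * cnj r \<noteq> 0" using r by (auto simp: complex_eq_iff admissible_def)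
  ultimately show ?thesis using mult_left_cancel by blast
qed

section \<open>The form of P_lambda on finitely supported functions\<close>

definition Pfin :: "real \<Rightarrow> 'v set set \<Rightarrow> ('v set \<Rightarrow> complex) \<Rightarrow> 'v set \<Rightarrow> complex" where
  "Pfin lam A F x = (\<Sum>y\<in>A. of_real (pol (D x y) lam) * F y)"

text \<open>The double sum is already real, the kernel being real and symmetric; \<open>Re\<close>
  only changes the type.\<close>

definition qform :: "real \<Rightarrow> 'v set set \<Rightarrow> ('v set \<Rightarrow> complex) \<Rightarrow> real" where
  "qform lam A F = Re (\<Sum>x\<in>A. \<Sum>y\<in>A. F x * cnj (F y) * of_real (pol (D x y) lam))"

lemma Pfin_eq_wave:
  assumes "admissible r"
  shows "Pfin (3 - 4 * Re r) A F x = acoef r * wave r A F x + cnj (acoef r) * wave (cnj r) A F x"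
  unfolding Pfin_def wave_def pol_eq_acoef[OF assms]
  by (simp add: sum_distrib_left sum.distrib algebra_simps)

lemma Pfin_nbrs:
  assumes A: "finite A" "A \<subseteq> E" and x: "x \<in> E"
  shows "(\<Sum>z\<in>nbrs x. Pfin lam A F z) = of_real (4 - lam) * Pfin lam A F x"
proof -
  have one: "(\<Sum>z\<in>nbrs x. complex_of_real (pol (D z y) lam)) = of_real (4 - lam) * of_real (pol (D x y) lam)"
    if y: "y \<in> A" for y
  proof (cases "y = x")
    case True
    have "(\<Sum>z\<in>nbrs x. complex_of_real (pol (D z x) lam)) = 4 * of_real (pol 1 lam)"
      using sum_nbrs_radial_self[OF x, of "\<lambda>m. of_real (pol m lam)"] by simp
    also have "\<dots> = of_real (4 - lam) * of_real (pol 0 lam)" by (simp add: field_simps)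
    finally show ?thesis using True by simp
  next
    case False
    hence pos: "D x y > 0" using x y A by (metis D_eq_0 gr0I subsetD)
    have "y \<in> E" using y A by auto
    from sum_nbrs_radial[OF x this False, of "\<lambda>m. of_real (pol m lam)"]
    have "(\<Sum>z\<in>nbrs x. complex_of_real (pol (D z y) lam))
       = of_real (pol (D x y - 1) lam + pol (D x y) lam + 2 * pol (D x y + 1) lam)" by simp
    thus ?thesis unfolding pol_rec[OF pos] by simp
  qed
  have "(\<Sum>z\<in>nbrs x. Pfin lam A F z) = (\<Sum>y\<in>A. (\<Sum>z\<in>nbrs x. of_real (pol (D z y) lam)) * F y)"
    unfolding Pfin_def by (subst sum.swap) (simp add: sum_distrib_right)
  thus ?thesis by (simp add: one Pfin_def sum_distrib_left mult.assoc)
qed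

lemma eventually_far:
  assumes "finite A" shows "\<exists>n0>0. \<forall>n\<ge>n0. \<forall>y\<in>A. D x0 y < n"
proof -
  have "\<forall>y\<in>A. D x0 y \<le> Max (D x0 ` A)" using assms by auto
  thus ?thesis by (intro exI[of _ "Suc (Max (D x0 ` A))"]) force
qed

lemma wave_norm_sum:
  assumes r: "admissible r" and x0: "x0 \<in> E" and A: "finite A" "A \<subseteq> E"
    and n: "n > 0" "\<And>y. y \<in> A \<Longrightarrow> D x0 y < n"
  shows "(\<Sum>e\<in>sphere x0 n. (cmod (wave r A F e))\<^sup>2) = 9 * qform (3 - 4 * Re r) A F"
proof -
  have "complex_of_real (\<Sum>e\<in>sphere x0 n. (cmod (wave r A F e))\<^sup>2) =
      9 * (\<Sum>x\<in>A. \<Sum>y\<in>A. F x * cnj (F y) * of_real (pol (D x y) (3 - 4 * Re r)))"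
    using wave_inner[OF r x0 A A n(1)] n(2) by (simp only: of_real_sum complex_norm_square) blast
  from arg_cong[OF this, of Re] show ?thesis by (simp add: qform_def)
qed

lemma wave_L2:
  assumes "admissible r" "x0 \<in> E" "finite A" "A \<subseteq> E" "n > 0" "\<And>y. y \<in> A \<Longrightarrow> D x0 y < n"
  shows "L2_set (\<lambda>e. cmod (wave r A F e)) (sphere x0 n) = 3 * sqrt (qform (3 - 4 * Re r) A F)"
  unfolding L2_set_def using wave_norm_sum[OF assms, of F] by (simp add: real_sqrt_mult)

text \<open>The sign is not visible in \<open>pol\<close>; it comes from the form being a ninth of a
  sum of squares of the wave on a far sphere.\<close>

lemma qform_nonneg:
  assumes r: "admissible r" and A: "finite A" "A \<subseteq> E"
  shows "qform (3 - 4 * Re r) A F \<ge> 0"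
proof -
  obtain x0 where x0: "x0 \<in> E" using E_nonempty by auto
  obtain n where "n > 0" "\<forall>y\<in>A. D x0 y < n" using eventually_far[OF A(1)] by blast
  from wave_norm_sum[OF r x0 A this(1), of F] this(2) show ?thesis
    by (smt (verit) sum_nonneg zero_le_power2)
qed

text \<open>On a sphere beyond both supports the square root of the form is a third of the L2 norm
  of the wave, and the wave is additive over disjoint supports.\<close>

lemma sqrt_qform_union:
  assumes r: "admissible r" and A: "finite A" "A \<subseteq> E" "finite B" "B \<subseteq> E" "A \<inter> B = {}"
  shows "sqrt (qform (3 - 4 * Re r) (A \<union> B) F)
     \<le> sqrt (qform (3 - 4 * Re r) A F) + sqrt (qform (3 - 4 * Re r) B F)"
proof -
  obtain x0 where x0: "x0 \<in> E" using E_nonempty by auto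
  have AB: "finite (A \<union> B)" "A \<union> B \<subseteq> E" using A by auto
  obtain n where n: "n > 0" "\<And>y. y \<in> A \<union> B \<Longrightarrow> D x0 y < n"
    using eventually_far[OF AB(1)] by blast
  have w: "wave r (A \<union> B) F e = wave r A F e + wave r B F e" for e
    unfolding wave_def using A by (intro sum.union_disjoint) auto
  have "L2_set (\<lambda>e. cmod (wave r (A \<union> B) F e)) (sphere x0 n)
     \<le> L2_set (\<lambda>e. cmod (wave r A F e) + cmod (wave r B F e)) (sphere x0 n)"
    unfolding w by (intro L2_set_mono norm_triangle_ineq) auto
  also have "\<dots> \<le> L2_set (\<lambda>e. cmod (wave r A F e)) (sphere x0 n)
               + L2_set (\<lambda>e. cmod (wave r B F e)) (sphere x0 n)"
    by (rule L2_set_triangle_ineq)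
  finally show ?thesis
    using wave_L2[OF r x0 AB n, of F] wave_L2[OF r x0 A(1,2) n(1), of F]
      wave_L2[OF r x0 A(3,4) n(1), of F] n(2) by auto
qed

lemma sqrt_qform_le_union:
  assumes r: "admissible r" and A: "finite A" "A \<subseteq> E" "finite B" "B \<subseteq> E" "A \<inter> B = {}"
  shows "sqrt (qform (3 - 4 * Re r) A F)
     \<le> sqrt (qform (3 - 4 * Re r) (A \<union> B) F) + sqrt (qform (3 - 4 * Re r) B F)"
proof -
  obtain x0 where x0: "x0 \<in> E" using E_nonempty by auto
  have AB: "finite (A \<union> B)" "A \<union> B \<subseteq> E" using A by auto
  obtain n where n: "n > 0" "\<And>y. y \<in> A \<union> B \<Longrightarrow> D x0 y < n"
    using eventually_far[OF AB(1)] by blast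
  have w: "wave r A F e = wave r (A \<union> B) F e - wave r B F e" for e
    unfolding wave_def using A by (simp add: sum.union_disjoint)
  have "L2_set (\<lambda>e. cmod (wave r A F e)) (sphere x0 n)
     \<le> L2_set (\<lambda>e. cmod (wave r (A \<union> B) F e) + cmod (wave r B F e)) (sphere x0 n)"
    unfolding w by (intro L2_set_mono norm_triangle_ineq4) auto
  also have "\<dots> \<le> L2_set (\<lambda>e. cmod (wave r (A \<union> B) F e)) (sphere x0 n)
               + L2_set (\<lambda>e. cmod (wave r B F e)) (sphere x0 n)"
    by (rule L2_set_triangle_ineq)
  finally show ?thesis
    using wave_L2[OF r x0 AB n, of F] wave_L2[OF r x0 A(1,2) n(1), of F]
      wave_L2[OF r x0 A(3,4) n(1), of F] n(2) by auto
qed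

text \<open>The value at \<open>x\<close> is the pairing with the point mass at \<open>x\<close>, so
  this is Cauchy-Schwarz on a far sphere; \<open>2/9\<close> is \<open>pol 0\<close>, the form at
  the point mass.\<close>

lemma Pfin_bound:
  assumes r: "admissible r" and A: "finite A" "A \<subseteq> E" and x: "x \<in> E"
  shows "(cmod (Pfin (3 - 4 * Re r) A F x))\<^sup>2 \<le> 2/9 * qform (3 - 4 * Re r) A F"
proof -
  have fin: "finite (insert x A)" using A by auto
  obtain n where n: "n > 0" "\<And>y. y \<in> insert x A \<Longrightarrow> D x y < n"
    using eventually_far[OF fin] by blast
  let ?S = "sphere x n" and ?v = "wave r A F" and ?v' = "wave r {x} (\<lambda>_. 1)"
  have "(\<Sum>e\<in>?S. ?v e * cnj (?v' e)) = 9 * Pfin (3 - 4 * Re r) A F x"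
    using wave_inner[OF r x A _ _ n(1), of "{x}" F "\<lambda>_. 1"] n(2) x
    by (simp add: Pfin_def D_sym mult.commute)
  hence "9 * cmod (Pfin (3 - 4 * Re r) A F x) = cmod (\<Sum>e\<in>?S. ?v e * cnj (?v' e))"
    by (simp add: norm_mult)
  also have "\<dots> \<le> (\<Sum>e\<in>?S. cmod (?v e * cnj (?v' e)))" by (rule norm_sum)
  also have "\<dots> = (\<Sum>e\<in>?S. \<bar>cmod (?v e)\<bar> * \<bar>cmod (?v' e)\<bar>)" by (simp add: norm_mult)
  also have "\<dots> \<le> L2_set (\<lambda>e. cmod (?v e)) ?S * L2_set (\<lambda>e. cmod (?v' e)) ?S"
    by (rule L2_set_mult_ineq)
  also have "\<dots> = 3 * sqrt (qform (3 - 4 * Re r) A F) * (3 * sqrt (2/9))"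
  proof -
    have "qform (3 - 4 * Re r) {x} (\<lambda>_. 1) = 2/9" by (simp add: qform_def)
    thus ?thesis
      using wave_L2[OF r x A n(1), of F] wave_L2[OF r x _ _ n(1), of "{x}" "\<lambda>_. 1"] n x
      by simp
  qed
  finally have "cmod (Pfin (3 - 4 * Re r) A F x) \<le> sqrt (2/9 * qform (3 - 4 * Re r) A F)"
    unfolding real_sqrt_mult by (simp add: mult.commute)
  thus ?thesis by (rule sqrt_ge_absD[OF ord_eq_le_trans[OF abs_norm_cancel]])
qed

text \<open>Up to the factor \<open>(2 * cnj r) ^ n\<close>, \<open>alpha\<close> is the finitely additive measure on the boundary of
  the tree of which the eigenfunction \<open>u\<close> is the Poisson transform.\<close>
lemma boundary_martingale:
  assumes x0: "x0 \<in> E" and e: "e \<in> E" "e \<noteq> x0" and r: "admissible r"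
    and u: "\<And>x. x \<in> E \<Longrightarrow> (\<Sum>z\<in>nbrs x. u z) = (1 + 2 * r + 2 * cnj r) * u x"
  defines "alpha \<equiv> \<lambda>e. (\<Sum>c\<in>children x0 e. u c) - 2 * r * u e"
  shows "(\<Sum>c\<in>children x0 e. alpha c) = 2 * cnj r * alpha e"
proof -
  obtain b g h c1 c2 where "b \<in> V" "star b = {e, c1, c2}" and s: "distinct [e, g, h, c1, c2]"
    "nbrs e = {g, h, c1, c2}" "children x0 e = {c1, c2}"
    "nbrs c1 = {e, c2} \<union> children x0 c1" "nbrs c2 = {e, c1} \<union> children x0 c2"
    "D x0 e = Suc (D x0 g)" "D x0 h = D x0 e" "D x0 c1 = Suc (D x0 e)" "D x0 c2 = Suc (D x0 e)"
    by (rule children_split[OF x0 e(1) e(2)[symmetric]])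
  \<comment> \<open>In the eigenvalue equation at the child \<open>c\<close> the parent and the
    sibling are split off, which expresses the sum over the grandchildren below \<open>c\<close> by
    values one generation up.\<close>
  have al: "alpha c = (1 + 2 * cnj r) * u c - u e - u c'"
    if c: "c \<in> {c1, c2}" "c' \<in> {c1, c2}" "c \<noteq> c'" for c c'
  proof -
    have n: "nbrs c = {e, c'} \<union> children x0 c" "c \<in> E" "c' \<noteq> e"
    proof -
      show "nbrs c = {e, c'} \<union> children x0 c" using c s(4,5) by auto
      have "c \<in> nbrs e" "c' \<noteq> e" using c s(1,2) by auto
      thus "c \<in> E" "c' \<noteq> e" by (auto intro: nbrs_in)
    qed
    have "D x0 c = Suc (D x0 e)" "D x0 c' = Suc (D x0 e)" using c s(8,9) by auto
    hence "e \<notin> children x0 c" "c' \<notin> children x0 c" unfolding children_def by simp_all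
    hence "{e, c'} \<inter> children x0 c = {}" by simp
    hence "(\<Sum>z\<in>nbrs c. u z) = u e + u c' + (\<Sum>z\<in>children x0 c. u z)"
      unfolding n(1) using n(3) finite_children by (subst sum.union_disjoint) auto
    thus ?thesis using u[OF n(2)] by (simp add: alpha_def algebra_simps)
  qed
  have "(\<Sum>c\<in>children x0 e. alpha c) = 2 * cnj r * (u c1 + u c2) - 2 * u e"
  proof -
    have "c1 \<noteq> c2" using s(1) by simp
    hence "alpha c1 = (1 + 2 * cnj r) * u c1 - u e - u c2" "alpha c2 = (1 + 2 * cnj r) * u c2 - u e - u c1"
      using al[of c1 c2] al[of c2 c1] by simp_all
    moreover have "(\<Sum>c\<in>children x0 e. alpha c) = alpha c1 + alpha c2"
      unfolding s(3) using \<open>c1 \<noteq> c2\<close> by simp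
    ultimately show ?thesis by (simp only:) (simp add: algebra_simps)
  qed
  moreover have "2 * cnj r * (2 * r * u e) = 2 * u e"
  proof -
    have "2 * cnj r * (2 * r * u e) = 4 * (r * cnj r) * u e" by (simp add: mult_ac)
    also have "r * cnj r = 1/2" using r by (simp add: admissible_def)
    finally show ?thesis by simp
  qed
  moreover have "alpha e = u c1 + u c2 - 2 * r * u e" using s(1,3) by (simp add: alpha_def)
  ultimately show ?thesis by (simp only: right_diff_distrib)
qed

text \<open>Since \<open>2 * cnj r\<close> has squared modulus 2, the martingale relation gives 2
  |alpha e|^2 = |alpha c1 + alpha c2|^2 for the children of \<open>e\<close>, and the right side is
  at most twice the sum of the two squares. The factors 2 cancel, so square sums never decrease
  outwards.\<close>

lemma boundary_mono:
  assumes x0: "x0 \<in> E" and r: "admissible r"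
    and u: "\<And>x. x \<in> E \<Longrightarrow> (\<Sum>z\<in>nbrs x. u z) = (1 + 2 * r + 2 * cnj r) * u x"
    and n: "0 < n" "n \<le> m"
  defines "alpha \<equiv> \<lambda>e. (\<Sum>c\<in>children x0 e. u c) - 2 * r * u e"
  shows "(\<Sum>e\<in>sphere x0 n. (cmod (alpha e))\<^sup>2) \<le> (\<Sum>e\<in>sphere x0 m. (cmod (alpha e))\<^sup>2)"
  using n(2)
proof (induction rule: dec_induct)
  case (step k)
  have "(cmod (alpha e))\<^sup>2 \<le> (\<Sum>c\<in>children x0 e. (cmod (alpha c))\<^sup>2)" if "e \<in> sphere x0 k" for e
  proof -
    have e: "e \<in> E" "D x0 e \<noteq> 0" using that step(1) n(1) by (auto simp: sphere_def)
    hence ne: "e \<noteq> x0" by auto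
    have "card (children x0 e) = 2" using card_children[OF x0 e(1)] ne by blast
    then obtain c1 c2 where c: "children x0 e = {c1, c2}" "c1 \<noteq> c2" by (auto simp: card_2_iff)
    have "2 * cnj r * alpha e = alpha c1 + alpha c2"
      using boundary_martingale[OF x0 e(1) ne r, of u] u c by (simp add: alpha_def)
    from arg_cong[OF this, of "\<lambda>z. (cmod z)\<^sup>2"]
    have "4 * (cmod r)\<^sup>2 * (cmod (alpha e))\<^sup>2 = (cmod (alpha c1 + alpha c2))\<^sup>2"
      by (simp add: norm_mult power_mult_distrib)
    also have "\<dots> \<le> (cmod (alpha c1) + cmod (alpha c2))\<^sup>2"
      by (intro power_mono norm_triangle_ineq) auto
    also have "\<dots> \<le> 2 * ((cmod (alpha c1))\<^sup>2 + (cmod (alpha c2))\<^sup>2)"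
      using sum_squares_bound[of "cmod (alpha c1)" "cmod (alpha c2)"] by (simp add: power2_sum)
    finally show ?thesis using c admissible_norm[OF r] by simp
  qed
  hence "(\<Sum>e\<in>sphere x0 k. (cmod (alpha e))\<^sup>2) \<le> (\<Sum>e\<in>sphere x0 (Suc k). (cmod (alpha e))\<^sup>2)"
    unfolding sum_sphere_Suc[OF x0] by (rule sum_mono)
  with step show ?case by linarith
qed auto

text \<open>Beyond the support the wave of \<open>r\<close> drops out of \<open>alpha\<close>,
  because the two children contribute exactly \<open>2 * r\<close> times its value at
  \<open>e\<close>. What is left is a multiple of the wave of \<open>cnj r\<close>, whose square sum
  on a far sphere is known; monotonicity carries the bound back to radius \<open>n\<close>.\<close>

lemma boundary_bound:
  fixes F :: "'v set \<Rightarrow> complex"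
  assumes r: "admissible r" and x0: "x0 \<in> E" and A: "finite A" "A \<subseteq> E" and n: "n > 0"
  defines "lam \<equiv> 3 - 4 * Re r"
  defines "alpha \<equiv> \<lambda>e. (\<Sum>c\<in>children x0 e. Pfin lam A F c) - 2 * r * Pfin lam A F e"
  shows "(\<Sum>e\<in>sphere x0 n. (cmod (alpha e))\<^sup>2) \<le> (1 + 16 * (Im r)\<^sup>2) / 9 * qform lam A F"
proof -
  obtain n0 where n0: "\<forall>n\<ge>n0. \<forall>y\<in>A. D x0 y < n" using eventually_far[OF A(1)] by blast
  define m where "m = max n n0"
  have m: "m > 0" "n \<le> m" "\<And>y. y \<in> A \<Longrightarrow> D x0 y < m" using n n0 by (auto simp: m_def)
  have ev: "(\<Sum>z\<in>nbrs x. Pfin lam A F z) = (1 + 2 * r + 2 * cnj r) * Pfin lam A F x" if "x \<in> E" for x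
  proof -
    have "complex_of_real (4 - lam) = 1 + 2 * r + 2 * cnj r"
      by (auto simp: lam_def complex_eq_iff)
    thus ?thesis using Pfin_nbrs[OF A that] by simp
  qed
  have far: "alpha e = 2 * (cnj r - r) * cnj (acoef r) * wave (cnj r) A F e" if e: "e \<in> sphere x0 m" for e
  proof -
    have "e \<in> E" "D x0 e \<noteq> 0" using e m by (auto simp: sphere_def)
    hence card: "card (children x0 e) = 2" using card_children[OF x0, of e] by (metis D_self)
    have "Pfin lam A F c = acoef r * r * wave r A F e + cnj (acoef r) * cnj r * wave (cnj r) A F e"
      if c: "c \<in> children x0 e" for c
    proof -
      have "wave s A F c = s * wave s A F e" for s
        by (rule wave_child[OF x0 A(2) _ e c]) (rule m(3))
      thus ?thesis unfolding lam_def Pfin_eq_wave[OF r] by simp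
    qed
    hence "(\<Sum>c\<in>children x0 e. Pfin lam A F c)
      = (\<Sum>c\<in>children x0 e. acoef r * r * wave r A F e + cnj (acoef r) * cnj r * wave (cnj r) A F e)"
      by (rule sum.cong[OF refl])
    thus ?thesis
      using card unfolding alpha_def lam_def Pfin_eq_wave[OF r] by (simp add: algebra_simps)
  qed
  have "(\<Sum>e\<in>sphere x0 n. (cmod (alpha e))\<^sup>2) \<le> (\<Sum>e\<in>sphere x0 m. (cmod (alpha e))\<^sup>2)"
    unfolding alpha_def by (rule boundary_mono[OF x0 r ev n m(2)])
  also have "\<dots> = (\<Sum>e\<in>sphere x0 m. (1 + 16 * (Im r)\<^sup>2) / 81 * (cmod (wave (cnj r) A F e))\<^sup>2)"
  proof (rule sum.cong[OF refl])
    fix e assume e: "e \<in> sphere x0 m"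
    have "cnj r - r = - (2 * \<i> * of_real (Im r))" by (auto simp: complex_eq_iff)
    hence "cmod (cnj r - r) = 2 * \<bar>Im r\<bar>" by (simp add: norm_mult)
    hence "(cmod (alpha e))\<^sup>2 = 16 * (Im r)\<^sup>2 * (cmod (acoef r))\<^sup>2 * (cmod (wave (cnj r) A F e))\<^sup>2"
      unfolding far[OF e] norm_mult by (simp add: power_mult_distrib)
    moreover have "16 * (Im r)\<^sup>2 * (cmod (acoef r))\<^sup>2 = (1 + 16 * (Im r)\<^sup>2) / 81"
      unfolding norm_acoef[OF r] using r by (simp add: admissible_def)
    ultimately show "(cmod (alpha e))\<^sup>2 = (1 + 16 * (Im r)\<^sup>2) / 81 * (cmod (wave (cnj r) A F e))\<^sup>2"
      by (simp only:)
  qed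
  also have "\<dots> = (1 + 16 * (Im r)\<^sup>2) / 81 * (9 * qform lam A F)"
    using wave_norm_sum[OF admissible_cnj[OF r] x0 A m(1,3), of F]
    unfolding sum_distrib_left[symmetric] lam_def by simp
  finally show ?thesis by (simp add: mult.commute)
qed

text \<open>The boundary measures for \<open>cnj r\<close> and \<open>r\<close> differ by
  \<open>4 * \<i> * Im r\<close> times the eigenfunction, so bounds for both bound the eigenfunction
  itself. The constant blows up at the ends of the spectrum, where \<open>Im r\<close> tends to
  0.\<close>

lemma sphere_bound:
  assumes r: "admissible r" and x0: "x0 \<in> E" and A: "finite A" "A \<subseteq> E" and n: "n > 0"
  shows "(\<Sum>e\<in>sphere x0 n. (cmod (Pfin (3 - 4 * Re r) A F e))\<^sup>2)
    \<le> (1 + 16 * (Im r)\<^sup>2) / (36 * (Im r)\<^sup>2) * qform (3 - 4 * Re r) A F"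
proof -
  define lam where "lam = 3 - 4 * Re r"
  define alpha where "alpha s e = (\<Sum>c\<in>children x0 e. Pfin lam A F c) - 2 * s * Pfin lam A F e" for s e
  have i: "Im r \<noteq> 0" using r by (simp add: admissible_def)
  have b: "(\<Sum>e\<in>sphere x0 n. (cmod (alpha s e))\<^sup>2) \<le> (1 + 16 * (Im r)\<^sup>2) / 9 * qform lam A F"
    if "s = r \<or> s = cnj r" for s
    using that boundary_bound[OF r x0 A n, of F] boundary_bound[OF admissible_cnj[OF r] x0 A n, of F]
    unfolding alpha_def lam_def by auto
  have pt: "16 * (Im r)\<^sup>2 * (cmod (Pfin lam A F e))\<^sup>2 \<le> 2 * (cmod (alpha r e))\<^sup>2 + 2 * (cmod (alpha (cnj r) e))\<^sup>2" for e
  proof -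
    have "4 * \<i> * of_real (Im r) * Pfin lam A F e = alpha (cnj r) e - alpha r e"
    proof -
      have "4 * \<i> * of_real (Im r) = 2 * r - 2 * cnj r" by (auto simp: complex_eq_iff)
      thus ?thesis by (simp only: alpha_def) (simp add: algebra_simps)
    qed
    from arg_cong[OF this, of "\<lambda>z. (cmod z)\<^sup>2"]
    have "16 * (Im r)\<^sup>2 * (cmod (Pfin lam A F e))\<^sup>2 = (cmod (alpha (cnj r) e - alpha r e))\<^sup>2"
      by (simp add: norm_mult power_mult_distrib)
    also have "\<dots> \<le> (cmod (alpha (cnj r) e) + cmod (alpha r e))\<^sup>2"
      by (intro power_mono norm_triangle_ineq4) auto
    also have "\<dots> \<le> 2 * ((cmod (alpha r e))\<^sup>2 + (cmod (alpha (cnj r) e))\<^sup>2)"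
      using sum_squares_bound[of "cmod (alpha (cnj r) e)" "cmod (alpha r e)"] by (simp add: power2_sum)
    finally show ?thesis by simp
  qed
  have "16 * (Im r)\<^sup>2 * (\<Sum>e\<in>sphere x0 n. (cmod (Pfin lam A F e))\<^sup>2)
     \<le> 2 * (\<Sum>e\<in>sphere x0 n. (cmod (alpha r e))\<^sup>2) + 2 * (\<Sum>e\<in>sphere x0 n. (cmod (alpha (cnj r) e))\<^sup>2)"
    unfolding sum_distrib_left sum.distrib[symmetric] by (rule sum_mono) (rule pt)
  also have "\<dots> \<le> 4 * ((1 + 16 * (Im r)\<^sup>2) / 9 * qform lam A F)"
    using b[of r] b[of "cnj r"] by simp
  finally show ?thesis using i by (simp add: lam_def field_simps)
qed

section \<open>Mean values over balls\<close>

lemma sphere_sum_far: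
  assumes r: "admissible r" and x0: "x0 \<in> E" and A: "finite A" "A \<subseteq> E"
    and n: "n > 0" "\<And>y. y \<in> A \<Longrightarrow> D x0 y < n"
  shows "(\<Sum>e\<in>sphere x0 n. (cmod (Pfin (3 - 4 * Re r) A F e))\<^sup>2)
    = (1 + 16 * (Im r)\<^sup>2) / (72 * (Im r)\<^sup>2) * qform (3 - 4 * Re r) A F
      + Re (2 * (acoef r)\<^sup>2 * (\<Sum>e\<in>sphere x0 n. wave r A F e * cnj (wave (cnj r) A F e)))"
proof -
  have pt: "(cmod (Pfin (3 - 4 * Re r) A F e))\<^sup>2 =
      (cmod (acoef r))\<^sup>2 * (cmod (wave r A F e))\<^sup>2 + (cmod (acoef r))\<^sup>2 * (cmod (wave (cnj r) A F e))\<^sup>2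
      + Re (2 * (acoef r)\<^sup>2 * (wave r A F e * cnj (wave (cnj r) A F e)))" for e
    unfolding Pfin_eq_wave[OF r] cmod_power2
    by (simp add: power2_eq_square algebra_simps)
  have "(\<Sum>e\<in>sphere x0 n. (cmod (Pfin (3 - 4 * Re r) A F e))\<^sup>2)
    = (cmod (acoef r))\<^sup>2 * (\<Sum>e\<in>sphere x0 n. (cmod (wave r A F e))\<^sup>2)
      + (cmod (acoef r))\<^sup>2 * (\<Sum>e\<in>sphere x0 n. (cmod (wave (cnj r) A F e))\<^sup>2)
      + Re (2 * (acoef r)\<^sup>2 * (\<Sum>e\<in>sphere x0 n. wave r A F e * cnj (wave (cnj r) A F e)))"
    unfolding pt sum.distrib sum_distrib_left Re_sum ..
  also have "(\<Sum>e\<in>sphere x0 n. (cmod (wave r A F e))\<^sup>2) = 9 * qform (3 - 4 * Re r) A F"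
    by (rule wave_norm_sum[OF r x0 A n])
  also have "(\<Sum>e\<in>sphere x0 n. (cmod (wave (cnj r) A F e))\<^sup>2) = 9 * qform (3 - 4 * Re r) A F"
    using wave_norm_sum[OF admissible_cnj[OF r] x0 A n, of F] by simp
  finally show ?thesis unfolding norm_acoef[OF r] using r by (simp add: admissible_def field_simps)
qed

lemma Pfin_mean:
  assumes r: "admissible r" and x0: "x0 \<in> E" and A: "finite A" "A \<subseteq> E"
  shows "(\<lambda>N. (\<Sum>x\<in>eball x0 N. (cmod (Pfin (3 - 4 * Re r) A F x))\<^sup>2) / real N)
    \<longlonglongrightarrow> (1 + 16 * (Im r)\<^sup>2) / (72 * (Im r)\<^sup>2) * qform (3 - 4 * Re r) A F"
proof -
  define K where "K = (1 + 16 * (Im r)\<^sup>2) / (72 * (Im r)\<^sup>2) * qform (3 - 4 * Re r) A F"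
  define X where "X n = (\<Sum>e\<in>sphere x0 n. wave r A F e * cnj (wave (cnj r) A F e))" for n
  define s where "s n = (\<Sum>e\<in>sphere x0 n. (cmod (Pfin (3 - 4 * Re r) A F e))\<^sup>2)" for n
  obtain n0 where n0: "n0 > 0" "\<forall>n\<ge>n0. \<forall>y\<in>A. D x0 y < n" using eventually_far[OF A(1)] by blast
  \<comment> \<open>Each of the two children multiplies the product by
    \<open>r * cnj (cnj r)\<close>, that is by the square of \<open>r\<close>.\<close>
  have X: "X (Suc n) = 2 * r\<^sup>2 * X n" if n: "n \<ge> n0" for n
  proof -
    have far: "\<And>y. y \<in> A \<Longrightarrow> D x0 y < n" using n0 n by auto
    have "(\<Sum>c\<in>children x0 e. wave r A F c * cnj (wave (cnj r) A F c))
        = 2 * r\<^sup>2 * (wave r A F e * cnj (wave (cnj r) A F e))" if e: "e \<in> sphere x0 n" for e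
    proof -
      have "e \<in> E" "D x0 e \<noteq> 0" using e n n0 by (auto simp: sphere_def)
      hence card: "card (children x0 e) = 2" using card_children[OF x0, of e] by (metis D_self)
      have "(\<Sum>c\<in>children x0 e. wave r A F c * cnj (wave (cnj r) A F c))
        = (\<Sum>c\<in>children x0 e. r\<^sup>2 * (wave r A F e * cnj (wave (cnj r) A F e)))"
      proof (rule sum.cong[OF refl])
        fix c assume c: "c \<in> children x0 e"
        show "wave r A F c * cnj (wave (cnj r) A F c) = r\<^sup>2 * (wave r A F e * cnj (wave (cnj r) A F e))"
        proof -
          have "wave s A F c = s * wave s A F e" for s
            by (rule wave_child[OF x0 A(2) _ e c]) (rule far)
          thus ?thesis by (simp add: power2_eq_square mult_ac)
        qed
      qed
      thus ?thesis using card by simp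
    qed
    thus ?thesis unfolding X_def sum_sphere_Suc[OF x0] sum_distrib_left by (rule sum.cong[OF refl])
  qed
  have q: "cmod (2 * r\<^sup>2) = 1" using admissible_norm[OF r] by (simp add: norm_mult norm_power)
  \<comment> \<open>As \<open>2 * (r * cnj r)\<close> is 1 as well, equality would make
    \<open>r\<close> real.\<close>
  have q1: "2 * r\<^sup>2 \<noteq> 1"
  proof
    assume "2 * r\<^sup>2 = 1"
    moreover have "r * cnj r = 1/2" using r by (simp add: admissible_def)
    moreover have "2 * (r * (r - cnj r)) = 2 * r\<^sup>2 - 2 * (r * cnj r)"
      by (simp add: power2_eq_square algebra_simps)
    ultimately have "2 * (r * (r - cnj r)) = 1 - 2 * (1 / 2)" by (simp only:)
    hence "r * (r - cnj r) = 0" by simp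
    thus False using r by (auto simp: admissible_def complex_eq_iff)
  qed
  have s: "s n = K + Re (2 * (acoef r)\<^sup>2 * X n)" if "n \<ge> n0" for n
    unfolding s_def K_def X_def using n0 that by (intro sphere_sum_far[OF r x0 A]) auto
  \<comment> \<open>Collects the finitely many spheres to which the exact formula need not apply; it
    disappears after division by \<open>N\<close>.\<close>
  define C where "C = (\<Sum>n\<le>n0. s n - (K + Re (2 * (acoef r)\<^sup>2 * X n)))"
  have S: "(\<Sum>n\<le>N. s n) = C + K * real (Suc N) + Re (2 * (acoef r)\<^sup>2 * (\<Sum>n\<le>N. X n))" if "N \<ge> n0" for N
    using that
  proof (induction rule: dec_induct)
    case base
    show ?case by (simp add: C_def sum_subtractf sum.distrib sum_distrib_left)
  next
    case (step k)
    thus ?case using s[of "Suc k"] by (simp add: algebra_simps)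
  qed
  have ces: "(\<lambda>N. (\<Sum>n\<le>N. X n) / of_nat N) \<longlonglongrightarrow> 0"
    by (rule cesaro_rotation[where q = "2 * r\<^sup>2" and ?n0.0 = n0]) (use X q q1 in auto)
  have "(\<lambda>N. C / real N + K * (real (Suc N) / real N) + Re (2 * (acoef r)\<^sup>2 * ((\<Sum>n\<le>N. X n) / of_nat N)))
     \<longlonglongrightarrow> 0 + K * 1 + Re (2 * (acoef r)\<^sup>2 * 0)"
    by (intro tendsto_intros ces) real_asymp+
  hence "(\<lambda>N. C / real N + K * (real (Suc N) / real N) + Re (2 * (acoef r)\<^sup>2 * ((\<Sum>n\<le>N. X n) / of_nat N)))
     \<longlonglongrightarrow> K" by simp
  moreover have "\<forall>\<^sub>F N in sequentially. C / real N + K * (real (Suc N) / real N)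
      + Re (2 * (acoef r)\<^sup>2 * ((\<Sum>n\<le>N. X n) / of_nat N))
     = (\<Sum>x\<in>eball x0 N. (cmod (Pfin (3 - 4 * Re r) A F x))\<^sup>2) / real N"
    using eventually_ge_at_top[of n0]
  proof eventually_elim
    case (elim N)
    have "Re (2 * (acoef r)\<^sup>2 * ((\<Sum>n\<le>N. X n) / of_nat N)) = Re (2 * (acoef r)\<^sup>2 * (\<Sum>n\<le>N. X n)) / real N"
      by (simp only: times_divide_eq_right Re_divide_of_nat)
    moreover have "(\<Sum>x\<in>eball x0 N. (cmod (Pfin (3 - 4 * Re r) A F x))\<^sup>2) = (\<Sum>n\<le>N. s n)"
      unfolding sum_eball[OF x0] s_def ..
    ultimately show ?case unfolding S[OF elim] by (simp only: add_divide_distrib times_divide_eq_right)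
  qed
  ultimately show ?thesis unfolding K_def by (rule Lim_transform_eventually)
qed

text \<open>The centre is left out because \<open>sphere_bound\<close> starts at radius 1; a single
  point does not affect averages in the limit.\<close>

lemma L2_set_Pfin_le:
  assumes r: "admissible r" and x0: "x0 \<in> E" and A: "finite A" "A \<subseteq> E"
  shows "L2_set (\<lambda>x. cmod (Pfin (3 - 4 * Re r) A F x)) (eball x0 N - {x0})
    \<le> sqrt (real N * ((1 + 16 * (Im r)\<^sup>2) / (36 * (Im r)\<^sup>2))) * sqrt (qform (3 - 4 * Re r) A F)"
proof -
  define C where "C = (1 + 16 * (Im r)\<^sup>2) / (36 * (Im r)\<^sup>2)"
  have eq: "eball x0 N - {x0} = (\<Union>n\<in>{1..N}. sphere x0 n)"
    using x0 by (auto simp: eball_def sphere_def Suc_le_eq intro!: gr0I)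
  have "(\<Sum>x\<in>eball x0 N - {x0}. (cmod (Pfin (3 - 4 * Re r) A F x))\<^sup>2)
      = (\<Sum>n\<in>{1..N}. \<Sum>x\<in>sphere x0 n. (cmod (Pfin (3 - 4 * Re r) A F x))\<^sup>2)"
    unfolding eq by (rule sum.UNION_disjoint) (use finite_sphere[OF x0] in \<open>auto simp: sphere_def\<close>)
  also have "\<dots> \<le> (\<Sum>n\<in>{1..N}. C * qform (3 - 4 * Re r) A F)"
    unfolding C_def by (intro sum_mono sphere_bound[OF r x0 A]) auto
  also have "\<dots> = real N * C * qform (3 - 4 * Re r) A F" by simp
  finally have "sqrt (\<Sum>x\<in>eball x0 N - {x0}. (cmod (Pfin (3 - 4 * Re r) A F x))\<^sup>2)
     \<le> sqrt (real N * C * qform (3 - 4 * Re r) A F)" by (rule real_sqrt_le_mono)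
  thus ?thesis unfolding L2_set_def C_def by (simp only: real_sqrt_mult)
qed

end

text \<open>An interchange of two limits, possible because \<open>t k\<close> bounds the error
  uniformly in \<open>N\<close>. The index 0 is left out since averages divide by
  \<open>N\<close>.\<close>

lemma tendsto_of_uniform_approx:
  fixes a :: "nat \<Rightarrow> real"
  assumes ab: "\<And>k N. N > 0 \<Longrightarrow> \<bar>a N - b k N\<bar> \<le> t k" and t: "t \<longlonglongrightarrow> 0"
    and b: "\<And>k. b k \<longlonglongrightarrow> c k" and c: "c \<longlonglongrightarrow> l"
  shows "a \<longlonglongrightarrow> l"
proof (rule LIMSEQ_I)
  fix e :: real assume e: "e > 0"
  have "\<forall>\<^sub>F k in sequentially. \<bar>t k - 0\<bar> < e / 3" "\<forall>\<^sub>F k in sequentially. \<bar>c k - l\<bar> < e / 3"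
    using t c e by (auto simp: tendsto_iff dist_real_def dest: spec[of _ "e / 3"])
  hence "\<forall>\<^sub>F k in sequentially. \<bar>t k - 0\<bar> < e / 3 \<and> \<bar>c k - l\<bar> < e / 3" by eventually_elim auto
  then obtain k where k: "\<bar>t k\<bar> < e / 3" "\<bar>c k - l\<bar> < e / 3"
    unfolding eventually_sequentially by fastforce
  have "\<forall>\<^sub>F N in sequentially. \<bar>b k N - c k\<bar> < e / 3"
    using b[of k] e by (auto simp: tendsto_iff dist_real_def dest: spec[of _ "e / 3"])
  with eventually_gt_at_top[of 0] have "\<forall>\<^sub>F N in sequentially. \<bar>a N - l\<bar> < e"
  proof eventually_elim
    case (elim N)
    thus ?case using ab[of N k] k by linarith
  qed
  thus "\<exists>no. \<forall>n\<ge>no. norm (a n - l) < e" by (simp add: eventually_sequentially)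
qed

context cubic_tree
begin

text \<open>The square root of the form is a seminorm in which the truncations are Cauchy, and by
  the sphere bounds the averaged L2 norm over a ball without its centre is Lipschitz in it with a
  constant independent of the radius. So the mean of the limit is the limit of the means of the
  truncations, and these do not depend on the base point.\<close>

lemma mean_inner_limit:
  fixes F :: "'v set \<Rightarrow> complex"
  assumes r: "admissible r" and A: "\<And>k. finite (A k)" "\<And>k. A k \<subseteq> E" "\<And>k. A k \<subseteq> A (Suc k)"
    and lam: "lam = 3 - 4 * Re r"
    and summ: "summable (\<lambda>k. sqrt (qform lam (A (Suc k) - A k) F))"
    and lim: "\<And>x. x \<in> E \<Longrightarrow> (\<lambda>k. Pfin lam (A k) F x) \<longlonglongrightarrow> G x"
  shows "\<exists>q. (\<lambda>k. qform lam (A k) F) \<longlonglongrightarrow> q \<and>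
    has_mean_inner E G G (of_real ((1 + 16 * (Im r)\<^sup>2) / (72 * (Im r)\<^sup>2) * q))"
proof -
  define d where "d k = sqrt (qform lam (A (Suc k) - A k) F)" for k
  \<comment> \<open>The tail of the series bounds the seminorm distance from the \<open>k\<close>-th
    truncation to every later one.\<close>
  define tau where "tau k = suminf d - sum d {..<k}" for k
  define Q where "Q k = sqrt (qform lam (A k) F)" for k
  have summ: "summable d" using summ by (simp add: d_def[abs_def])
  have nn: "qform lam B F \<ge> 0" if "finite B" "B \<subseteq> E" for B
    using qform_nonneg[OF r that] lam by simp
  have tau0: "tau \<longlonglongrightarrow> 0"
    using tendsto_diff[OF tendsto_const summable_LIMSEQ[OF summ], of "suminf d"] by (simp add: tau_def[abs_def])
  have mono: "A k \<subseteq> A j" if "k \<le> j" for k j using lift_Suc_mono_le[of A, OF A(3) that] .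
  have dif: "finite (A j - A k)" "A j - A k \<subseteq> E" for j k using A by auto
  have chain: "sqrt (qform lam (A j - A k) F) \<le> tau k" if "k \<le> j" for k j
  proof -
    have "sqrt (qform lam (A j - A k) F) \<le> sum d {k..<j}" using that
    proof (induction rule: dec_induct)
      case (step j)
      have e: "A (Suc j) - A k = (A j - A k) \<union> (A (Suc j) - A j)"
        using mono[OF step(1)] A(3)[of j] by auto
      have "sqrt (qform lam (A (Suc j) - A k) F) \<le> sqrt (qform lam (A j - A k) F) + d j"
        unfolding e d_def lam by (intro sqrt_qform_union[OF r]) (use A(1,2) in auto)
      with step show ?case by simp
    qed (simp add: qform_def)
    also have "\<dots> = sum d {..<j} - sum d {..<k}"
      using that by (simp add: sum_diff_nat_ivl lessThan_atLeast0)
    also have "\<dots> \<le> tau k"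
      unfolding tau_def using summ nn[OF dif] by (intro diff_right_mono sum_le_suminf) (auto simp: d_def)
    finally show ?thesis .
  qed
  have Qd: "\<bar>Q j - Q k\<bar> \<le> tau k" if "k \<le> j" for k j
  proof -
    have e: "A j = A k \<union> (A j - A k)" using mono[OF that] by auto
    have "Q j \<le> Q k + sqrt (qform lam (A j - A k) F)"
      unfolding Q_def by (subst e, unfold lam, rule sqrt_qform_union[OF r]) (use A(1,2) in auto)
    moreover have "Q k \<le> Q j + sqrt (qform lam (A j - A k) F)"
    proof -
      have "Q k \<le> sqrt (qform lam (A k \<union> (A j - A k)) F) + sqrt (qform lam (A j - A k) F)"
        unfolding Q_def lam by (rule sqrt_qform_le_union[OF r]) (use A(1,2) in auto)
      thus ?thesis using e by (simp add: Q_def)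
    qed
    ultimately show ?thesis using chain[OF that] by linarith
  qed
  have "Cauchy Q"
  proof (rule CauchyI')
    fix e :: real assume "e > 0"
    then obtain M where M: "\<And>k. k \<ge> M \<Longrightarrow> \<bar>tau k\<bar> < e"
      using LIMSEQ_D[OF tau0] by fastforce
    have "dist (Q m) (Q n) < e" if "m \<ge> M" "n > m" for m n
      using Qd[of m n] M[of m] that by (simp add: dist_real_def)
    thus "\<exists>M. \<forall>m\<ge>M. \<forall>n>m. dist (Q m) (Q n) < e" by blast
  qed
  then obtain q where q: "Q \<longlonglongrightarrow> q" by (auto simp: Cauchy_convergent_iff convergent_def)
  define C where "C = (1 + 16 * (Im r)\<^sup>2) / (36 * (Im r)\<^sup>2)"
  define K where "K = (1 + 16 * (Im r)\<^sup>2) / (72 * (Im r)\<^sup>2)"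
  have CK: "C \<ge> 0" "K \<ge> 0" by (simp_all add: C_def K_def)
  have main: "(\<lambda>N. (\<Sum>x\<in>eball x0 N. (cmod (G x))\<^sup>2) / real N) \<longlonglongrightarrow> K * q\<^sup>2" if x0: "x0 \<in> E" for x0
  proof -
    define B where "B N = eball x0 N - {x0}" for N
    define L where "L h N = L2_set (\<lambda>x. cmod (h x)) (B N) / sqrt (real N)" for h :: "'v set \<Rightarrow> complex" and N
    define U where "U k = Pfin lam (A k) F" for k
    have fB: "finite (B N)" "B N \<subseteq> E" for N
      using finite_eball[OF x0] by (auto simp: B_def eball_def)
    have x0B: "(\<Sum>x\<in>eball x0 N. h x) = (\<Sum>x\<in>B N. h x) + h x0" for N and h :: "'v set \<Rightarrow> real"
      unfolding B_def using sum.remove[OF finite_eball[OF x0], of x0 N h] x0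
      by (simp add: eball_def)
    have LU: "L2_set (\<lambda>x. cmod (U j x - U k x)) (B N) \<le> sqrt (real N * C) * tau k" if "k \<le> j" for j k N
    proof -
      have "U j x - U k x = Pfin lam (A j - A k) F x" for x
        unfolding U_def Pfin_def using A(1) mono[OF that] by (subst sum_diff) auto
      hence "L2_set (\<lambda>x. cmod (U j x - U k x)) (B N)
          \<le> sqrt (real N * C) * sqrt (qform lam (A j - A k) F)"
        using L2_set_Pfin_le[OF r x0 dif, of j k F N] by (simp add: B_def C_def lam)
      also have "\<dots> \<le> sqrt (real N * C) * tau k"
        by (intro mult_left_mono chain[OF that]) (use CK in auto)
      finally show ?thesis .
    qed
    \<comment> \<open>The set \<open>B N\<close> is finite, so pointwise convergence lets
      \<open>j\<close> tend to infinity in \<open>LU\<close>.\<close>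
    have LG: "L2_set (\<lambda>x. cmod (G x - U k x)) (B N) \<le> sqrt (real N * C) * tau k" for k N
    proof (rule tendsto_upperbound)
      show "((\<lambda>j. L2_set (\<lambda>x. cmod (U j x - U k x)) (B N)) \<longlongrightarrow> L2_set (\<lambda>x. cmod (G x - U k x)) (B N)) sequentially"
        unfolding L2_set_def using fB[of N]
        by (intro tendsto_intros) (auto simp: U_def intro!: lim)
      show "\<forall>\<^sub>F j in sequentially. L2_set (\<lambda>x. cmod (U j x - U k x)) (B N) \<le> sqrt (real N * C) * tau k"
        using eventually_ge_at_top[of k] by eventually_elim (rule LU)
    qed simp
    have ab: "\<bar>L G N - L (U k) N\<bar> \<le> sqrt C * tau k" if "N > 0" for k N
    proof -
      have "L2_set (\<lambda>x. cmod (G x)) (B N) \<le> L2_set (\<lambda>x. cmod (U k x) + cmod (G x - U k x)) (B N)"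
        by (intro L2_set_mono) (use norm_triangle_sub in auto)
      also have "\<dots> \<le> L2_set (\<lambda>x. cmod (U k x)) (B N) + L2_set (\<lambda>x. cmod (G x - U k x)) (B N)"
        by (rule L2_set_triangle_ineq)
      finally have 1: "L2_set (\<lambda>x. cmod (G x)) (B N) - L2_set (\<lambda>x. cmod (U k x)) (B N) \<le> sqrt (real N * C) * tau k"
        using LG[of k N] by linarith
      have "L2_set (\<lambda>x. cmod (U k x)) (B N) \<le> L2_set (\<lambda>x. cmod (G x) + cmod (G x - U k x)) (B N)"
        by (intro L2_set_mono) (use norm_triangle_sub norm_minus_commute in metis, auto)
      also have "\<dots> \<le> L2_set (\<lambda>x. cmod (G x)) (B N) + L2_set (\<lambda>x. cmod (G x - U k x)) (B N)"
        by (rule L2_set_triangle_ineq)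
      finally have 2: "L2_set (\<lambda>x. cmod (U k x)) (B N) - L2_set (\<lambda>x. cmod (G x)) (B N) \<le> sqrt (real N * C) * tau k"
        using LG[of k N] by linarith
      have "\<bar>L G N - L (U k) N\<bar> = \<bar>L2_set (\<lambda>x. cmod (G x)) (B N) - L2_set (\<lambda>x. cmod (U k x)) (B N)\<bar> / sqrt (real N)"
        unfolding L_def by (simp flip: diff_divide_distrib)
      also have "\<dots> \<le> (sqrt (real N * C) * tau k) / sqrt (real N)"
        using 1 2 by (intro divide_right_mono) auto
      also have "\<dots> = sqrt C * tau k" using that by (simp add: real_sqrt_mult)
      finally show ?thesis .
    qed
    have sq: "(L h N)\<^sup>2 = (\<Sum>x\<in>eball x0 N. (cmod (h x))\<^sup>2) / real N - (cmod (h x0))\<^sup>2 / real N" for h N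
      unfolding L_def x0B by (simp add: power_divide L2_set_def sum_nonneg add_divide_distrib)
    have zero: "(\<lambda>N. c / real N) \<longlonglongrightarrow> 0" for c by real_asymp
    have b: "L (U k) \<longlonglongrightarrow> sqrt K * Q k" for k
    proof -
      have "(\<lambda>N. (L (U k) N)\<^sup>2) \<longlonglongrightarrow> K * qform lam (A k) F - 0"
        unfolding sq K_def U_def lam by (intro tendsto_diff Pfin_mean[OF r x0 A(1,2)] zero)
      from tendsto_real_sqrt[OF this]
      have "(\<lambda>N. sqrt ((L (U k) N)\<^sup>2)) \<longlonglongrightarrow> sqrt (K * qform lam (A k) F - 0)" .
      moreover have "L (U k) N \<ge> 0" for N by (simp add: L_def)
      ultimately show ?thesis by (simp add: real_sqrt_mult Q_def)
    qed
    have t: "(\<lambda>k. sqrt C * tau k) \<longlonglongrightarrow> 0" using tendsto_mult[OF tendsto_const tau0] by simp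
    have c: "(\<lambda>k. sqrt K * Q k) \<longlonglongrightarrow> sqrt K * q" by (intro tendsto_intros q)
    have "L G \<longlonglongrightarrow> sqrt K * q" by (rule tendsto_of_uniform_approx[OF ab t b c])
    hence "(\<lambda>N. (L G N)\<^sup>2 + (cmod (G x0))\<^sup>2 / real N) \<longlonglongrightarrow> (sqrt K * q)\<^sup>2 + 0"
      by (intro tendsto_intros zero)
    thus ?thesis unfolding sq using CK by (simp add: power_mult_distrib)
  qed
  have "has_mean_inner E G G (of_real (K * q\<^sup>2))"
    unfolding has_mean_inner_def
  proof
    fix x0 assume x0: "x0 \<in> E"
    have e: "{x \<in> E. D x x0 \<le> N} = eball x0 N" for N by (auto simp: eball_def D_sym)
    have "(\<lambda>N. complex_of_real ((\<Sum>x\<in>eball x0 N. (cmod (G x))\<^sup>2) / real N)) \<longlonglongrightarrow> of_real (K * q\<^sup>2)"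
      by (intro tendsto_of_real main x0)
    moreover have "complex_of_real ((\<Sum>x\<in>eball x0 N. (cmod (G x))\<^sup>2) / real N)
       = 1 / of_nat N * (\<Sum>x | x \<in> E \<and> D x x0 \<le> N. G x * cnj (G x))" for N
      unfolding e complex_norm_square[symmetric] by simp
    ultimately show "(\<lambda>N. 1 / of_nat N * (\<Sum>x | x \<in> E \<and> D x x0 \<le> N. G x * cnj (G x)))
      \<longlonglongrightarrow> of_real (K * q\<^sup>2)" by (simp only:)
  qed
  moreover have "(\<lambda>k. qform lam (A k) F) \<longlonglongrightarrow> q\<^sup>2"
  proof -
    have "(\<lambda>k. (Q k)\<^sup>2) \<longlonglongrightarrow> q\<^sup>2" by (intro tendsto_intros q)
    thus ?thesis unfolding Q_def using nn[OF A(1,2)] by simp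
  qed
  ultimately show ?thesis unfolding K_def by blast
qed

end

section \<open>The spectral measure\<close>

definition angle :: "real \<Rightarrow> real" where "angle lam = t_of lam * ln 2"

text \<open>The value of \<open>2 powr (- z)\<close> at z = 1/2 + i t: modulus 1 / sqrt 2, argument
  -t log 2.\<close>

definition wave_base :: "real \<Rightarrow> complex" where
  "wave_base lam = cis (- angle lam) / of_real (sqrt 2)"

lemma angle_props:
  assumes "lam \<in> {3 - 2 * sqrt 2 <..< 3 + 2 * sqrt 2}"
  shows "sin (angle lam) > 0" "3 - lam = 2 * sqrt 2 * cos (angle lam)"
proof -
  have a: "angle lam = arccos ((3 - lam) / (2 * sqrt 2))" by (simp add: angle_def t_of_def)
  have r: "- 1 < (3 - lam) / (2 * sqrt 2)" "(3 - lam) / (2 * sqrt 2) < 1"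
    using assms by (auto simp: field_simps)
  show "sin (angle lam) > 0" unfolding a using arccos_lt_bounded[OF r] by (intro sin_gt_zero) auto
  show "3 - lam = 2 * sqrt 2 * cos (angle lam)" unfolding a using r by (subst cos_arccos) auto
qed

lemma wave_base_props:
  assumes "lam \<in> {3 - 2 * sqrt 2 <..< 3 + 2 * sqrt 2}"
  shows "admissible (wave_base lam)" "3 - 4 * Re (wave_base lam) = lam"
    "(Im (wave_base lam))\<^sup>2 = (sin (angle lam))\<^sup>2 / 2"
proof -
  have re: "Re (wave_base lam) = cos (angle lam) / sqrt 2"
    and im: "Im (wave_base lam) = - sin (angle lam) / sqrt 2"
    by (simp_all add: wave_base_def)
  show "(Im (wave_base lam))\<^sup>2 = (sin (angle lam))\<^sup>2 / 2"
    unfolding im by (simp add: power_divide)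
  have "wave_base lam * cnj (wave_base lam) = of_real ((Re (wave_base lam))\<^sup>2 + (Im (wave_base lam))\<^sup>2)"
    by (simp add: complex_mult_cnj)
  also have "(Re (wave_base lam))\<^sup>2 + (Im (wave_base lam))\<^sup>2 = 1/2"
    unfolding re im by (simp add: power_divide flip: add_divide_distrib)
  finally show "admissible (wave_base lam)"
    using angle_props(1)[OF assms] im by (auto simp: admissible_def)
  have "4 * Re (wave_base lam) = 2 * sqrt 2 * cos (angle lam)"
    unfolding re by (simp add: field_simps)
  thus "3 - 4 * Re (wave_base lam) = lam" using angle_props(2)[OF assms] by linarith
qed

text \<open>The origin of the weight 36 / b in the Plancherel formula: the quotient is the ratio of
  the mean square of P_lambda F to the form, and the squared imaginary part is half a squared
  sine.\<close>

lemma bfun_eq_wave_base: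
  assumes "lam \<in> {3 - 2 * sqrt 2 <..< 3 + 2 * sqrt 2}"
  shows "(1 + 16 * (Im (wave_base lam))\<^sup>2) / (72 * (Im (wave_base lam))\<^sup>2) = bfun lam / 36"
    "bfun lam > 0"
proof -
  have s: "sin (angle lam) \<noteq> 0" using angle_props(1)[OF assms] by simp
  show "(1 + 16 * (Im (wave_base lam))\<^sup>2) / (72 * (Im (wave_base lam))\<^sup>2) = bfun lam / 36"
    using s unfolding wave_base_props(3)[OF assms] bfun_def angle_def[symmetric] by (simp add: field_simps)
  show "bfun lam > 0" unfolding bfun_def by (simp add: add_pos_nonneg)
qed

lemma powr_int_wave:
  fixes z r :: complex
  assumes "2 powr (- z) = r"
  shows "2 powr (- of_int (int n) * z) = r ^ n" "2 powr (- of_int (int n + 1) * z) = r ^ n * r"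
    "2 powr (- of_int (int n - 1) * z) = r ^ n / r"
proof -
  have r: "r = exp (- z * of_real (ln 2))"
    using assms by (simp add: powr_def flip: Ln_of_real)
  have p: "2 powr x = exp (x * of_real (ln 2))" for x :: complex
    by (simp add: powr_def flip: Ln_of_real)
  have rn: "r ^ n = exp (of_nat n * (- z * of_real (ln 2)))" unfolding r by (simp only: exp_of_nat_mult)
  show "2 powr (- of_int (int n) * z) = r ^ n"
    unfolding p rn by (simp add: mult_ac)
  show "2 powr (- of_int (int n + 1) * z) = r ^ n * r"
    unfolding p rn unfolding r by (simp add: algebra_simps flip: exp_add)
  show "2 powr (- of_int (int n - 1) * z) = r ^ n / r"
    unfolding p rn unfolding r by (simp add: algebra_simps flip: exp_diff)
qed

text \<open>In \<open>psi\<close> the term \<open>r ^ n\<close> of \<open>phi\<close> acquires the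
  factor 2 + r + 1/r. Modulo \<open>r * cnj r = 1/2\<close> its product with the numerator of
  \<open>cfun\<close> is divisible by \<open>6 - lam\<close>, and the quotient leaves
  \<open>acoef r\<close>. At the ends of the spectrum the denominator of \<open>cfun\<close>
  vanishes, hence the open interval.\<close>

lemma psi_eq_pol:
  assumes lam: "lam \<in> {3 - 2 * sqrt 2 <..< 3 + 2 * sqrt 2}"
  shows "1 / (3 * (6 - of_real lam)) * psi (Complex (1/2) (t_of lam)) (int n) = of_real (pol n lam)"
proof -
  define z where "z = Complex (1/2) (t_of lam)"
  define r where "r = wave_base lam"
  have adm: "admissible r" and rl: "3 - 4 * Re r = lam" using wave_base_props[OF lam] by (auto simp: r_def)
  have rr: "r * cnj r = 1/2" and im: "Im r \<noteq> 0" using adm by (auto simp: admissible_def)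
  hence r0: "r \<noteq> 0" "cnj r \<noteq> 0" by auto
  have p: "2 powr x = exp (x * of_real (ln 2))" for x :: complex
    by (simp add: powr_def flip: Ln_of_real)
  have z1: "2 powr (- z) = r"
  proof -
    have "exp (- z * of_real (ln 2)) = of_real (exp (- (ln 2 / 2))) * cis (- angle lam)"
      by (simp add: z_def exp_eq_polar angle_def)
    also have "exp (- (ln 2 / 2)) = 1 / sqrt (2::real)"
      by (simp add: exp_minus powr_half_sqrt[symmetric] powr_def field_simps)
    finally show ?thesis unfolding p by (simp add: r_def wave_base_def)
  qed
  have z2: "2 powr (- (1 - z)) = cnj r"
  proof -
    have "2 powr (- (1 - z)) * 2 powr (- z) = 2 powr (- 1 :: complex)"
      by (simp flip: powr_add)
    also have "\<dots> = 1/2" by (simp add: powr_minus)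
    also have "\<dots> = cnj r * r" using rr by (simp add: mult.commute)
    finally show ?thesis using r0 unfolding z1 by simp
  qed
  have z3: "2 powr (1 - z) = 2 * r"
    using z1 powr_add[of 2 1 "- z"] by simp
  have z4: "2 powr (z - 1) = cnj r" using z2 by simp
  have z5: "2 powr z = 2 * cnj r"
    using z2 powr_add[of 2 1 "- (1 - z)"] by simp
  have c1: "cfun z = 1/3 * ((2 * r - cnj r) / (r - cnj r))"
    unfolding cfun_def z1 z3 z4 ..
  have c2: "cfun (1 - z) = 1/3 * ((2 * cnj r - r) / (cnj r - r))"
    unfolding cfun_def using z1 z2 z5 by simp
  have inv: "1 / r = 2 * cnj r" "1 / cnj r = 2 * r"
    using rr r0 by (auto simp: field_simps)
  have d: "r - cnj r \<noteq> 0" using im by (auto simp: complex_eq_iff)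
  have l6: "6 - complex_of_real lam = 3 + 2 * r + 2 * cnj r"
    using rl by (auto simp: complex_eq_iff)
  have l0: "3 + 2 * r + 2 * cnj r \<noteq> 0"
  proof -
    have "sqrt 2 < 3/2" by (rule real_less_lsqrt) (auto simp: power2_eq_square)
    hence "lam < 6" using lam by auto
    thus ?thesis unfolding l6[symmetric] by (auto simp: complex_eq_iff)
  qed
  have psi: "psi z (int n) = cfun z * (2 + r + 2 * cnj r) * r ^ n
       + cfun (1 - z) * (2 + cnj r + 2 * r) * cnj r ^ n"
    unfolding psi_def phi_def powr_int_wave[OF z1] powr_int_wave[OF z2]
    using inv by (simp add: algebra_simps flip: times_divide_eq_right) (simp add: divide_inverse)
  \<comment> \<open>Stated for a pair \<open>s\<close>, \<open>t\<close> so that it serves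
    \<open>r\<close>, \<open>cnj r\<close> in either order.\<close>
  have key: "1 / (3 * (3 + 2 * s + 2 * t)) * (1/3 * ((2 * s - t) / (s - t)) * (2 + s + 2 * t))
      = (1 + 2 * s - 2 * t) / (18 * (s - t))"
    if st: "s * t = 1/2" "s - t \<noteq> 0" "3 + 2 * s + 2 * t \<noteq> 0" for s t :: complex
  proof -
    have "2 * ((2 * s - t) * (2 + s + 2 * t)) - (1 + 2 * s - 2 * t) * (3 + 2 * s + 2 * t)
       = 6 * (s * t) - 3" by (simp add: algebra_simps)
    hence e: "(2 * s - t) * (2 + s + 2 * t) = (1 + 2 * s - 2 * t) * (3 + 2 * s + 2 * t) / 2"
      unfolding st(1) by (simp add: mult.commute)
    have "1 / (3 * B) * (1/3 * (X / d) * C) = X * C / (9 * B * d)" for B X d C :: complex by simp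
    moreover have "N * B / 2 / (9 * B * d) = N / (18 * d)" if "B \<noteq> 0" for B N d :: complex
      using that by simp
    ultimately show ?thesis using st(3) e by (simp only:)
  qed
  have ac: "acoef r = (1 + 2 * r - 2 * cnj r) / (18 * (r - cnj r))"
  proof -
    have "r - cnj r = 2 * \<i> * of_real (Im r)" by (auto simp: complex_eq_iff)
    thus ?thesis unfolding acoef_def by simp
  qed
  have ac': "cnj (acoef r) = (1 + 2 * cnj r - 2 * r) / (18 * (cnj r - r))"
    unfolding ac by simp
  have k1: "1 / (3 * (3 + 2 * r + 2 * cnj r)) * (1/3 * ((2 * r - cnj r) / (r - cnj r)) * (2 + r + 2 * cnj r)) = acoef r"
    unfolding ac by (rule key[OF rr d l0])
  have L: "3 + 2 * cnj r + 2 * r = 3 + 2 * r + 2 * cnj r" by simp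
  have k2: "1 / (3 * (3 + 2 * r + 2 * cnj r)) * (1/3 * ((2 * cnj r - r) / (cnj r - r)) * (2 + cnj r + 2 * r)) = cnj (acoef r)"
    unfolding ac' by (rule key[of "cnj r" r, unfolded L]) (use rr d l0 in \<open>auto simp: mult.commute\<close>)
  have "1 / (3 * (6 - of_real lam)) * psi z (int n)
     = (1 / (3 * (3 + 2 * r + 2 * cnj r)) * (1/3 * ((2 * r - cnj r) / (r - cnj r)) * (2 + r + 2 * cnj r))) * r ^ n
     + (1 / (3 * (3 + 2 * r + 2 * cnj r)) * (1/3 * ((2 * cnj r - r) / (cnj r - r)) * (2 + cnj r + 2 * r))) * cnj r ^ n"
  proof -
    have "X * (A * P * R + B * Q * S) = X * (A * P) * R + X * (B * Q) * S" for X A P R B Q S :: complex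
      by (simp add: algebra_simps)
    thus ?thesis unfolding psi c1 c2 l6 .
  qed
  also have "\<dots> = acoef r * r ^ n + cnj (acoef r) * cnj r ^ n"
    unfolding k1 k2 ..
  also have "\<dots> = of_real (pol n lam)" using pol_eq_acoef[OF adm, of n] rl by simp
  finally show ?thesis unfolding z_def .
qed

section \<open>Trigonometric form of the kernel and Poisson coefficients\<close>

lemma pol_cont [continuous_intros]: "continuous_on S (pol n)"
  by (induction n rule: induct_nat_012) (auto intro!: continuous_intros)

lemma sqrt2_mult: "sqrt 2 * (sqrt 2 * y) = 2 * (y :: real)"
  by (simp flip: mult.assoc)

text \<open>The closed form of \<open>pol\<close> for \<open>r = cis (- x) / sqrt 2\<close>,
  multiplied by \<open>sin x\<close> so that it survives where the sine vanishes. One of the two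
  sine factors of the substituted density supplies this multiplier.\<close>

lemma pol_trig:
  "pol n (3 - 2 * sqrt 2 * cos x) * sin x
    = (1 / sqrt 2) ^ n / 9 * (2 * cos (n * x) * sin x + sin (n * x) / sqrt 2)"
proof (induction n rule: induct_nat_012)
  case 0
  show ?case by simp
next
  case 1
  show ?case by (simp add: field_simps sqrt2_mult)
next
  case (ge2 n)
  have c: "cos (real (Suc (Suc n)) * x) = 2 * cos x * cos (real (Suc n) * x) - cos (real n * x)"
    using cos_add[of "real (Suc n) * x" x] cos_diff[of "real (Suc n) * x" x] by (simp add: algebra_simps)
  have s: "sin (real (Suc (Suc n)) * x) = 2 * cos x * sin (real (Suc n) * x) - sin (real n * x)"
    using sin_add[of "real (Suc n) * x" x] sin_diff[of "real (Suc n) * x" x] by (simp add: algebra_simps)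
  define lam where "lam = 3 - 2 * sqrt 2 * cos x"
  define k where "k = 1 / sqrt (2::real)"
  have k2: "k * k = 1/2" "sqrt 2 * k = 1" "1 / sqrt 2 = k" by (simp_all add: k_def)
  have k3: "sqrt 2 * k ^ Suc n = 2 * k ^ Suc (Suc n)" "k ^ n = 2 * k ^ Suc (Suc n)"
  proof -
    show "k ^ n = 2 * k ^ Suc (Suc n)" using k2(1) by (simp flip: mult.assoc)
    thus "sqrt 2 * k ^ Suc n = 2 * k ^ Suc (Suc n)" using k2(2) by (simp flip: mult.assoc)
  qed
  have "pol (Suc (Suc n)) lam * sin x
      = cos x * (sqrt 2 * (pol (Suc n) lam * sin x)) - (pol n lam * sin x) / 2"
    by (simp add: lam_def field_simps)
  also have "pol (Suc n) lam * sin x = k ^ Suc n / 9 * (2 * cos (Suc n * x) * sin x + sin (Suc n * x) / sqrt 2)"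
    using ge2(2) by (simp only: lam_def k_def)
  also have "pol n lam * sin x = k ^ n / 9 * (2 * cos (n * x) * sin x + sin (n * x) / sqrt 2)"
    using ge2(1) by (simp only: lam_def k_def)
  also have "cos x * (sqrt 2 * (k ^ Suc n / 9 * (2 * cos (Suc n * x) * sin x + sin (Suc n * x) / sqrt 2)))
      - k ^ n / 9 * (2 * cos (n * x) * sin x + sin (n * x) / sqrt 2) / 2
     = cos x * ((sqrt 2 * k ^ Suc n) / 9 * (2 * cos (Suc n * x) * sin x + sin (Suc n * x) / sqrt 2))
      - k ^ n / 9 * (2 * cos (n * x) * sin x + sin (n * x) / sqrt 2) / 2"
    by simp
  also have "\<dots> = k ^ Suc (Suc n) / 9 * (2 * cos (Suc (Suc n) * x) * sin x + sin (Suc (Suc n) * x) / sqrt 2)"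
    unfolding k3 c s by (simp add: field_simps)
  finally show ?case unfolding lam_def k_def .
qed

text \<open>Cosine moments of a Poisson kernel: \<open>3 / (5 - 4 * cos y)\<close> is the Poisson
  kernel of the unit disc at radius 1/2. Integer indices let the recurrence reach below 0, where
  evenness takes over.\<close>

definition poisson_int :: "int \<Rightarrow> real" where
  "poisson_int k = integral {0..pi} (\<lambda>x. cos (of_int k * x) / (5 - 4 * cos (2 * x)))"

lemma denom_pos: "5 - 4 * cos (y::real) > 0" "5 - 4 * cos (y::real) \<ge> 1"
  using cos_le_one[of y] by linarith+

lemma poisson_int_integrable: "(\<lambda>x. cos (of_int k * x) / (5 - 4 * cos (2 * x))) integrable_on {0..pi}"
  by (intro integrable_continuous_real continuous_intros) (use denom_pos in \<open>auto simp: less_imp_neq\<close>)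

lemma poisson_int_minus: "poisson_int (- k) = poisson_int k"
  by (simp add: poisson_int_def)

lemma poisson_int_bound: "\<bar>poisson_int k\<bar> \<le> pi"
proof -
  have "norm (integral {0..pi} (\<lambda>x. cos (of_int k * x) / (5 - 4 * cos (2 * x)))) \<le> 1 * (pi - 0)"
  proof (rule integral_bound)
    show "continuous_on {0..pi} (\<lambda>x. cos (of_int k * x) / (5 - 4 * cos (2 * x)))"
      by (intro continuous_intros) (use denom_pos in \<open>auto simp: less_imp_neq\<close>)
    show "norm (cos (of_int k * x) / (5 - 4 * cos (2 * x))) \<le> 1" for x :: real
    proof -
      have "\<bar>cos (of_int k * x)\<bar> \<le> \<bar>5 - 4 * cos (2 * x)\<bar>"
        using denom_pos(2)[of "2 * x"] abs_cos_le_one[of "of_int k * x"] by linarith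
      thus ?thesis by (simp add: divide_le_eq)
    qed
  qed simp
  thus ?thesis by (simp add: poisson_int_def)
qed

lemma integral_cos_int: "integral {0..pi} (\<lambda>x. cos (of_int k * x)) = (if k = 0 then pi else 0)"
proof (cases "k = 0")
  case False
  have "((\<lambda>x. cos (of_int k * x)) has_integral (sin (of_int k * pi) / of_int k - sin (of_int k * 0) / of_int k)) {0..pi}"
    by (rule fundamental_theorem_of_calculus)
       (use False in \<open>auto intro!: derivative_eq_intros simp flip: has_real_derivative_iff_has_vector_derivative\<close>)
  moreover have "sin (of_int k * pi) = 0" by (simp add: mult.commute sin_zero_iff_int2)
  ultimately show ?thesis using False by (simp add: integral_unique)
qed simp

text \<open>By the addition formulas the three numerators combine to \<open>cos (k * x)\<close>
  times the denominator, so the integral of a plain cosine remains.\<close>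

lemma poisson_int_rec: "5 * poisson_int k - 2 * poisson_int (k + 2) - 2 * poisson_int (k - 2) = (if k = 0 then pi else 0)"
proof -
  have "5 * poisson_int k - 2 * poisson_int (k + 2) - 2 * poisson_int (k - 2)
    = integral {0..pi} (\<lambda>x. 5 * (cos (of_int k * x) / (5 - 4 * cos (2 * x)))
        - 2 * (cos (of_int (k + 2) * x) / (5 - 4 * cos (2 * x)))
        - 2 * (cos (of_int (k - 2) * x) / (5 - 4 * cos (2 * x))))"
    unfolding poisson_int_def
    by (rule integral_unique[symmetric])
       (intro has_integral_diff has_integral_mult_right integrable_integral poisson_int_integrable)
  also have "\<dots> = integral {0..pi} (\<lambda>x. cos (of_int k * x))"
  proof (rule integral_cong)
    fix x :: real
    have c: "cos (of_int (k + 2) * x) + cos (of_int (k - 2) * x) = 2 * cos (of_int k * x) * cos (2 * x)"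
      using cos_add[of "of_int k * x" "2 * x"] cos_diff[of "of_int k * x" "2 * x"] by (simp add: algebra_simps)
    have "5 * cos (of_int k * x) - 2 * cos (of_int (k + 2) * x) - 2 * cos (of_int (k - 2) * x)
       = cos (of_int k * x) * (5 - 4 * cos (2 * x))" using c by (simp add: algebra_simps)
    thus "5 * (cos (of_int k * x) / (5 - 4 * cos (2 * x))) - 2 * (cos (of_int (k + 2) * x) / (5 - 4 * cos (2 * x)))
        - 2 * (cos (of_int (k - 2) * x) / (5 - 4 * cos (2 * x))) = cos (of_int k * x)"
      using denom_pos(1)[of "2 * x"]
      by (simp only: times_divide_eq_right flip: diff_divide_distrib) simp
  qed
  finally show ?thesis unfolding integral_cos_int .
qed

text \<open>By the recurrence \<open>2 * poisson_int (k + 2) - poisson_int k\<close> doubles at each step, and a bounded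
  sequence that doubles vanishes.\<close>
lemma poisson_int_half:
  assumes "k \<ge> - 1" shows "poisson_int (k + 2) = poisson_int k / 2"
proof (rule ccontr)
  define H where "H k = 2 * poisson_int (k + 2) - poisson_int k" for k
  assume "poisson_int (k + 2) \<noteq> poisson_int k / 2"
  hence H0: "H k \<noteq> 0" by (simp add: H_def)
  have step: "H (k + 2 * int j) = 2 ^ j * H k" for j
  proof (induction j)
    case (Suc j)
    \<comment> \<open>Starting at -1 or later keeps these indices positive, where the right side of
      the recurrence is 0.\<close>
    have "k + 2 * int (Suc j) \<noteq> 0" using assms by simp
    hence "H (k + 2 * int (Suc j)) = 2 * H (k + 2 * int j)"
      using poisson_int_rec[of "k + 2 * int (Suc j)"] by (simp add: H_def algebra_simps)
    thus ?case using Suc by simp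
  qed simp
  obtain j where j: "2 ^ j > 3 * pi / \<bar>H k\<bar>" using real_arch_pow[of 2] by auto
  have "\<bar>H (k + 2 * int j)\<bar> \<le> 3 * pi"
    using poisson_int_bound[of "k + 2 * int j + 2"] poisson_int_bound[of "k + 2 * int j"] unfolding H_def by linarith
  hence "2 ^ j * \<bar>H k\<bar> \<le> 3 * pi" unfolding step by (simp add: abs_mult)
  with j H0 show False by (simp add: field_simps)
qed

text \<open>Halving at index -1 together with evenness makes the odd coefficients vanish; at index 0
  it turns the inhomogeneous recurrence into \<open>3 * poisson_int 0 = pi\<close>. The sum of two
  powers covers both parities in one formula.\<close>

lemma poisson_int_nat: "(1 / sqrt 2) ^ n * poisson_int (int n) = pi / 6 * ((1/2) ^ n + (- 1/2) ^ n)"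
proof (induction n rule: induct_nat_012)
  case 0
  have "poisson_int 2 = poisson_int 0 / 2" using poisson_int_half[of 0] by simp
  thus ?case using poisson_int_rec[of 0] poisson_int_minus[of 2] by simp
next
  case 1
  show ?case using poisson_int_half[of "- 1"] poisson_int_minus[of 1] by simp
next
  case (ge2 n)
  have "poisson_int (int (Suc (Suc n))) = poisson_int (int n) / 2" using poisson_int_half[of "int n"] by (simp add: add.commute)
  moreover have "(1 / sqrt 2) ^ Suc (Suc n) = (1 / sqrt 2) ^ n / 2"
    using power_add[of "1 / sqrt 2" 2 n] by (simp add: power_divide)
  ultimately have "(1 / sqrt 2) ^ Suc (Suc n) * poisson_int (int (Suc (Suc n))) = (1 / sqrt 2) ^ n * poisson_int (int n) / 4"
    by simp
  thus ?case unfolding ge2(1) by (simp add: field_simps)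
qed

section \<open>Integration against the spectral measure\<close>

lemma mu_density_cont: "continuous_on Sig mu_density"
proof -
  have "- lam\<^sup>2 + 6 * lam > 0" if "lam \<in> Sig" for lam
  proof -
    have "\<bar>lam - 3\<bar> \<le> 2 * sqrt 2" using that by (auto simp: Sig_def)
    hence "(lam - 3)\<^sup>2 \<le> (2 * sqrt 2)\<^sup>2" by (metis abs_le_square_iff abs_of_nonneg real_sqrt_ge_zero mult_nonneg_nonneg zero_le_numeral)
    thus ?thesis by (simp add: power2_eq_square algebra_simps)
  qed
  thus ?thesis unfolding mu_density_def by (intro continuous_intros) fastforce
qed

lemma mu_density_nonneg: "lam \<in> Sig \<Longrightarrow> mu_density lam \<ge> 0"
proof -
  assume l: "lam \<in> Sig"
  have "\<bar>lam - 3\<bar> \<le> 2 * sqrt 2" using l by (auto simp: Sig_def)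
  hence "(lam - 3)\<^sup>2 \<le> (2 * sqrt 2)\<^sup>2" by (metis abs_le_square_iff abs_of_nonneg real_sqrt_ge_zero mult_nonneg_nonneg zero_le_numeral)
  hence "- lam\<^sup>2 + 6 * lam - 1 \<ge> 0" by (simp add: power2_eq_square algebra_simps)
  thus ?thesis by (simp add: mu_density_def)
qed

lemma sets_mu [measurable_cong, simp]: "sets mu = sets borel"
  by (simp add: mu_def)

lemma space_mu [simp]: "space mu = UNIV"
  by (simp add: mu_def)

lemma weight_measurable: "(\<lambda>lam. indicator Sig lam * mu_density lam) \<in> borel_measurable borel"
proof -
  have "set_borel_measurable borel Sig mu_density"
    unfolding Sig_def[symmetric]
    by (rule set_measurable_continuous_on[OF _ mu_density_cont]) (simp add: Sig_def)
  thus ?thesis by (simp add: set_borel_measurable_def)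
qed

lemma weight_nonneg: "indicator Sig lam * mu_density lam \<ge> 0"
  using mu_density_nonneg by (simp add: indicator_def)

lemma mu_integrable_cont:
  fixes f :: "real \<Rightarrow> real"
  assumes "continuous_on UNIV f"
  shows "integrable mu f"
proof -
  have m: "f \<in> borel_measurable borel" using assms by (rule borel_measurable_continuous_onI)
  have "set_integrable lborel Sig (\<lambda>lam. mu_density lam * f lam)"
    unfolding Sig_def
    by (rule borel_integrable_atLeastAtMost', fold Sig_def)
       (intro continuous_intros mu_density_cont continuous_on_subset[OF assms] subset_UNIV)
  thus ?thesis unfolding mu_def
    using m weight_measurable weight_nonneg
    by (subst integrable_density) (auto simp: set_integrable_def mult.assoc)
qed

text \<open>Under \<open>lam = 3 - 2 * sqrt 2 * cos x\<close> the root in the density and the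
  derivative of the substitution are both \<open>2 * sqrt 2 * sin x\<close>, and the quadratic in
  the denominator becomes 1 + 8 sin^2 x, the Poisson denominator.\<close>

lemma mu_integral_cont:
  fixes f :: "real \<Rightarrow> real"
  assumes "continuous_on UNIV f"
  shows "integral\<^sup>L mu f
    = integral {0..pi} (\<lambda>x. 36 / pi * (sin x)\<^sup>2 / (5 - 4 * cos (2 * x)) * f (3 - 2 * sqrt 2 * cos x))"
proof -
  define g where "g x = 3 - 2 * sqrt 2 * cos x" for x :: real
  define g' where "g' x = 2 * sqrt 2 * sin x" for x :: real
  define h where "h lam = mu_density lam * f lam" for lam
  have m: "f \<in> borel_measurable borel" using assms by (rule borel_measurable_continuous_onI)
  have S: "{g 0..g pi} = Sig" by (simp add: g_def Sig_def)
  have i: "set_integrable lborel {g 0..g pi} h"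
    unfolding h_def S
    unfolding Sig_def
    by (rule borel_integrable_atLeastAtMost', fold Sig_def)
       (intro continuous_intros mu_density_cont continuous_on_subset[OF assms] subset_UNIV)
  have d: "(g has_real_derivative g' x) (at x)" for x
    unfolding g_def g'_def by (auto intro!: derivative_eq_intros)
  have c: "continuous_on {0..pi} g'" unfolding g'_def by (intro continuous_intros)
  have nn: "g' x \<ge> 0" if "x \<in> {0..pi}" for x using that sin_ge_zero[of x] by (auto simp: g'_def)
  note sub = integral_substitution[OF i d c nn pi_ge_zero]
  have "integral\<^sup>L mu f = (LBINT lam. h lam * indicator {g 0..g pi} lam)"
    unfolding mu_def S h_def using m weight_measurable weight_nonneg
    by (subst integral_density) (auto simp: mult_ac)
  also have "\<dots> = (LBINT x. h (g x) * g' x * indicator {0..pi} x)" by (rule sub(2))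
  also have "\<dots> = integral {0..pi} (\<lambda>x. h (g x) * g' x)"
    using set_borel_integral_eq_integral(2)[OF sub(1)]
    by (simp add: set_lebesgue_integral_def mult.commute)
  also have "\<dots> = integral {0..pi} (\<lambda>x. 36 / pi * (sin x)\<^sup>2 / (5 - 4 * cos (2 * x)) * f (3 - 2 * sqrt 2 * cos x))"
  proof (rule integral_cong)
    fix x :: real assume x: "x \<in> {0..pi}"
    have s: "sin x \<ge> 0" using x by (intro sin_ge_zero) auto
    have e: "- (g x)\<^sup>2 + 6 * g x = 1 + 8 * (sin x)\<^sup>2"
      by (simp add: g_def power2_diff power_mult_distrib sin_squared_eq algebra_simps)
    have "sqrt (- (g x)\<^sup>2 + 6 * g x - 1) = 2 * sqrt 2 * sin x"
      unfolding e using s by (simp add: real_sqrt_mult real_sqrt_unique)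
    hence "mu_density (g x) * g' x = 9 * (2 * sqrt 2 * sin x) / (2 * pi * (1 + 8 * (sin x)\<^sup>2)) * (2 * sqrt 2 * sin x)"
      unfolding mu_density_def g'_def e by simp
    also have "\<dots> = 36 / pi * (sin x)\<^sup>2 / (1 + 8 * (sin x)\<^sup>2)"
    proof -
      have "9 * (2 * sqrt 2 * s) / (2 * pi * d) * (2 * sqrt 2 * s) = 36 / pi * s\<^sup>2 / d" for s d
        by (cases "d = 0") (auto simp: power2_eq_square field_simps sqrt2_mult)
      thus ?thesis .
    qed
    also have "1 + 8 * (sin x)\<^sup>2 = 5 - 4 * cos (2 * x)" by (simp add: cos_double_sin)
    finally have m: "mu_density (g x) * g' x = 36 / pi * (sin x)\<^sup>2 / (5 - 4 * cos (2 * x))" .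
    have "h (g x) * g' x = mu_density (g x) * g' x * f (g x)" by (simp add: h_def mult_ac)
    thus "h (g x) * g' x = 36 / pi * (sin x)\<^sup>2 / (5 - 4 * cos (2 * x)) * f (3 - 2 * sqrt 2 * cos x)"
      unfolding m by (simp only: g_def)
  qed
  finally show ?thesis .
qed

text \<open>Here the normalisation of \<open>mu\<close> is confirmed: the kernels of P_lambda
  integrate to the kernel of the identity minus that of the projection for eigenvalue 6.\<close>

lemma integral_pol: "integral\<^sup>L mu (pol n) = (if n = 0 then 1 else 0) - 1/3 * (- 1/2) ^ n"
proof -
  \<comment> \<open>The \<open>36 / pi\<close> of the substituted density times the
    \<open>1/9\<close> and the power in \<open>pol_trig\<close>.\<close>
  define c where "c = 4 / pi * (1 / sqrt 2) ^ n"
  define J where "J k x = cos (of_int k * x) / (5 - 4 * cos (2 * x))" for k :: int and x :: real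
  have J: "J k integrable_on {0..pi}" for k using poisson_int_integrable[of k] by (simp add: J_def[abs_def])
  have "integral\<^sup>L mu (pol n)
    = integral {0..pi} (\<lambda>x. c * (J (int n) x - (J (int n + 2) x + J (int n - 2) x) / 2
        + (J (int n - 1) x - J (int n + 1) x) / (2 * sqrt 2)))"
    unfolding mu_integral_cont[OF pol_cont]
  proof (rule integral_cong)
    fix x :: real
    define d where "d = 5 - 4 * cos (2 * x)"
    have s2: "cos (of_int (int n + 2) * x) + cos (of_int (int n - 2) * x) = 2 * cos (n * x) * cos (2 * x)"
      using cos_add[of "n * x" "2 * x"] cos_diff[of "n * x" "2 * x"] by (simp add: algebra_simps)
    have s1: "cos (of_int (int n - 1) * x) - cos (of_int (int n + 1) * x) = 2 * sin (n * x) * sin x"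
      using cos_add[of "n * x" x] cos_diff[of "n * x" x] by (simp add: algebra_simps)
    have "36 / pi * (sin x)\<^sup>2 / d * pol n (3 - 2 * sqrt 2 * cos x)
       = 36 / pi * sin x / d * (pol n (3 - 2 * sqrt 2 * cos x) * sin x)"
      by (simp add: power2_eq_square)
    also have "\<dots> = c * ((2 * cos (n * x) * (sin x)\<^sup>2 + sin (n * x) * sin x / sqrt 2) / d)"
      unfolding pol_trig c_def by (simp add: power2_eq_square algebra_simps add_divide_distrib)
    also have "2 * cos (n * x) * (sin x)\<^sup>2 + sin (n * x) * sin x / sqrt 2
      = cos (of_int (int n) * x) - (cos (of_int (int n + 2) * x) + cos (of_int (int n - 2) * x)) / 2
        + (cos (of_int (int n - 1) * x) - cos (of_int (int n + 1) * x)) / (2 * sqrt 2)"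
      unfolding s1 s2 cos_double_sin by (simp add: algebra_simps diff_divide_distrib)
    finally have e: "36 / pi * (sin x)\<^sup>2 / d * pol n (3 - 2 * sqrt 2 * cos x) = c * ((cos (of_int (int n) * x)
        - (cos (of_int (int n + 2) * x) + cos (of_int (int n - 2) * x)) / 2
        + (cos (of_int (int n - 1) * x) - cos (of_int (int n + 1) * x)) / (2 * sqrt 2)) / d)" .
    have "(A - (B + C) / 2 + (P - Q) / (2 * sqrt 2)) / d = A / d - (B / d + C / d) / 2 + (P / d - Q / d) / (2 * sqrt 2)"
      for A B C P Q by (simp add: add_divide_distrib diff_divide_distrib mult.commute)
    thus "36 / pi * (sin x)\<^sup>2 / (5 - 4 * cos (2 * x)) * pol n (3 - 2 * sqrt 2 * cos x)
      = c * (J (int n) x - (J (int n + 2) x + J (int n - 2) x) / 2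
        + (J (int n - 1) x - J (int n + 1) x) / (2 * sqrt 2))"
      using e unfolding J_def d_def[symmetric] by (simp only:)
  qed
  also have "\<dots> = c * (poisson_int (int n) - (poisson_int (int n + 2) + poisson_int (int n - 2)) / 2
        + (poisson_int (int n - 1) - poisson_int (int n + 1)) / (2 * sqrt 2))"
  proof -
    have "((\<lambda>x. c * (J (int n) x - (J (int n + 2) x + J (int n - 2) x) / 2
        + (J (int n - 1) x - J (int n + 1) x) / (2 * sqrt 2))) has_integral
       c * (poisson_int (int n) - (poisson_int (int n + 2) + poisson_int (int n - 2)) / 2
        + (poisson_int (int n - 1) - poisson_int (int n + 1)) / (2 * sqrt 2))) {0..pi}"
    proof -
      have hi: "(J k has_integral poisson_int k) {0..pi}" for k
        using integrable_integral[OF J[of k]] by (simp add: poisson_int_def J_def[abs_def])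
      show ?thesis
        by (intro has_integral_mult_right has_integral_add has_integral_diff has_integral_divide)
           (use hi[of "int n + 2"] hi[of "int n + 1"] hi in \<open>auto simp: add.commute\<close>)
    qed
    thus ?thesis by (rule integral_unique)
  qed
  also have "\<dots> = (if n = 0 then 1 else 0) - 1/3 * (- 1/2) ^ n"
  \<comment> \<open>For \<open>n = 0\<close> the index \<open>n - 2\<close> is outside the range of
    the halving rule, and evenness replaces it.\<close>
  proof (cases n)
    case 0
    have "poisson_int 2 = poisson_int 0 / 2" "poisson_int (- 2) = poisson_int 2" "poisson_int (- 1) = poisson_int 1" "poisson_int 0 = pi / 3"
      using poisson_int_half[of 0] poisson_int_minus[of 2] poisson_int_minus[of 1] poisson_int_nat[of 0] by simp_all
    thus ?thesis using 0 by (simp add: c_def field_simps)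
  next
    case (Suc m)
    have i: "int n + 1 = int m + 2" "int n - 1 = int m" "int n - 2 + 2 = int n" using Suc by simp_all
    have "poisson_int (int n + 2) = poisson_int (int n) / 2" by (rule poisson_int_half) simp
    moreover have "poisson_int (int n + 1) = poisson_int (int m) / 2" unfolding i(1) by (rule poisson_int_half) simp
    moreover have "poisson_int (int n) = poisson_int (int n - 2) / 2"
      using poisson_int_half[of "int n - 2"] Suc unfolding i(3) by simp
    ultimately have "c * (poisson_int (int n) - (poisson_int (int n + 2) + poisson_int (int n - 2)) / 2
        + (poisson_int (int n - 1) - poisson_int (int n + 1)) / (2 * sqrt 2))
      = c * (- poisson_int n / 4 + poisson_int m / (4 * sqrt 2))" by (simp add: i(2) add.commute field_simps)
    also have "\<dots> = 1 / pi * (- ((1 / sqrt 2) ^ n * poisson_int n) + (1 / sqrt 2) ^ m * poisson_int m / 2)"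
      unfolding c_def Suc by (simp add: field_simps)
    also have "\<dots> = - 1/3 * (- 1/2) ^ n"
      unfolding poisson_int_nat Suc by (simp add: field_simps)
    finally show ?thesis using Suc by simp
  qed
  finally show ?thesis .
qed

section \<open>The projection onto eigenvalue 6\<close>

lemma has_sum_sum_finite:
  fixes f :: "'i \<Rightarrow> 'b \<Rightarrow> 'c :: topological_comm_monoid_add"
  assumes "finite I" "\<And>i. i \<in> I \<Longrightarrow> (f i has_sum a i) X"
  shows "((\<lambda>x. \<Sum>i\<in>I. f i x) has_sum (\<Sum>i\<in>I. a i)) X"
  using assms by (induction I rule: finite_induct) (auto intro!: has_sum_add has_sum_0)

context cubic_tree
begin

text \<open>The distances at a vertex are m, m + 1, m + 1, and 1 - 1/2 - 1/2 = 0. A function with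
  zero sum over every star has adjacency eigenvalue -2, which is eigenvalue 6 of the negative
  Laplacian.\<close>

lemma sum_star_kernel:
  assumes "y \<in> E" "v \<in> V"
  shows "(\<Sum>e\<in>star v. (- 1/2 :: real) ^ D y e) = 0"
proof -
  obtain e1 e2 e3 where "star v = {e1, e2, e3}" "distinct [e1, e2, e3]"
    "D y e2 = Suc (D y e1)" "D y e3 = Suc (D y e1)"
    using star_split[OF assms] by metis
  thus ?thesis by simp
qed

text \<open>An edge and its two children form a star, so passing to the children changes the sign of
  the sum; the root belongs to two stars, hence the factor 2.\<close>

lemma sum_sphere_balanced:
  fixes f :: "'v set \<Rightarrow> real"
  assumes x: "x \<in> E" and f: "\<And>v. v \<in> V \<Longrightarrow> (\<Sum>e\<in>star v. f e) = 0"
  shows "(\<Sum>e\<in>sphere x (Suc n). f e) = 2 * (- 1) ^ Suc n * f x"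
proof (induction n)
  case 0
  obtain a b where ab: "a \<in> V" "b \<in> V" "a \<noteq> b" "x = {a, b}" using x by (metis edge_ends)
  have m: "x \<in> star a" "x \<in> star b" using ab x by (auto simp: star_def)
  have "(\<Sum>e\<in>sphere x (Suc 0). f e) = (\<Sum>e\<in>nbrs x. f e)"
    unfolding sum_sphere_Suc[OF x] using x by (simp add: sphere_0 children_root)
  also have "\<dots> = (\<Sum>e\<in>star a - {x}. f e) + (\<Sum>e\<in>star b - {x}. f e)"
    unfolding ab(4)
    by (subst nbrs_eq, use x ab in simp, subst sum.union_disjoint)
       (use ab star_inter[of a b] x finite_star in auto)
  also have "\<dots> = - 2 * f x"
    using f[OF ab(1)] f[OF ab(2)] sum.remove[OF finite_star[OF ab(1)] m(1), of f]
      sum.remove[OF finite_star[OF ab(2)] m(2), of f] by linarith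
  finally show ?case by simp
next
  case (Suc n)
  have "(\<Sum>c\<in>children x e. f c) = - f e" if e: "e \<in> sphere x (Suc n)" for e
  proof -
    have "e \<in> E" "D x e \<noteq> 0" using e by (auto simp: sphere_def)
    hence "x \<noteq> e" by auto
    obtain b g h c1 c2 where s: "b \<in> V" "star b = {e, c1, c2}" "distinct [e, g, h, c1, c2]"
      "nbrs e = {g, h, c1, c2}" "children x e = {c1, c2}"
      "nbrs c1 = {e, c2} \<union> children x c1" "nbrs c2 = {e, c1} \<union> children x c2"
      "D x e = Suc (D x g)" "D x h = D x e" "D x c1 = Suc (D x e)" "D x c2 = Suc (D x e)"
      by (rule children_split[OF x \<open>e \<in> E\<close> \<open>x \<noteq> e\<close>])
    show ?thesis using f[OF s(1)] s(3) unfolding s(2,5) by simp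
  qed
  hence "(\<Sum>e\<in>sphere x (Suc (Suc n)). f e) = (\<Sum>e\<in>sphere x (Suc n). - f e)"
    unfolding sum_sphere_Suc[OF x, where n = "Suc n"] by (rule sum.cong[OF refl])
  thus ?case using Suc by (simp add: sum_negf)
qed

lemma card_sphere: "x \<in> E \<Longrightarrow> card (sphere x (Suc n)) = 4 * 2 ^ n"
proof (induction n)
  case 0
  have "sphere x (Suc 0) = nbrs x" using 0 by (simp add: sphere_Suc sphere_0 children_root)
  thus ?case using card_nbrs[OF 0] by simp
next
  case (Suc n)
  have "card (sphere x (Suc (Suc n))) = (\<Sum>e\<in>sphere x (Suc n). card (children x e))"
    using sum_sphere_Suc[OF Suc(2), of "\<lambda>_. 1::nat" "Suc n"] by simp
  also have "\<dots> = (\<Sum>e\<in>sphere x (Suc n). 2)"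
    by (rule sum.cong[OF refl]) (use card_children[OF Suc(2)] in \<open>force simp: sphere_def\<close>)
  finally show ?case using Suc by simp
qed

lemma finite_subset_eball:
  assumes "finite X" "X \<subseteq> E" shows "\<exists>n0. \<forall>n\<ge>n0. X \<subseteq> eball x n"
proof -
  obtain n0 where "\<forall>n\<ge>n0. \<forall>y\<in>X. D x y < n" using eventually_far[OF assms(1)] by blast
  thus ?thesis using assms(2) by (intro exI[of _ n0]) (force simp: eball_def)
qed

lemma eball_filterlim: "x \<in> E \<Longrightarrow> filterlim (eball x) (finite_subsets_at_top E) sequentially"
  unfolding filterlim_finite_subsets_at_top
proof (intro allI impI)
  fix X assume x: "x \<in> E" and X: "finite X \<and> X \<subseteq> E"
  then obtain n0 where "\<forall>n\<ge>n0. X \<subseteq> eball x n" using finite_subset_eball by blast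
  thus "\<forall>\<^sub>F n in sequentially. finite (eball x n) \<and> X \<subseteq> eball x n \<and> eball x n \<subseteq> E"
    unfolding eventually_sequentially using finite_eball[OF x] by (auto simp: eball_def)
qed

text \<open>The sphere sums are 1 at radius 0 and \<open>2 * (1/2) ^ m\<close> at radius m > 0, in
  total 3. With the factor 1/3 of the projection kernel this makes the squared norm 1/3, the value
  of that kernel on the diagonal.\<close>

lemma kernel_sq_summable:
  assumes x: "x \<in> E" shows "(\<lambda>z. ((- 1/2 :: real) ^ D x z)\<^sup>2) summable_on E"
proof (rule nonneg_bdd_above_summable_on)
  have ball: "(\<Sum>z\<in>eball x n. ((- 1/2 :: real) ^ D x z)\<^sup>2) \<le> 3" for n
  proof -
    have s: "(\<Sum>z\<in>sphere x m. ((- 1/2 :: real) ^ D x z)\<^sup>2) = (if m = 0 then 1 else 2 * (1/2) ^ m)" for m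
    proof -
      have "(\<Sum>z\<in>sphere x m. ((- 1/2 :: real) ^ D x z)\<^sup>2) = (\<Sum>z\<in>sphere x m. (1/4) ^ m)"
        by (rule sum.cong) (auto simp: sphere_def power2_eq_square simp flip: power_mult_distrib)
      also have "\<dots> = card (sphere x m) * (1/4) ^ m" by simp
      also have "\<dots> = (if m = 0 then 1 else 2 * (1/2) ^ m)"
      proof (cases m)
        case (Suc k)
        have "(2::real) ^ k * (1/4) ^ k = (1/2) ^ k" by (simp flip: power_mult_distrib)
        thus ?thesis using card_sphere[OF x, of k] Suc by simp
      qed (use x in \<open>simp add: sphere_0\<close>)
      finally show ?thesis .
    qed
    have "(\<Sum>z\<in>eball x n. ((- 1/2 :: real) ^ D x z)\<^sup>2) = 3 - 2 * (1/2) ^ n"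
      unfolding sum_eball[OF x] s by (induction n) auto
    thus ?thesis by simp
  qed
  show "bdd_above (sum (\<lambda>z. ((- 1/2 :: real) ^ D x z)\<^sup>2) ` {X. X \<subseteq> E \<and> finite X})"
  proof (rule bdd_aboveI2)
    fix X assume "X \<in> {X. X \<subseteq> E \<and> finite X}"
    then obtain n where "X \<subseteq> eball x n" using finite_subset_eball[of X x] by blast
    hence "(\<Sum>z\<in>X. ((- 1/2 :: real) ^ D x z)\<^sup>2) \<le> (\<Sum>z\<in>eball x n. ((- 1/2 :: real) ^ D x z)\<^sup>2)"
      by (intro sum_mono2 finite_eball x) auto
    thus "(\<Sum>z\<in>X. ((- 1/2 :: real) ^ D x z)\<^sup>2) \<le> 3" using ball[of n] by linarith
  qed
qed simp

definition kern :: "'v set \<Rightarrow> 'v set \<Rightarrow> real" where "kern x y = 1/3 * (- 1/2) ^ D x y"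

lemma kern_sym: "kern x y = kern y x"
  by (simp add: kern_def D_sym)

lemma kern_product_summable:
  fixes f :: "'v set \<Rightarrow> real"
  assumes x: "x \<in> E" and f: "(\<lambda>z. (f z)\<^sup>2) summable_on E"
  shows "(\<lambda>z. norm (kern x z * f z)) summable_on E"
proof (rule Infinite_Sum.abs_summable_on_comparison_test)
  have k: "(\<lambda>z. (kern x z)\<^sup>2) summable_on E"
    unfolding kern_def power_mult_distrib by (intro summable_on_cmult_right kernel_sq_summable x)
  show "(\<lambda>z. norm ((kern x z)\<^sup>2 + (f z)\<^sup>2)) summable_on E"
    using summable_on_add[OF k f] by (simp add: abs_of_nonneg add_nonneg_nonneg)
  show "norm (kern x z * f z) \<le> norm ((kern x z)\<^sup>2 + (f z)\<^sup>2)" for z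
  proof -
    have "2 * (\<bar>kern x z\<bar> * \<bar>f z\<bar>) \<le> (kern x z)\<^sup>2 + (f z)\<^sup>2"
      using sum_squares_bound[of "\<bar>kern x z\<bar>" "\<bar>f z\<bar>"] by simp
    moreover have "0 \<le> \<bar>kern x z\<bar> * \<bar>f z\<bar>" by simp
    ultimately have "\<bar>kern x z\<bar> * \<bar>f z\<bar> \<le> (kern x z)\<^sup>2 + (f z)\<^sup>2" by linarith
    thus ?thesis by (simp add: abs_mult)
  qed
qed

text \<open>For fixed \<open>y\<close> the kernel sums to 0 over every star, so its sums over
  spheres of positive radius around \<open>x\<close> are plus or minus twice its value at
  \<open>x\<close>. Against the second kernel the signs cancel, and the weights 1/3 + 2/3 (1/2 + 1/4
  + ...) add up to 1.\<close>

lemma kern_reproducing: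
  assumes x: "x \<in> E" and y: "y \<in> E"
  shows "((\<lambda>z. kern z x * kern z y) has_sum kern x y) E"
proof -
  let ?g = "\<lambda>z. kern x z * kern y z"
  have star0: "(\<Sum>e\<in>star v. kern y e) = 0" if "v \<in> V" for v
    using sum_star_kernel[OF y that] unfolding kern_def sum_distrib_left[symmetric] by simp
  have summ: "?g summable_on E"
  proof (rule Infinite_Sum.abs_summable_summable, rule kern_product_summable[OF x])
    show "(\<lambda>z. (kern y z)\<^sup>2) summable_on E"
      unfolding kern_def power_mult_distrib by (intro summable_on_cmult_right kernel_sq_summable y)
  qed
  have s: "(\<Sum>z\<in>sphere x m. ?g z) = (if m = 0 then 1/3 * kern x y else 2/3 * (1/2) ^ m * kern x y)" for m
  proof (cases m)
    case 0
    thus ?thesis using x by (simp add: sphere_0 kern_def[of x x] kern_sym)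
  next
    case (Suc k)
    have "(\<Sum>z\<in>sphere x m. ?g z) = (\<Sum>z\<in>sphere x m. 1/3 * (- 1/2) ^ m * kern y z)"
      by (rule sum.cong) (auto simp: sphere_def kern_def[of x])
    also have "\<dots> = 1/3 * (- 1/2) ^ m * (2 * (- 1) ^ m * kern y x)"
    proof -
      have "(\<Sum>z\<in>sphere x m. kern y z) = 2 * (- 1) ^ m * kern y x"
        unfolding Suc by (rule sum_sphere_balanced[OF x]) (rule star0)
      thus ?thesis unfolding sum_distrib_left[symmetric] by (simp only:)
    qed
    also have "(- 1/2 :: real) ^ m * (- 1) ^ m = (1/2) ^ m" by (simp flip: power_mult_distrib)
    hence "1/3 * (- 1/2) ^ m * (2 * (- 1) ^ m * kern y x) = 2/3 * (1/2) ^ m * kern x y"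
      by (simp add: kern_sym mult_ac)
    finally show ?thesis using Suc by simp
  qed
  have "(\<lambda>n. \<Sum>z\<in>eball x n. ?g z) \<longlonglongrightarrow> infsum ?g E"
    by (rule filterlim_compose[OF infsum_tendsto[OF summ] eball_filterlim[OF x]])
  moreover have "(\<Sum>z\<in>eball x n. ?g z) = kern x y * (1 - 2/3 * (1/2) ^ n)" for n
    unfolding sum_eball[OF x] s by (induction n) (auto simp: field_simps)
  moreover have "(\<lambda>n. kern x y * (1 - 2/3 * (1/2) ^ n)) \<longlonglongrightarrow> kern x y * (1 - 2/3 * 0)"
    by (intro tendsto_intros LIMSEQ_power_zero) auto
  ultimately have "infsum ?g E = kern x y" using LIMSEQ_unique by fastforce
  moreover have "(\<lambda>z. kern z x * kern z y) = ?g" by (auto simp: kern_sym)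
  ultimately show ?thesis using has_sum_infsum[OF summ] by simp
qed

section \<open>The Plancherel identity for finite supports\<close>

definition P6fin :: "'v set set \<Rightarrow> ('v set \<Rightarrow> complex) \<Rightarrow> 'v set \<Rightarrow> complex" where
  "P6fin A F x = (\<Sum>y\<in>A. of_real (kern x y) * F y)"

lemma P6fin_norm:
  assumes A: "finite A" "A \<subseteq> E"
  shows "((\<lambda>z. (cmod (P6fin A F z))\<^sup>2) has_sum
     (\<Sum>x\<in>A. \<Sum>y\<in>A. Re (F x * cnj (F y)) * kern x y)) E"
proof -
  have "((\<lambda>z. \<Sum>x\<in>A. \<Sum>y\<in>A. Re (F x * cnj (F y)) * (kern z x * kern z y)) has_sum
     (\<Sum>x\<in>A. \<Sum>y\<in>A. Re (F x * cnj (F y)) * kern x y)) E"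
    using A by (intro has_sum_sum_finite has_sum_cmult_right kern_reproducing) auto
  moreover have "(\<Sum>x\<in>A. \<Sum>y\<in>A. Re (F x * cnj (F y)) * (kern z x * kern z y)) = (cmod (P6fin A F z))\<^sup>2" for z
  proof -
    have "complex_of_real ((cmod (P6fin A F z))\<^sup>2) = P6fin A F z * cnj (P6fin A F z)"
      by (rule complex_norm_square)
    also have "\<dots> = (\<Sum>x\<in>A. \<Sum>y\<in>A. of_real (kern z x * kern z y) * (F x * cnj (F y)))"
      unfolding P6fin_def cnj_sum sum_product by (simp add: mult_ac)
    finally have "(cmod (P6fin A F z))\<^sup>2 = Re (\<Sum>x\<in>A. \<Sum>y\<in>A. of_real (kern z x * kern z y) * (F x * cnj (F y)))"
      by (metis Re_complex_of_real)
    also have "\<dots> = (\<Sum>x\<in>A. \<Sum>y\<in>A. Re (F x * cnj (F y)) * (kern z x * kern z y))"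
    proof -
      have "Re (of_real c * z) = Re z * c" for c z by simp
      thus ?thesis unfolding Re_sum by (simp only:)
    qed
    finally show ?thesis by simp
  qed
  ultimately show ?thesis by simp
qed

lemma qform_eq: "qform lam A F = (\<Sum>x\<in>A. \<Sum>y\<in>A. Re (F x * cnj (F y)) * pol (D x y) lam)"
  unfolding qform_def Re_sum by simp

lemma qform_cont: "continuous_on S (\<lambda>lam. qform lam A F)"
proof -
  have "continuous_on S (\<lambda>lam. pol n lam)" for n using pol_cont[of S n] by simp
  thus ?thesis unfolding qform_eq by (intro continuous_intros)
qed

lemma qform_integrable: "integrable mu (\<lambda>lam. qform lam A F)"
  by (rule mu_integrable_cont[OF qform_cont])

text \<open>The form is expanded over pairs of points and integrated by \<open>integral_pol\<close>.
  The identity kernel gives the squared norm on \<open>A\<close>, and the reproducing property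
  recognises the rest as the norm of the projection.\<close>

lemma qform_integral:
  assumes A: "finite A" "A \<subseteq> E"
  shows "(\<Sum>x\<in>A. (cmod (F x))\<^sup>2) = (LINT lam|mu. qform lam A F) + (\<Sum>\<^sub>\<infinity>z\<in>E. (cmod (P6fin A F z))\<^sup>2)"
proof -
  have i: "integrable mu (pol n)" for n by (rule mu_integrable_cont[OF pol_cont])
  have "(LINT lam|mu. qform lam A F) = (\<Sum>x\<in>A. \<Sum>y\<in>A. Re (F x * cnj (F y)) * integral\<^sup>L mu (pol (D x y)))"
    unfolding qform_eq using i by (simp add: Bochner_Integration.integral_sum)
  also have "\<dots> = (\<Sum>x\<in>A. \<Sum>y\<in>A. (if x = y then (cmod (F x))\<^sup>2 else 0) - Re (F x * cnj (F y)) * kern x y)"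
  proof (intro sum.cong refl)
    fix x y assume xy: "x \<in> A" "y \<in> A"
    have e: "Re (F x * cnj (F y)) = (cmod (F x))\<^sup>2" if "x = y"
      unfolding that by (simp flip: complex_norm_square)
    have iff: "D x y = 0 \<longleftrightarrow> x = y" by (rule D_eq_0) (use xy A in auto)
    have gen: "R * ((if D x y = 0 then 1 else 0) - 1/3 * (- 1/2) ^ D x y)
        = (if x = y then c else 0) - R * (1/3 * (- 1/2) ^ D x y)"
      if "x = y \<Longrightarrow> R = c" for R c :: real
      using that iff by (simp add: right_diff_distrib)
    show "Re (F x * cnj (F y)) * integral\<^sup>L mu (pol (D x y))
       = (if x = y then (cmod (F x))\<^sup>2 else 0) - Re (F x * cnj (F y)) * kern x y"
      unfolding integral_pol kern_def by (rule gen) (rule e)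
  qed
  also have "\<dots> = (\<Sum>x\<in>A. (cmod (F x))\<^sup>2) - (\<Sum>x\<in>A. \<Sum>y\<in>A. Re (F x * cnj (F y)) * kern x y)"
    using A by (simp add: sum_subtractf)
  finally show ?thesis using infsumI[OF P6fin_norm[OF A, of F]] by simp
qed

end

text \<open>The density is 0 off the spectrum and its two end points are Lebesgue null. There
  \<open>wave_base\<close> would be real, so it would not be \<open>admissible\<close>.\<close>

lemma AE_mu_interior: "AE lam in mu. lam \<in> {3 - 2 * sqrt 2 <..< 3 + 2 * sqrt 2}"
proof -
  have w: "(\<lambda>lam. ennreal (indicator Sig lam * mu_density lam)) \<in> borel_measurable lborel"
    using weight_measurable by simp
  have "AE lam in lborel. lam \<noteq> 3 - 2 * sqrt 2" "AE lam in lborel. lam \<noteq> 3 + 2 * sqrt 2"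
    by (rule AE_lborel_singleton)+
  hence "AE lam in lborel. 0 < ennreal (indicator Sig lam * mu_density lam)
      \<longrightarrow> lam \<in> {3 - 2 * sqrt 2 <..< 3 + 2 * sqrt 2}"
    by eventually_elim (auto simp: Sig_def indicator_def split: if_splits)
  thus ?thesis unfolding mu_def by (subst AE_density[OF w])
qed

context cubic_tree
begin

lemma AE_qform_nonneg: "finite A \<Longrightarrow> A \<subseteq> E \<Longrightarrow> AE lam in mu. qform lam A F \<ge> 0"
  using AE_mu_interior
  by eventually_elim (metis qform_nonneg wave_base_props(1,2))

text \<open>Both parts of the Plancherel identity are nonnegative, so each is bounded by the whole;
  these contraction estimates drive the passage to infinite support.\<close>

lemma qform_integral_bounds:
  assumes A: "finite A" "A \<subseteq> E"
  shows "(LINT lam|mu. qform lam A F) \<ge> 0" "(LINT lam|mu. qform lam A F) \<le> (\<Sum>x\<in>A. (cmod (F x))\<^sup>2)"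
    "(\<Sum>\<^sub>\<infinity>z\<in>E. (cmod (P6fin A F z))\<^sup>2) \<le> (\<Sum>x\<in>A. (cmod (F x))\<^sup>2)"
proof -
  show 1: "(LINT lam|mu. qform lam A F) \<ge> 0"
    by (rule integral_nonneg_AE) (rule AE_qform_nonneg[OF A])
  have "(\<Sum>\<^sub>\<infinity>z\<in>E. (cmod (P6fin A F z))\<^sup>2) \<ge> 0" by (rule infsum_nonneg) simp
  thus "(LINT lam|mu. qform lam A F) \<le> (\<Sum>x\<in>A. (cmod (F x))\<^sup>2)"
    "(\<Sum>\<^sub>\<infinity>z\<in>E. (cmod (P6fin A F z))\<^sup>2) \<le> (\<Sum>x\<in>A. (cmod (F x))\<^sup>2)"
    using qform_integral[OF A, of F] 1 by linarith+
qed

lemma P6fin_sq_summable: "finite A \<Longrightarrow> A \<subseteq> E \<Longrightarrow> (\<lambda>z. (cmod (P6fin A F z))\<^sup>2) summable_on E"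
  using P6fin_norm by (auto simp: summable_on_def)

lemma P6_eq_lim:
  assumes F: "in_l2 E F" and x: "x \<in> E"
  shows "((\<lambda>B. P6fin B F x) \<longlongrightarrow> P6 E F x) (finite_subsets_at_top E)"
proof -
  have "(\<lambda>y. (cmod (F y))\<^sup>2) summable_on E" using F by (simp add: in_l2_def)
  from kern_product_summable[OF x this]
  have "(\<lambda>y. norm (complex_of_real (kern x y) * F y)) summable_on E"
    by (simp add: norm_mult abs_mult)
  hence "(\<lambda>y. complex_of_real (kern x y) * F y) summable_on E"
    by (rule Infinite_Sum.abs_summable_summable)
  from infsum_tendsto[OF this] show ?thesis
    unfolding P6fin_def P6_def kern_def by simp
qed

end

section \<open>Square-summable functions\<close>

lemma borel_measurable_mu: "f \<in> borel_measurable borel \<Longrightarrow> f \<in> borel_measurable mu"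
  by (simp add: measurable_cong_sets[OF sets_mu refl])

lemma norm_diff_sq_le: "(cmod (a - b))\<^sup>2 \<le> 2 * (cmod a)\<^sup>2 + 2 * (cmod b)\<^sup>2"
proof -
  have "(cmod (a - b))\<^sup>2 \<le> (cmod a + cmod b)\<^sup>2" by (intro power_mono norm_triangle_ineq4) simp
  thus ?thesis using sum_squares_bound[of "cmod a" "cmod b"] by (simp add: power2_sum)
qed

text \<open>Young's inequality with a free parameter \<open>e\<close>, later matched with the speed
  of the truncations.\<close>

lemma norm_sq_perturb:
  fixes a b :: complex assumes "e > 0"
  shows "\<bar>(cmod a)\<^sup>2 - (cmod b)\<^sup>2\<bar> \<le> e * (cmod b)\<^sup>2 + (1 + 1 / e) * (cmod (a - b))\<^sup>2"
proof -
  define s t d where "s = cmod a" and "t = cmod b" and "d = cmod (a - b)"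
  have nn: "s \<ge> 0" "t \<ge> 0" "d \<ge> 0" "s \<le> t + d" "t \<le> s + d"
    using norm_triangle_ineq[of b "a - b"] norm_triangle_ineq[of a "b - a"]
    by (auto simp: s_def t_def d_def norm_minus_commute)
  have "2 * (t * d) \<le> e * t\<^sup>2 + d\<^sup>2 / e"
  proof -
    have "0 \<le> (e * t - d)\<^sup>2 / e" using assms by simp
    also have "\<dots> = e * t\<^sup>2 + d\<^sup>2 / e - 2 * (t * d)"
      using assms by (simp add: power2_eq_square field_simps)
    finally show ?thesis by simp
  qed
  moreover have "s\<^sup>2 \<le> (t + d)\<^sup>2" using nn by (intro power_mono) auto
  moreover have "t\<^sup>2 - s\<^sup>2 \<le> 2 * (t * d)"
  proof (cases "d \<le> t")
    case True
    have "(t - d)\<^sup>2 \<le> s\<^sup>2" using nn True by (intro power_mono) auto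
    moreover have "(t - d)\<^sup>2 = t\<^sup>2 - 2 * (t * d) + d\<^sup>2" by (simp add: power2_diff)
    ultimately show ?thesis using zero_le_power2[of d] by linarith
  next
    case False
    hence "t * t \<le> t * d" using nn by (intro mult_left_mono) auto
    moreover have "0 \<le> t * d" using nn by simp
    ultimately show ?thesis using zero_le_power2[of s] unfolding power2_eq_square[of t] by linarith
  qed
  ultimately have "\<bar>s\<^sup>2 - t\<^sup>2\<bar> \<le> e * t\<^sup>2 + d\<^sup>2 / e + d\<^sup>2"
    using zero_le_power2[of d] unfolding abs_le_iff power2_sum by linarith
  thus ?thesis by (simp add: s_def t_def d_def algebra_simps)
qed

lemma has_mean_inner_unique:
  assumes "E \<noteq> {}" "has_mean_inner E f g L" "has_mean_inner E f g L'" shows "L = L'"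
  using assms LIMSEQ_unique unfolding has_mean_inner_def by blast

lemma mean_inner_eq: "E \<noteq> {} \<Longrightarrow> has_mean_inner E f g L \<Longrightarrow> mean_inner E f g = L"
  unfolding mean_inner_def using has_mean_inner_unique by blast

text \<open>Holds at the end points too, since \<open>1 / 0 = 0\<close> is read in the same way on
  both sides. The rational expression gives measurability without going through
  \<open>arccos\<close>.\<close>

lemma bfun_on_Sig: "lam \<in> Sig \<Longrightarrow> bfun lam = 8 + 1 / ((- lam\<^sup>2 + 6 * lam - 1) / 8)"
proof -
  assume lam: "lam \<in> Sig"
  have l: "3 - lam = 2 * sqrt 2 * cos (t_of lam * ln 2)" using t_of_correct(2)[OF lam] by simp
  have "(3 - lam)\<^sup>2 = 8 * (cos (t_of lam * ln 2))\<^sup>2" unfolding l by (simp add: power_mult_distrib)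
  hence "(sin (t_of lam * ln 2))\<^sup>2 = (- lam\<^sup>2 + 6 * lam - 1) / 8"
    unfolding sin_squared_eq by (simp add: power2_eq_square algebra_simps)
  thus ?thesis unfolding bfun_def by (simp only:)
qed

locale l2_function = cubic_tree V E for V :: "'v set" and E :: "'v set set" +
  fixes F :: "'v set \<Rightarrow> complex"
  assumes F: "in_l2 E F"
begin

section \<open>Finite truncations of a square-summable function\<close>

definition mass :: "'v set set \<Rightarrow> real" where "mass B = (\<Sum>x\<in>B. (cmod (F x))\<^sup>2)"

abbreviation total :: real where "total \<equiv> l2_norm_sq E F"

lemma has_sum_F: "((\<lambda>x. (cmod (F x))\<^sup>2) has_sum total) E"
  using F unfolding in_l2_def l2_norm_sq_def by (rule has_sum_infsum)

lemma mass_le: "finite B \<Longrightarrow> B \<subseteq> E \<Longrightarrow> mass B \<le> total"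
  unfolding mass_def using finite_sum_le_has_sum[OF has_sum_F] by simp

lemma mass_nonneg: "mass B \<ge> 0"
  unfolding mass_def by (rule sum_nonneg) simp

lemma mass_disjoint:
  assumes "finite B" "B \<subseteq> E" "finite C" "C \<subseteq> E" "B \<inter> C = {}"
  shows "mass B \<le> total - mass C"
proof -
  have "mass B + mass C = mass (B \<union> C)" unfolding mass_def using assms by (simp add: sum.union_disjoint)
  also have "\<dots> \<le> total" using assms by (intro mass_le) auto
  finally show ?thesis by simp
qed

lemma mass_mono: "finite B \<Longrightarrow> C \<subseteq> B \<Longrightarrow> mass C \<le> mass B"
  unfolding mass_def by (rule sum_mono2) auto

lemma mass_approx: "e > 0 \<Longrightarrow> \<exists>C. finite C \<and> C \<subseteq> E \<and> total - e \<le> mass C"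
  using has_sum_finite_approximation[OF has_sum_F, of e] unfolding mass_def dist_real_def by fastforce

text \<open>The rate \<open>(1/4) ^ k\<close> leaves room for the weight \<open>2 ^ k\<close> of
  \<open>incr\<close> and still a summable remainder.\<close>

definition core :: "nat \<Rightarrow> 'v set set" where
  "core k = (SOME C. finite C \<and> C \<subseteq> E \<and> total - (1/4) ^ k \<le> mass C)"

text \<open>The chosen sets need not be nested; their unions are.\<close>

definition stage :: "nat \<Rightarrow> 'v set set" where "stage k = (\<Union>i\<le>k. core i)"

lemma core: "finite (core k)" "core k \<subseteq> E" "total - (1/4) ^ k \<le> mass (core k)"
  using someI_ex[OF mass_approx[of "(1/4) ^ k"]] by (simp_all add: core_def)

lemma stage: "finite (stage k)" "stage k \<subseteq> E" "stage k \<subseteq> stage (Suc k)"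
  using core(1,2) by (fastforce simp: stage_def)+

lemma mass_stage: "total - (1/4) ^ k \<le> mass (stage k)"
  using core(3)[of k] mass_mono[OF stage(1), of "core k" k] by (fastforce simp: stage_def)

lemma mass_tail: "finite B \<Longrightarrow> B \<subseteq> E \<Longrightarrow> B \<inter> stage k = {} \<Longrightarrow> mass B \<le> (1/4) ^ k"
  using mass_disjoint[of B "stage k"] stage(1,2)[of k] mass_stage[of k] by simp

section \<open>Almost everywhere convergence along the truncations\<close>

lemma Pfin_measurable: "(\<lambda>lam. Pfin lam B F x) \<in> borel_measurable mu"
proof -
  have [measurable]: "pol n \<in> borel_measurable borel" for n
    by (rule borel_measurable_continuous_onI[OF pol_cont])
  show ?thesis unfolding Pfin_def by (rule borel_measurable_mu) measurable
qed

lemma qform_measurable: "(\<lambda>lam. qform lam B F) \<in> borel_measurable mu"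
  by (rule borel_measurable_mu) (rule borel_measurable_continuous_onI[OF qform_cont])

lemma Pker_sum:
  assumes "lam \<in> {3 - 2 * sqrt 2 <..< 3 + 2 * sqrt 2}"
  shows "(\<Sum>y\<in>B. Pker E lam x y * F y) = Pfin lam B F x"
  unfolding Pfin_def Pker_def psi_eq_pol[OF assms] ..

text \<open>Evaluation at \<open>x\<close> is bounded from l2 to L2(mu), which is the source of the
  unconditional convergence demanded by \<open>is_Plam\<close>.\<close>

lemma nn_integral_Pfin:
  assumes B: "finite B" "B \<subseteq> E" and x: "x \<in> E"
  shows "(\<integral>\<^sup>+ lam. ennreal ((cmod (Pfin lam B F x))\<^sup>2) \<partial>mu) \<le> ennreal (2/9 * mass B)"
proof -
  have "(\<integral>\<^sup>+ lam. ennreal ((cmod (Pfin lam B F x))\<^sup>2) \<partial>mu) \<le> (\<integral>\<^sup>+ lam. ennreal (2/9 * qform lam B F) \<partial>mu)"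
  proof (rule nn_integral_mono_AE)
    show "AE lam in mu. ennreal ((cmod (Pfin lam B F x))\<^sup>2) \<le> ennreal (2/9 * qform lam B F)"
      using AE_mu_interior
    proof eventually_elim
      case (elim lam)
      show ?case using Pfin_bound[OF wave_base_props(1)[OF elim] B x, of F]
        unfolding wave_base_props(2)[OF elim] by (rule ennreal_leI)
    qed
  qed
  also have "\<dots> = ennreal (LINT lam|mu. 2/9 * qform lam B F)"
    by (rule nn_integral_eq_integral) (use qform_integrable AE_qform_nonneg[OF B, of F] in auto)
  also have "\<dots> \<le> ennreal (2/9 * mass B)"
    using qform_integral_bounds(2)[OF B, of F] by (intro ennreal_leI) (simp add: mass_def)
  finally show ?thesis .
qed

text \<open>Weighted increments of the form: their integrals are at most
  \<open>2 ^ k * (1/4) ^ k\<close>, hence summable, while the weight pays for the square roots in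
  \<open>good_summable\<close>.\<close>

definition incr :: "nat \<Rightarrow> real \<Rightarrow> real" where
  "incr k lam = 2 ^ k * qform lam (stage (Suc k) - stage k) F"

lemma stage_diff: "finite (stage (Suc k) - stage k)" "stage (Suc k) - stage k \<subseteq> E"
  using stage by auto

lemma incr_integrable: "integrable mu (incr k)"
  unfolding incr_def[abs_def] by (intro integrable_mult_right qform_integrable)

lemma AE_incr_nonneg: "AE lam in mu. incr k lam \<ge> 0"
  using AE_qform_nonneg[OF stage_diff[of k], of F] by eventually_elim (simp add: incr_def)

lemma incr_integral: "(LINT lam|mu. norm (incr k lam)) \<le> (1/2) ^ k"
proof -
  have "(LINT lam|mu. norm (incr k lam)) = (LINT lam|mu. incr k lam)"
  proof (rule integral_cong_AE)
    show "AE lam in mu. norm (incr k lam) = incr k lam"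
      using AE_incr_nonneg[of k] by eventually_elim simp
  qed (use incr_integrable[of k] in auto)
  also have "\<dots> = 2 ^ k * (LINT lam|mu. qform lam (stage (Suc k) - stage k) F)"
    unfolding incr_def[abs_def] using qform_integrable by simp
  also have "\<dots> \<le> 2 ^ k * mass (stage (Suc k) - stage k)"
    using qform_integral_bounds(2)[OF stage_diff[of k], of F] by (simp add: mass_def)
  also have "\<dots> \<le> 2 ^ k * (1/4) ^ k"
    using mass_tail[OF stage_diff[of k], of k] by auto
  also have "\<dots> = (1/2) ^ k" by (simp flip: power_mult_distrib)
  finally show ?thesis .
qed

text \<open>Monotone convergence: the integral of the series is at most a geometric sum, so the
  series is finite almost everywhere.\<close>

lemma AE_incr_summable: "AE lam in mu. summable (\<lambda>k. norm (incr k lam))"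
proof -
  have [measurable]: "incr k \<in> borel_measurable mu" for k using incr_integrable[of k] by auto
  have "(\<integral>\<^sup>+ lam. (\<Sum>k. ennreal (norm (incr k lam))) \<partial>mu) = (\<Sum>k. \<integral>\<^sup>+ lam. ennreal (norm (incr k lam)) \<partial>mu)"
    by (rule nn_integral_suminf) measurable
  also have "\<dots> \<le> (\<Sum>k. ennreal ((1/2) ^ k))"
  proof (intro suminf_le summableI)
    fix k
    have "(\<integral>\<^sup>+ lam. ennreal (norm (incr k lam)) \<partial>mu) = ennreal (LINT lam|mu. norm (incr k lam))"
      by (rule nn_integral_eq_integral) (use incr_integrable[of k] in auto)
    also have "\<dots> \<le> ennreal ((1/2) ^ k)" by (rule ennreal_leI[OF incr_integral])
    finally show "(\<integral>\<^sup>+ lam. ennreal (norm (incr k lam)) \<partial>mu) \<le> ennreal ((1/2) ^ k)" .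
  qed
  also have "\<dots> = ennreal (\<Sum>k. (1/2) ^ k)"
    by (rule suminf_ennreal2) (auto intro: summable_geometric)
  finally have "(\<integral>\<^sup>+ lam. (\<Sum>k. ennreal (norm (incr k lam))) \<partial>mu) \<noteq> \<infinity>"
    by (auto simp: top_unique)
  hence "AE lam in mu. (\<Sum>k. ennreal (norm (incr k lam))) \<noteq> \<infinity>"
    by (intro nn_integral_PInf_AE) measurable
  thus ?thesis
    by eventually_elim (rule summable_suminf_not_top, auto)
qed

definition good :: "real \<Rightarrow> bool" where
  "good lam \<longleftrightarrow> lam \<in> {3 - 2 * sqrt 2 <..< 3 + 2 * sqrt 2} \<and> summable (\<lambda>k. norm (incr k lam))"

lemma AE_good: "AE lam in mu. good lam"
  using AE_mu_interior AE_incr_summable by eventually_elim (simp add: good_def)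

lemma good_qform_nonneg: "good lam \<Longrightarrow> finite B \<Longrightarrow> B \<subseteq> E \<Longrightarrow> qform lam B F \<ge> 0"
  unfolding good_def by (metis qform_nonneg wave_base_props(1,2))

text \<open>The form is the product of \<open>(1/2) ^ k\<close> and \<open>incr k lam\<close>, and
  the geometric mean of two summable sequences is dominated by their arithmetic mean.\<close>

lemma good_summable:
  assumes "good lam" shows "summable (\<lambda>k. sqrt (qform lam (stage (Suc k) - stage k) F))"
proof (rule summable_comparison_test)
  have g: "summable (\<lambda>k. (1/2 :: real) ^ k)" by (rule summable_geometric) simp
  show "summable (\<lambda>k. ((1/2) ^ k + norm (incr k lam)) / 2)"
    using assms g unfolding good_def by (intro summable_divide summable_add) auto
  have "norm (sqrt (qform lam (stage (Suc k) - stage k) F)) \<le> ((1/2) ^ k + norm (incr k lam)) / 2" for k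
  proof -
    have nn: "qform lam (stage (Suc k) - stage k) F \<ge> 0" by (rule good_qform_nonneg[OF assms stage_diff])
    have e: "(1/2) ^ k * incr k lam = qform lam (stage (Suc k) - stage k) F"
      by (simp add: incr_def power_one_over)
    have "sqrt ((1/2) ^ k * incr k lam) \<le> ((1/2) ^ k + incr k lam) / 2"
      by (rule arith_geo_mean_sqrt) (use nn in \<open>auto simp: incr_def\<close>)
    moreover have "norm (incr k lam) = incr k lam" using nn by (simp add: incr_def)
    moreover have "norm (sqrt (qform lam (stage (Suc k) - stage k) F)) = sqrt (qform lam (stage (Suc k) - stage k) F)"
      using nn by simp
    ultimately show ?thesis unfolding e by (simp only:)
  qed
  thus "\<exists>N. \<forall>k\<ge>N. norm (sqrt (qform lam (stage (Suc k) - stage k) F)) \<le> ((1/2) ^ k + norm (incr k lam)) / 2"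
    by blast
qed

text \<open>A limit along one fixed exhaustion, which exists on \<open>E\<close> at every
  \<open>good\<close> parameter; the remaining parameters form a null set.\<close>

definition Plam :: "real \<Rightarrow> 'v set \<Rightarrow> complex" where
  "Plam lam x = lim (\<lambda>k. Pfin lam (stage k) F x)"

lemma Pfin_diff: "finite B \<Longrightarrow> C \<subseteq> B \<Longrightarrow> Pfin lam (B - C) F x = Pfin lam B F x - Pfin lam C F x"
  unfolding Pfin_def by (rule sum_diff)

lemma good_limit:
  assumes good: "good lam" and x: "x \<in> E"
  shows "(\<lambda>k. Pfin lam (stage k) F x) \<longlonglongrightarrow> Plam lam x"
proof -
  define d where "d k = Pfin lam (stage (Suc k)) F x - Pfin lam (stage k) F x" for k
  have "norm (d k) \<le> sqrt (qform lam (stage (Suc k) - stage k) F)" for k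
  proof -
    have int: "lam \<in> {3 - 2 * sqrt 2 <..< 3 + 2 * sqrt 2}" using good by (simp add: good_def)
    have "d k = Pfin lam (stage (Suc k) - stage k) F x" unfolding d_def using stage by (intro Pfin_diff[symmetric])
    hence "(norm (d k))\<^sup>2 \<le> 2/9 * qform lam (stage (Suc k) - stage k) F"
      using Pfin_bound[OF wave_base_props(1)[OF int] stage_diff x, of k F] unfolding wave_base_props(2)[OF int]
      by simp
    also have "\<dots> \<le> qform lam (stage (Suc k) - stage k) F" using good_qform_nonneg[OF good stage_diff, of k] by simp
    finally show ?thesis by (rule real_le_rsqrt)
  qed
  hence "summable d" by (intro summable_comparison_test[OF _ good_summable[OF good]]) blast
  hence "(\<lambda>n. \<Sum>k<n. d k) \<longlonglongrightarrow> suminf d" by (rule summable_LIMSEQ)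
  moreover have "(\<Sum>k<n. d k) = Pfin lam (stage n) F x - Pfin lam (stage 0) F x" for n
    unfolding d_def by (rule sum_lessThan_telescope)
  ultimately have "(\<lambda>n. Pfin lam (stage n) F x - Pfin lam (stage 0) F x + Pfin lam (stage 0) F x)
      \<longlonglongrightarrow> suminf d + Pfin lam (stage 0) F x"
    by (intro tendsto_add tendsto_const) simp
  hence "convergent (\<lambda>k. Pfin lam (stage k) F x)" by (auto simp: convergent_def)
  thus ?thesis unfolding Plam_def by (simp add: convergent_LIMSEQ_iff)
qed

lemma Plam_measurable: "(\<lambda>lam. Plam lam x) \<in> borel_measurable mu"
  unfolding Plam_def by (rule borel_measurable_lim_metric[OF Pfin_measurable])

text \<open>Fatou's lemma along the truncations. As \<open>B\<close> need not be comparable with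
  \<open>stage k\<close>, both differences occur: one has mass at most
  \<open>total - mass B\<close>, the other lies outside \<open>stage k\<close> and vanishes in the
  limit. The constant is 2 times 2/9, from squaring a difference and from
  \<open>nn_integral_Pfin\<close>.\<close>

lemma Plam_Pfin_dist:
  assumes B: "finite B" "B \<subseteq> E" and x: "x \<in> E"
  shows "(\<integral>\<^sup>+ lam. ennreal ((cmod (Plam lam x - Pfin lam B F x))\<^sup>2) \<partial>mu) \<le> ennreal (4/9 * (total - mass B))"
proof -
  define u where "u k lam = ennreal ((cmod (Pfin lam (stage k) F x - Pfin lam B F x))\<^sup>2)" for k lam
  have m: "u k \<in> borel_measurable mu" for k
    unfolding u_def[abs_def] using Pfin_measurable by measurable
  have "(\<integral>\<^sup>+ lam. ennreal ((cmod (Plam lam x - Pfin lam B F x))\<^sup>2) \<partial>mu) = (\<integral>\<^sup>+ lam. liminf (\<lambda>k. u k lam) \<partial>mu)"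
  proof (rule nn_integral_cong_AE)
    show "AE lam in mu. ennreal ((cmod (Plam lam x - Pfin lam B F x))\<^sup>2) = liminf (\<lambda>k. u k lam)"
      using AE_good
    proof eventually_elim
      case (elim lam)
      have "(\<lambda>k. u k lam) \<longlonglongrightarrow> ennreal ((cmod (Plam lam x - Pfin lam B F x))\<^sup>2)"
        unfolding u_def by (intro tendsto_ennrealI tendsto_intros good_limit[OF elim x])
      thus ?case by (simp add: lim_imp_Liminf)
    qed
  qed
  also have "\<dots> \<le> liminf (\<lambda>k. \<integral>\<^sup>+ lam. u k lam \<partial>mu)"
    by (rule nn_integral_liminf[OF m])
  also have "\<dots> \<le> liminf (\<lambda>k. ennreal (4/9 * (total - mass B) + 4/9 * (1/4) ^ k))"
  proof (rule Liminf_mono, rule always_eventually, rule allI)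
    fix k
    have f: "finite (stage k - B)" "stage k - B \<subseteq> E" "finite (B - stage k)" "B - stage k \<subseteq> E" using stage B by auto
    have d: "Pfin lam (stage k) F x - Pfin lam B F x = Pfin lam (stage k - B) F x - Pfin lam (B - stage k) F x" for lam
    proof -
      have "Pfin lam (stage k - B) F x = Pfin lam (stage k) F x - Pfin lam (stage k \<inter> B) F x"
        using Pfin_diff[of "stage k" "stage k \<inter> B" lam x] stage by (simp add: Diff_Int)
      moreover have "Pfin lam (B - stage k) F x = Pfin lam B F x - Pfin lam (stage k \<inter> B) F x"
        using Pfin_diff[of B "stage k \<inter> B" lam x] B by (simp add: Diff_Int)
      ultimately show ?thesis by simp
    qed
    have "(\<integral>\<^sup>+ lam. u k lam \<partial>mu) \<le> (\<integral>\<^sup>+ lam. 2 * ennreal ((cmod (Pfin lam (stage k - B) F x))\<^sup>2)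
        + 2 * ennreal ((cmod (Pfin lam (B - stage k) F x))\<^sup>2) \<partial>mu)"
    proof (rule nn_integral_mono)
      fix lam
      have "u k lam \<le> ennreal (2 * (cmod (Pfin lam (stage k - B) F x))\<^sup>2 + 2 * (cmod (Pfin lam (B - stage k) F x))\<^sup>2)"
        unfolding u_def d by (rule ennreal_leI[OF norm_diff_sq_le])
      thus "u k lam \<le> 2 * ennreal ((cmod (Pfin lam (stage k - B) F x))\<^sup>2)
          + 2 * ennreal ((cmod (Pfin lam (B - stage k) F x))\<^sup>2)"
        by (simp add: ennreal_plus ennreal_mult)
    qed
    also have "\<dots> = 2 * (\<integral>\<^sup>+ lam. ennreal ((cmod (Pfin lam (stage k - B) F x))\<^sup>2) \<partial>mu)
        + 2 * (\<integral>\<^sup>+ lam. ennreal ((cmod (Pfin lam (B - stage k) F x))\<^sup>2) \<partial>mu)"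
      using Pfin_measurable by (subst nn_integral_add) (auto simp: nn_integral_cmult)
    also have "\<dots> \<le> 2 * ennreal (2/9 * mass (stage k - B)) + 2 * ennreal (2/9 * mass (B - stage k))"
      by (intro add_mono mult_left_mono nn_integral_Pfin f x) auto
    also have "\<dots> = ennreal (4/9 * mass (stage k - B) + 4/9 * mass (B - stage k))"
    proof -
      have "2 * ennreal (2/9 * w) = ennreal (4/9 * w)" if "w \<ge> 0" for w
        using that ennreal_mult[of 2 "2/9 * w"] by simp
      thus ?thesis using mass_nonneg by (simp add: ennreal_plus)
    qed
    also have "\<dots> \<le> ennreal (4/9 * (total - mass B) + 4/9 * (1/4) ^ k)"
    proof (rule ennreal_leI)
      have "mass (stage k - B) \<le> total - mass B" by (rule mass_disjoint) (use f B in auto)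
      moreover have "mass (B - stage k) \<le> (1/4) ^ k" by (rule mass_tail) (use f in auto)
      ultimately show "4/9 * mass (stage k - B) + 4/9 * mass (B - stage k) \<le> 4/9 * (total - mass B) + 4/9 * (1/4) ^ k"
        by (intro add_mono mult_left_mono) auto
    qed
    finally show "(\<integral>\<^sup>+ lam. u k lam \<partial>mu) \<le> ennreal (4/9 * (total - mass B) + 4/9 * (1/4) ^ k)" .
  qed
  also have "\<dots> = ennreal (4/9 * (total - mass B))"
  proof (rule lim_imp_Liminf)
    have "(\<lambda>k. 4/9 * (total - mass B) + 4/9 * (1/4) ^ k) \<longlonglongrightarrow> 4/9 * (total - mass B) + 4/9 * 0"
      by (intro tendsto_intros LIMSEQ_power_zero) auto
    thus "(\<lambda>k. ennreal (4/9 * (total - mass B) + 4/9 * (1/4) ^ k)) \<longlonglongrightarrow> ennreal (4/9 * (total - mass B))"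
      by (intro tendsto_ennrealI) simp
  qed simp
  finally show ?thesis .
qed

lemma Pker_dist_eq:
  "(\<integral>\<^sup>+ lam. ennreal ((cmod (G lam x - (\<Sum>y\<in>B. Pker E lam x y * F y)))\<^sup>2) \<partial>mu)
    = (\<integral>\<^sup>+ lam. ennreal ((cmod (G lam x - Pfin lam B F x))\<^sup>2) \<partial>mu)"
proof (rule nn_integral_cong_AE)
  show "AE lam in mu. ennreal ((cmod (G lam x - (\<Sum>y\<in>B. Pker E lam x y * F y)))\<^sup>2)
      = ennreal ((cmod (G lam x - Pfin lam B F x))\<^sup>2)"
    using AE_mu_interior by eventually_elim (simp add: Pker_sum)
qed

lemma mass_tendsto: "(mass \<longlongrightarrow> total) (finite_subsets_at_top E)"
  using has_sum_F unfolding has_sum_def mass_def[abs_def] .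

lemma Plam_tendsto:
  assumes x: "x \<in> E"
  shows "((\<lambda>B. \<integral>\<^sup>+ lam. ennreal ((cmod (Plam lam x - Pfin lam B F x))\<^sup>2) \<partial>mu) \<longlongrightarrow> 0) (finite_subsets_at_top E)"
proof (rule tendsto_sandwich[OF _ _ tendsto_const])
  have "((\<lambda>B. 4/9 * (total - mass B)) \<longlongrightarrow> 4/9 * (total - total)) (finite_subsets_at_top E)"
    by (intro tendsto_intros mass_tendsto)
  hence "((\<lambda>B. ennreal (4/9 * (total - mass B))) \<longlongrightarrow> ennreal 0) (finite_subsets_at_top E)"
    by (intro tendsto_ennrealI) simp
  thus "((\<lambda>B. ennreal (4/9 * (total - mass B))) \<longlongrightarrow> 0) (finite_subsets_at_top E)" by simp
  show "\<forall>\<^sub>F B in finite_subsets_at_top E.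
      (\<integral>\<^sup>+ lam. ennreal ((cmod (Plam lam x - Pfin lam B F x))\<^sup>2) \<partial>mu) \<le> ennreal (4/9 * (total - mass B))"
    by (rule eventually_finite_subsets_at_top_weakI) (rule Plam_Pfin_dist[OF _ _ x])
qed simp

lemma is_Plam_Plam: "is_Plam E F Plam"
  unfolding is_Plam_def Pker_dist_eq using Plam_measurable Plam_tendsto by blast

text \<open>For each \<open>x\<close> the limit in L2(mu) is unique up to a null set, and
  countability of \<open>E\<close> merges these null sets into one.\<close>

lemma is_Plam_unique:
  assumes G: "is_Plam E F G" shows "AE lam in mu. \<forall>x\<in>E. G lam x = Plam lam x"
proof (rule AE_ball_countable'[OF _ countable_E])
  fix x assume x: "x \<in> E"
  have m: "(\<lambda>lam. G lam x) \<in> borel_measurable mu"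
    and lim: "((\<lambda>B. \<integral>\<^sup>+ lam. ennreal ((cmod (G lam x - Pfin lam B F x))\<^sup>2) \<partial>mu) \<longlongrightarrow> 0) (finite_subsets_at_top E)"
    using G x unfolding is_Plam_def Pker_dist_eq by auto
  note meas = m Plam_measurable[of x] Pfin_measurable[of _ x]
  let ?I = "\<integral>\<^sup>+ lam. ennreal ((cmod (G lam x - Plam lam x))\<^sup>2) \<partial>mu"
  have le: "?I \<le> 2 * (\<integral>\<^sup>+ lam. ennreal ((cmod (G lam x - Pfin lam B F x))\<^sup>2) \<partial>mu)
      + 2 * (\<integral>\<^sup>+ lam. ennreal ((cmod (Plam lam x - Pfin lam B F x))\<^sup>2) \<partial>mu)" for B
  proof -
    have "?I \<le> (\<integral>\<^sup>+ lam. 2 * ennreal ((cmod (G lam x - Pfin lam B F x))\<^sup>2)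
        + 2 * ennreal ((cmod (Plam lam x - Pfin lam B F x))\<^sup>2) \<partial>mu)"
    proof (rule nn_integral_mono)
      fix lam
      have "(cmod (G lam x - Plam lam x))\<^sup>2
          \<le> 2 * (cmod (G lam x - Pfin lam B F x))\<^sup>2 + 2 * (cmod (Plam lam x - Pfin lam B F x))\<^sup>2"
        using norm_diff_sq_le[of "G lam x - Pfin lam B F x" "Plam lam x - Pfin lam B F x"] by simp
      from ennreal_leI[OF this]
      show "ennreal ((cmod (G lam x - Plam lam x))\<^sup>2) \<le> 2 * ennreal ((cmod (G lam x - Pfin lam B F x))\<^sup>2)
          + 2 * ennreal ((cmod (Plam lam x - Pfin lam B F x))\<^sup>2)"
        by (simp add: ennreal_plus ennreal_mult)
    qed
    also have "\<dots> = 2 * (\<integral>\<^sup>+ lam. ennreal ((cmod (G lam x - Pfin lam B F x))\<^sup>2) \<partial>mu)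
        + 2 * (\<integral>\<^sup>+ lam. ennreal ((cmod (Plam lam x - Pfin lam B F x))\<^sup>2) \<partial>mu)"
      using meas by (subst nn_integral_add) (auto simp: nn_integral_cmult)
    finally show ?thesis .
  qed
  have "((\<lambda>B. 2 * (\<integral>\<^sup>+ lam. ennreal ((cmod (G lam x - Pfin lam B F x))\<^sup>2) \<partial>mu)
      + 2 * (\<integral>\<^sup>+ lam. ennreal ((cmod (Plam lam x - Pfin lam B F x))\<^sup>2) \<partial>mu)) \<longlongrightarrow> 2 * 0 + 2 * 0)
      (finite_subsets_at_top E)"
    by (intro tendsto_add ennreal_tendsto_cmult lim Plam_tendsto[OF x]) auto
  hence "?I \<le> 2 * 0 + 2 * 0"
    by (rule tendsto_lowerbound) (auto intro: always_eventually le)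
  hence "?I = 0" by simp
  hence "AE lam in mu. ennreal ((cmod (G lam x - Plam lam x))\<^sup>2) = 0"
    using meas by (subst (asm) nn_integral_0_iff_AE) auto
  thus "AE lam in mu. G lam x = Plam lam x" by eventually_elim simp
qed

section \<open>The mean inner product and its integral\<close>

definition qlim :: "real \<Rightarrow> real" where "qlim lam = lim (\<lambda>k. qform lam (stage k) F)"

lemma good_mean:
  assumes good: "good lam" and G: "\<And>x. x \<in> E \<Longrightarrow> G x = Plam lam x"
  shows "(\<lambda>k. qform lam (stage k) F) \<longlonglongrightarrow> qlim lam" "has_mean_inner E G G (of_real (bfun lam / 36 * qlim lam))"
proof -
  have int: "lam \<in> {3 - 2 * sqrt 2 <..< 3 + 2 * sqrt 2}" using good by (simp add: good_def)
  obtain l where l: "(\<lambda>k. qform lam (stage k) F) \<longlonglongrightarrow> l"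
    "has_mean_inner E G G (of_real ((1 + 16 * (Im (wave_base lam))\<^sup>2) / (72 * (Im (wave_base lam))\<^sup>2) * l))"
    using mean_inner_limit[OF wave_base_props(1)[OF int] stage wave_base_props(2)[OF int, symmetric] good_summable[OF good], of G]
      good_limit[OF good] G by auto
  have "l = qlim lam" unfolding qlim_def by (rule limI[OF l(1), symmetric])
  thus "(\<lambda>k. qform lam (stage k) F) \<longlonglongrightarrow> qlim lam" "has_mean_inner E G G (of_real (bfun lam / 36 * qlim lam))"
    using l unfolding bfun_eq_wave_base(1)[OF int] by auto
qed

text \<open>The majorant for dominated convergence. Each square root is
  \<open>sqrt ((1/2) ^ j) * sqrt (incr j lam)\<close>, so Cauchy-Schwarz bounds the square of their
  sum by the geometric series, which is 2, times the sum of the increments.\<close>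

lemma good_qform_bound:
  assumes good: "good lam"
  shows "qform lam (stage k) F \<le> 2 * qform lam (stage 0) F + 4 * (\<Sum>j. norm (incr j lam))"
proof -
  have int: "lam \<in> {3 - 2 * sqrt 2 <..< 3 + 2 * sqrt 2}" and summ: "summable (\<lambda>k. norm (incr k lam))"
    using good by (auto simp: good_def)
  define d where "d j = sqrt (qform lam (stage (Suc j) - stage j) F)" for j
  have "sqrt (qform lam (stage k) F) \<le> sqrt (qform lam (stage 0) F) + (\<Sum>j<k. d j)"
  proof (induction k)
    case (Suc k)
    have e: "stage (Suc k) = stage k \<union> (stage (Suc k) - stage k)" using stage(3)[of k] by auto
    have "sqrt (qform lam (stage (Suc k)) F) \<le> sqrt (qform lam (stage k) F) + d k"
      using sqrt_qform_union[OF wave_base_props(1)[OF int] stage(1,2)[of k] stage_diff[of k], of F] e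
      unfolding wave_base_props(2)[OF int] d_def by auto
    thus ?case using Suc by simp
  qed simp
  hence "(sqrt (qform lam (stage k) F))\<^sup>2 \<le> (sqrt (qform lam (stage 0) F) + (\<Sum>j<k. d j))\<^sup>2"
    using good_qform_nonneg[OF good stage(1,2)] by (intro power_mono) auto
  also have "\<dots> \<le> 2 * (sqrt (qform lam (stage 0) F))\<^sup>2 + 2 * (\<Sum>j<k. d j)\<^sup>2"
    using sum_squares_bound[of "sqrt (qform lam (stage 0) F)" "\<Sum>j<k. d j"] by (simp add: power2_sum)
  also have "(\<Sum>j<k. d j)\<^sup>2 \<le> 2 * (\<Sum>j. norm (incr j lam))"
  proof -
    have nn: "incr j lam \<ge> 0" for j
      using good_qform_nonneg[OF good stage_diff[of j]] by (simp add: incr_def)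
    have dj: "d j = sqrt ((1/2) ^ j) * sqrt (incr j lam)" for j
      unfolding d_def by (simp add: incr_def power_one_over flip: real_sqrt_mult)
    have "(\<Sum>j<k. d j)\<^sup>2 \<le> (\<Sum>j<k. (sqrt ((1/2) ^ j))\<^sup>2) * (\<Sum>j<k. (sqrt (incr j lam))\<^sup>2)"
      unfolding dj by (rule Cauchy_Schwarz_ineq_sum)
    also have "\<dots> = (\<Sum>j<k. (1/2) ^ j) * (\<Sum>j<k. norm (incr j lam))"
      using nn by (simp add: abs_of_nonneg)
    also have "\<dots> \<le> 2 * (\<Sum>j. norm (incr j lam))"
    proof (rule mult_mono)
      have "(\<Sum>j<k. (1/2 :: real) ^ j) \<le> (\<Sum>j. (1/2) ^ j)"
        by (rule sum_le_suminf) (auto intro: summable_geometric)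
      also have "(\<Sum>j. (1/2 :: real) ^ j) = 2" using suminf_geometric[of "1/2 :: real"] by simp
      finally show "(\<Sum>j<k. (1/2 :: real) ^ j) \<le> 2" .
      show "(\<Sum>j<k. norm (incr j lam)) \<le> (\<Sum>j. norm (incr j lam))"
        by (rule sum_le_suminf[OF summ]) auto
    qed (auto intro: sum_nonneg)
    finally show ?thesis .
  qed
  finally show ?thesis using good_qform_nonneg[OF good stage(1,2)] by simp
qed

lemma qlim_measurable: "qlim \<in> borel_measurable mu"
  unfolding qlim_def[abs_def] by (rule borel_measurable_lim_metric[OF qform_measurable])

lemma qlim_integral: "integrable mu qlim" "(\<lambda>k. LINT lam|mu. qform lam (stage k) F) \<longlonglongrightarrow> integral\<^sup>L mu qlim"
proof -
  define w where "w lam = 2 * qform lam (stage 0) F + 4 * (\<Sum>j. norm (incr j lam))" for lam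
  have "summable (\<lambda>k. LINT lam|mu. norm (norm (incr k lam)))"
    by (rule summable_comparison_test[of _ "\<lambda>k. (1/2) ^ k"])
       (use incr_integral in \<open>auto intro!: summable_geometric simp: abs_of_nonneg integral_nonneg_AE\<close>)
  hence "integrable mu (\<lambda>lam. \<Sum>j. norm (incr j lam))"
    using AE_incr_summable incr_integrable by (intro integrable_suminf) auto
  hence w: "integrable mu w"
    unfolding w_def[abs_def]
    by (intro Bochner_Integration.integrable_add integrable_mult_right qform_integrable)
  have lim: "AE lam in mu. (\<lambda>k. qform lam (stage k) F) \<longlonglongrightarrow> qlim lam"
    using AE_good by eventually_elim (rule good_mean(1), auto)
  have bound: "AE lam in mu. norm (qform lam (stage k) F) \<le> w lam" for k
    using AE_good
    by eventually_elim (use good_qform_bound good_qform_nonneg stage in \<open>simp add: w_def\<close>)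
  show "integrable mu qlim"
    by (rule integrable_dominated_convergence[OF qlim_measurable qform_measurable w lim bound])
  show "(\<lambda>k. LINT lam|mu. qform lam (stage k) F) \<longlonglongrightarrow> integral\<^sup>L mu qlim"
    by (rule integral_dominated_convergence[OF qlim_measurable qform_measurable w lim bound])
qed

text \<open>The approximations converge to \<open>P6\<close> pointwise, so the contraction bound is
  passed to the limit on finite sets of points, and the supremum over these sets is taken
  last.\<close>

lemma P6_approx:
  assumes C: "finite C" "C \<subseteq> E"
  shows "(\<lambda>x. (cmod (P6 E F x - P6fin C F x))\<^sup>2) summable_on E"
    "(\<Sum>\<^sub>\<infinity>x\<in>E. (cmod (P6 E F x - P6fin C F x))\<^sup>2) \<le> total - mass C"
proof -
  have bound: "(\<Sum>x\<in>X. (cmod (P6 E F x - P6fin C F x))\<^sup>2) \<le> total - mass C" if X: "finite X" "X \<subseteq> E" for X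
  proof (rule tendsto_upperbound)
    show "((\<lambda>B. \<Sum>x\<in>X. (cmod (P6fin B F x - P6fin C F x))\<^sup>2) \<longlongrightarrow>
        (\<Sum>x\<in>X. (cmod (P6 E F x - P6fin C F x))\<^sup>2)) (finite_subsets_at_top E)"
      using X by (intro tendsto_intros P6_eq_lim[OF F]) auto
    show "\<forall>\<^sub>F B in finite_subsets_at_top E. (\<Sum>x\<in>X. (cmod (P6fin B F x - P6fin C F x))\<^sup>2) \<le> total - mass C"
      unfolding eventually_finite_subsets_at_top
    proof (intro exI[of _ C] conjI C allI impI)
      fix B assume B: "finite B \<and> C \<subseteq> B \<and> B \<subseteq> E"
      hence f: "finite (B - C)" "B - C \<subseteq> E" by auto
      have "P6fin B F x - P6fin C F x = P6fin (B - C) F x" for x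
        unfolding P6fin_def using B by (simp add: sum_diff)
      hence "(\<Sum>x\<in>X. (cmod (P6fin B F x - P6fin C F x))\<^sup>2) = (\<Sum>x\<in>X. (cmod (P6fin (B - C) F x))\<^sup>2)" by simp
      also have "\<dots> \<le> (\<Sum>\<^sub>\<infinity>x\<in>E. (cmod (P6fin (B - C) F x))\<^sup>2)"
        by (rule finite_sum_le_infsum[OF P6fin_sq_summable[OF f] X]) simp
      also have "\<dots> \<le> mass (B - C)" unfolding mass_def by (rule qform_integral_bounds(3)[OF f])
      also have "\<dots> \<le> total - mass C" by (rule mass_disjoint) (use B C in auto)
      finally show "(\<Sum>x\<in>X. (cmod (P6fin B F x - P6fin C F x))\<^sup>2) \<le> total - mass C" .
    qed
  qed simp
  show s: "(\<lambda>x. (cmod (P6 E F x - P6fin C F x))\<^sup>2) summable_on E"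
    by (rule nonneg_bdd_above_summable_on) (use bound in \<open>auto intro!: bdd_aboveI2\<close>)
  show "(\<Sum>\<^sub>\<infinity>x\<in>E. (cmod (P6 E F x - P6fin C F x))\<^sup>2) \<le> total - mass C"
    by (rule infsum_le_finite_sums[OF s bound])
qed

lemma P6_in_l2: "in_l2 E (P6 E F)"
proof -
  have "(\<lambda>x. (cmod (P6 E F x - P6fin {} F x))\<^sup>2) summable_on E" by (rule P6_approx(1)) auto
  thus ?thesis by (simp add: in_l2_def P6fin_def)
qed

lemma P6_norm_limit: "(\<lambda>k. \<Sum>\<^sub>\<infinity>x\<in>E. (cmod (P6fin (stage k) F x))\<^sup>2) \<longlonglongrightarrow> l2_norm_sq E (P6 E F)"
proof -
  define N where "N k = (\<Sum>\<^sub>\<infinity>x\<in>E. (cmod (P6fin (stage k) F x))\<^sup>2)" for k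
  have close: "\<bar>l2_norm_sq E (P6 E F) - N k\<bar> \<le> (1/2) ^ k * total + (1/4) ^ k + (1/2) ^ k" for k
  proof -
    let ?a = "\<lambda>x. (cmod (P6 E F x))\<^sup>2" and ?b = "\<lambda>x. (cmod (P6fin (stage k) F x))\<^sup>2"
    let ?d = "\<lambda>x. (cmod (P6 E F x - P6fin (stage k) F x))\<^sup>2"
    \<comment> \<open>Balances the errors: both \<open>e * total\<close> and
      \<open>(1 / e) * (1/4) ^ k\<close> become of order \<open>(1/2) ^ k\<close>.\<close>
    define e :: real where "e = (1/2) ^ k"
    have e: "e > 0" "1 / e = 2 ^ k" by (simp_all add: e_def power_one_over)
    have sa: "?a summable_on E" using P6_in_l2 by (simp add: in_l2_def)
    have sb: "?b summable_on E" by (rule P6fin_sq_summable[OF stage(1,2)])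
    have sd: "?d summable_on E" by (rule P6_approx(1)[OF stage(1,2)])
    have R: "((\<lambda>x. e * ?b x + (1 + 1 / e) * ?d x) has_sum e * infsum ?b E + (1 + 1 / e) * infsum ?d E) E"
      by (intro has_sum_add has_sum_cmult_right has_sum_infsum sb sd)
    have "((\<lambda>x. ?a x) has_sum infsum ?a E) E" by (rule has_sum_infsum[OF sa])
    from has_sum_mono[OF this has_sum_add[OF has_sum_infsum[OF sb] R]]
    have 1: "infsum ?a E \<le> infsum ?b E + (e * infsum ?b E + (1 + 1 / e) * infsum ?d E)"
      using norm_sq_perturb[OF e(1)] by (smt (verit))
    from has_sum_mono[OF has_sum_infsum[OF sb] has_sum_add[OF has_sum_infsum[OF sa] R]]
    have 2: "infsum ?b E \<le> infsum ?a E + (e * infsum ?b E + (1 + 1 / e) * infsum ?d E)"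
      using norm_sq_perturb[OF e(1)] by (smt (verit))
    have "infsum ?b E \<le> total"
      using qform_integral_bounds(3)[OF stage(1,2), of k F] mass_le[OF stage(1,2), of k] by (simp add: mass_def)
    hence b: "e * infsum ?b E \<le> e * total" using e by simp
    have "infsum ?d E \<le> (1/4) ^ k" using P6_approx(2)[OF stage(1,2), of k] mass_stage[of k] by simp
    hence "(1 + 1 / e) * infsum ?d E \<le> (1 + 1 / e) * (1/4) ^ k" using e by (intro mult_left_mono) auto
    also have "\<dots> = (1/4) ^ k + (1/2) ^ k"
      unfolding e(2) by (simp add: distrib_right flip: power_mult_distrib)
    finally show ?thesis
      using 1 2 b unfolding l2_norm_sq_def N_def e_def by linarith
  qed
  have "(\<lambda>k. l2_norm_sq E (P6 E F) - N k) \<longlonglongrightarrow> 0"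
  proof (rule Lim_null_comparison)
    show "\<forall>\<^sub>F k in sequentially. norm (l2_norm_sq E (P6 E F) - N k) \<le> (1/2) ^ k * total + (1/4) ^ k + (1/2) ^ k"
      using close by simp
    have "(\<lambda>k. (1/2) ^ k * total + (1/4) ^ k + (1/2) ^ k) \<longlonglongrightarrow> 0 * total + 0 + 0"
      by (intro tendsto_intros LIMSEQ_power_zero) auto
    thus "(\<lambda>k. (1/2) ^ k * total + (1/4) ^ k + (1/2) ^ k) \<longlonglongrightarrow> 0" by simp
  qed
  from tendsto_diff[OF tendsto_const this, of "l2_norm_sq E (P6 E F)"]
  show ?thesis unfolding N_def by simp
qed

lemma plancherel: "total = l2_norm_sq E (P6 E F) + integral\<^sup>L mu qlim"
proof -
  have "mass (stage k) = (LINT lam|mu. qform lam (stage k) F) + (\<Sum>\<^sub>\<infinity>x\<in>E. (cmod (P6fin (stage k) F x))\<^sup>2)" for k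
    unfolding mass_def by (rule qform_integral[OF stage(1,2)])
  hence "(\<lambda>k. mass (stage k)) \<longlonglongrightarrow> integral\<^sup>L mu qlim + l2_norm_sq E (P6 E F)"
    using tendsto_add[OF qlim_integral(2) P6_norm_limit] by simp
  moreover have "(\<lambda>k. mass (stage k)) \<longlonglongrightarrow> total"
  proof (rule tendsto_sandwich)
    show "\<forall>\<^sub>F k in sequentially. total - (1/4) ^ k \<le> mass (stage k)" using mass_stage by simp
    show "\<forall>\<^sub>F k in sequentially. mass (stage k) \<le> total" using mass_le stage by simp
    have "(\<lambda>k. total - (1/4) ^ k) \<longlonglongrightarrow> total - 0" by (intro tendsto_intros LIMSEQ_power_zero) auto
    thus "(\<lambda>k. total - (1/4) ^ k) \<longlonglongrightarrow> total" by simp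
  qed simp
  ultimately show ?thesis using LIMSEQ_unique by fastforce
qed

text \<open>As \<open>mu\<close> is not complete, the value of \<open>mean_inner\<close> on the null set where the mean does not
  exist matters; it is the constant \<open>THE L. False\<close>.\<close>
lemma mean_inner_measurable:
  assumes G: "\<And>x. x \<in> E \<Longrightarrow> (\<lambda>lam. G lam x) \<in> borel_measurable mu"
  shows "(\<lambda>lam. mean_inner E (G lam) (G lam)) \<in> borel_measurable mu"
proof -
  obtain x1 where x1: "x1 \<in> E" using E_nonempty by auto
  define s where "s x0 N lam = 1 / of_nat N * (\<Sum>x | x \<in> E \<and> D x x0 \<le> N. G lam x * cnj (G lam x))" for x0 N lam
  have s[measurable]: "s x0 N \<in> borel_measurable mu" for x0 N
  proof -
    have "cnj \<in> borel_measurable borel"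
      by (rule borel_measurable_continuous_onI) (intro continuous_intros)
    hence "(\<lambda>lam. cnj (G lam x)) \<in> borel_measurable mu" if "x \<in> E" for x
      using measurable_compose[OF G[OF that]] by blast
    thus ?thesis unfolding s_def[abs_def] using G
      by (intro borel_measurable_times borel_measurable_sum borel_measurable_const) auto
  qed
  \<comment> \<open>Existence of the mean as countably many measurable conditions: at every base
    point the averages are Cauchy, with the same limit as at \<open>x1\<close>.\<close>
  define P where "P lam \<longleftrightarrow> (\<forall>x0\<in>E. Cauchy (\<lambda>N. s x0 N lam) \<and> lim (\<lambda>N. s x0 N lam) - lim (\<lambda>N. s x1 N lam) = 0)" for lam
  have P_iff: "has_mean_inner E (G lam) (G lam) L \<longleftrightarrow> P lam \<and> L = lim (\<lambda>N. s x1 N lam)" for lam L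
  proof -
    have h: "has_mean_inner E (G lam) (G lam) L \<longleftrightarrow> (\<forall>x0\<in>E. (\<lambda>N. s x0 N lam) \<longlonglongrightarrow> L)"
      unfolding has_mean_inner_def s_def ..
    have "(\<lambda>N. s x0 N lam) \<longlonglongrightarrow> L \<longleftrightarrow> Cauchy (\<lambda>N. s x0 N lam) \<and> lim (\<lambda>N. s x0 N lam) = L" for x0
      by (metis Cauchy_convergent_iff convergent_LIMSEQ_iff convergentI limI)
    thus ?thesis unfolding h P_def using x1 by auto
  qed
  have eq: "mean_inner E (G lam) (G lam) = (if P lam then lim (\<lambda>N. s x1 N lam) else (THE L. False))" for lam
    unfolding mean_inner_def P_iff by simp
  have "{lam \<in> space mu. Cauchy (\<lambda>N. s x0 N lam) \<and> lim (\<lambda>N. s x0 N lam) - lim (\<lambda>N. s x1 N lam) = 0} \<in> sets mu" for x0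
  proof (rule sets.sets_Collect_conj)
    show "{lam \<in> space mu. Cauchy (\<lambda>N. s x0 N lam)} \<in> sets mu" by (rule sets_Collect_Cauchy[OF s])
    have [measurable]: "(\<lambda>lam. lim (\<lambda>N. s x0 N lam) - lim (\<lambda>N. s x1 N lam)) \<in> borel_measurable mu"
      by (intro borel_measurable_diff borel_measurable_lim_metric s)
    show "{lam \<in> space mu. lim (\<lambda>N. s x0 N lam) - lim (\<lambda>N. s x1 N lam) = 0} \<in> sets mu"
      by measurable
  qed
  hence "(\<Inter>x0\<in>E. {lam \<in> space mu. Cauchy (\<lambda>N. s x0 N lam) \<and> lim (\<lambda>N. s x0 N lam) - lim (\<lambda>N. s x1 N lam) = 0}) \<in> sets mu"
    by (intro sets.countable_INT'[OF countable_E E_nonempty]) blast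
  also have "(\<Inter>x0\<in>E. {lam \<in> space mu. Cauchy (\<lambda>N. s x0 N lam) \<and> lim (\<lambda>N. s x0 N lam) - lim (\<lambda>N. s x1 N lam) = 0})
      = {lam \<in> space mu. P lam}"
    using x1 by (auto simp: P_def)
  finally have "{lam \<in> space mu. P lam} \<in> sets mu" .
  thus ?thesis unfolding eq
    by (intro measurable_If borel_measurable_lim_metric s borel_measurable_const)
qed

lemma Plam_conclusion:
  assumes G: "is_Plam E F G"
  shows "AE lam in mu. \<exists>L. has_mean_inner E (G lam) (G lam) L" (is ?AE)
    and "set_integrable mu Sig (\<lambda>lam. mean_inner E (G lam) (G lam) * of_real (36 * inverse (bfun lam)))" (is ?int)
    and "(LINT lam:Sig|mu. mean_inner E (G lam) (G lam) * of_real (36 * inverse (bfun lam)))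
      = of_real (integral\<^sup>L mu qlim)" (is ?eq)
proof -
  have AE: "AE lam in mu. good lam \<and> has_mean_inner E (G lam) (G lam) (of_real (bfun lam / 36 * qlim lam))"
    using AE_good is_Plam_unique[OF G] by eventually_elim (use good_mean(2) in blast)
  thus ?AE by eventually_elim blast
  define h where "h lam = indicator Sig lam *\<^sub>R (mean_inner E (G lam) (G lam) * complex_of_real (36 * inverse (bfun lam)))" for lam
  have m[measurable]: "(\<lambda>lam. mean_inner E (G lam) (G lam)) \<in> borel_measurable mu"
    by (rule mean_inner_measurable) (use G in \<open>auto simp: is_Plam_def\<close>)
  \<comment> \<open>On the spectrum \<open>bfun\<close> is replaced by its rational form, whose
    measurability is evident; elsewhere the indicator is 0.\<close>
  have "h lam = indicator Sig lam *\<^sub>R (mean_inner E (G lam) (G lam)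
      * complex_of_real (36 * inverse (8 + 1 / ((- lam\<^sup>2 + 6 * lam - 1) / 8))))" for lam
    unfolding h_def using bfun_on_Sig[of lam] by (auto simp: indicator_def)
  hence he: "h = (\<lambda>lam. indicator Sig lam *\<^sub>R (mean_inner E (G lam) (G lam)
      * complex_of_real (36 * inverse (8 + 1 / ((- lam\<^sup>2 + 6 * lam - 1) / 8)))))" by blast
  have "(\<lambda>lam. complex_of_real (36 * inverse (8 + 1 / ((- lam\<^sup>2 + 6 * lam - 1) / 8)))) \<in> borel_measurable mu"
    by (rule borel_measurable_mu) measurable
  hence hm: "h \<in> borel_measurable mu"
    unfolding he
    by (intro borel_measurable_scaleR borel_measurable_times m borel_measurable_indicator) (auto simp: Sig_def)
  have qm: "(\<lambda>lam. complex_of_real (qlim lam)) \<in> borel_measurable mu" using qlim_measurable by measurable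
  have hq: "AE lam in mu. h lam = of_real (qlim lam)"
    using AE
  proof eventually_elim
    case (elim lam)
    hence int: "lam \<in> {3 - 2 * sqrt 2 <..< 3 + 2 * sqrt 2}" by (simp add: good_def)
    hence "lam \<in> Sig" by (auto simp: Sig_def)
    moreover have "mean_inner E (G lam) (G lam) = of_real (bfun lam / 36 * qlim lam)"
      using elim by (intro mean_inner_eq[OF E_nonempty]) auto
    \<comment> \<open>The factors b/36 and 36/b cancel, as b is positive in the interior.\<close>
    ultimately show ?case using bfun_eq_wave_base(2)[OF int] by (simp add: h_def field_simps)
  qed
  have qi: "integrable mu (\<lambda>lam. complex_of_real (qlim lam))" using qlim_integral(1) by simp
  show ?int unfolding set_integrable_def h_def[abs_def, symmetric]
    using qi integrable_cong_AE[OF hm qm hq] by simp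
  show ?eq unfolding set_lebesgue_integral_def h_def[abs_def, symmetric]
    using integral_cong_AE[OF hm qm hq] by simp
qed

end

theorem corollary4p24:
  fixes V :: "'v set" and E :: "'v set set" and F :: "'v set \<Rightarrow> complex"
  assumes tree: "regular_tree 3 V E"
    and F: "in_l2 E F"
  shows "in_l2 E (P6 E F) \<and>
    (\<exists>G. is_Plam E F G) \<and>
    (\<forall>G. is_Plam E F G \<longrightarrow>
       (AE lam in mu. \<exists>L. has_mean_inner E (G lam) (G lam) L) \<and>
       set_integrable mu Sig
         (\<lambda>lam. mean_inner E (G lam) (G lam) * of_real (36 * inverse (bfun lam))) \<and>
       of_real (l2_norm_sq E F) =
         of_real (l2_norm_sq E (P6 E F)) +
         (LINT lam:Sig|mu. mean_inner E (G lam) (G lam) * of_real (36 * inverse (bfun lam))))"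
proof -
  interpret l2_function V E F by unfold_locales (rule tree F)+
  show ?thesis
    using P6_in_l2 is_Plam_Plam Plam_conclusion plancherel by (auto simp flip: of_real_add)
qed

end
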